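(* Let $A$ be an expansive $n\times n$ real matrix, $M_{\rm HL}$ the associated anisotropic Hardy-Littlewood maximal operator, and $r\in(1,\infty]$. (i) If $p\in(1,\infty)$ and $q\in(0,\infty]$, then there exists a positive constant $C_9$ such that, for all sequences $\{f_j\}_j$ of measurable functions on $\mathbb R^n$, $$\Big\|\Big\{\sum_j[M_{\rm HL}(f_j)]^r\Big\}^{1/r}\Big\|_{L^{p,q}(\mathbb R^n)}\le C_9\Big\|\Big[\sum_j|f_j|^r\Big]^{1/r}\Big\|_{L^{p,q}(\mathbb R^n)}.$$ (ii) If $p\in(0,\infty)$, $q\in(0,\infty]$ and $s\in(0,\min\{r,p\})$, then there exists a positive constant $C_{10}$ such that, for all sequences $\{f_j\}_j$ of measurable functions on $\mathbb R^n$, $$\Big\|\Big\{\sum_j[M_{\rm HL}(f_j)]^{r/s}\Big\}^{1/r}\Big\|_{L^{p,q}(\mathbb R^n)}\le C_{10}\Big\|\Big[\sum_j|f_j|^{r/s}\Big]^{1/r}\Big\|_{L^{p,q}(\mathbb R^n)}.$$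
   Context: Lorentz spaces: for $p\in(0,\infty)$, $q\in(0,\infty]$, $\|f\|_{L^{p,q}}:=\{\frac qp\int_0^\infty[t^{1/p}f^*(t)]^q\frac{dt}t\}^{1/q}$ if $q<\infty$ and $\|f\|_{L^{p,\infty}}:=\sup_{t>0}t^{1/p}f^*(t)$; here $f^*(t):=\inf\{\alpha\in(0,\infty): d_f(\alpha)\le t\}$ and $d_f(\alpha):=|\{x:|f(x)|>\alpha\}|$. The inequalities are understood in $[0,\infty]$. A real $n\times n$ matrix $A$ is expansive (a dilation) if all its eigenvalues satisfy $|\lambda|>1$. Fix an open ellipsoid $\Delta$ centered at the origin with $|\Delta|=1$ and some $c>1$ with $\Delta\subset c\Delta\subset A\Delta$ (such exist), set $B_k:=A^k\Delta$ for $k\in\mathbb Z$ and $\mathfrak B:=\{x+B_k:x\in\mathbb R^n,\ k\in\mathbb Z\}$. The Hardy-Littlewood maximal function is $M_{\rm HL}(f)(x):=\sup_{x\in B\in\mathfrak B}\frac1{|B|}\int_B|f(z)|\,dz$. When $r=\infty$ the usual modification is made: $\{\sum_j a_j^r\}^{1/r}$ means $\sup_j a_j$, and $\{\sum_j a_j^{r/s}\}^{1/r}$ means $\sup_j a_j^{1/s}$, for $a_j\ge0$. *)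

theory Defs
  imports "HOL-Analysis.Analysis"
begin

text \<open>Only used with exponent \<open>a > 0\<close>, hence \<open>0\<close> and \<open>\<infinity>\<close> are fixed points.\<close>

definition enn_powr :: "ennreal \<Rightarrow> real \<Rightarrow> ennreal" (infixr "powre" 80) where
  "x powre a = (if x = \<infinity> then \<infinity> else ennreal (enn2real x powr a))"

text \<open>
  Functions are given through their modulus, as functions into \<open>[0,\<infinity>]\<close>, since the
  maximal functions and \<open>\<ell>\<^sup>r\<close> sums may be infinite.
\<close>

definition distribution_fun :: "('a::euclidean_space \<Rightarrow> ennreal) \<Rightarrow> ennreal \<Rightarrow> ennreal" where
  "distribution_fun F \<alpha> = emeasure lebesgue {x. F x > \<alpha>}"

text \<open>The infimum of the empty set is \<open>\<infinity>\<close>.\<close>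

definition decr_rearrangement :: "('a::euclidean_space \<Rightarrow> ennreal) \<Rightarrow> real \<Rightarrow> ennreal" where
  "decr_rearrangement F t =
     Inf {\<alpha>. 0 < \<alpha> \<and> \<alpha> < \<infinity> \<and> distribution_fun F \<alpha> \<le> ennreal t}"

definition lorentz_norm :: "real \<Rightarrow> ennreal \<Rightarrow> ('a::euclidean_space \<Rightarrow> ennreal) \<Rightarrow> ennreal" where
  "lorentz_norm p q F =
     (if q = \<infinity>
      then SUP t\<in>{0<..}. ennreal (t powr (1 / p)) * decr_rearrangement F t
      else (ennreal (enn2real q / p) *
            (\<integral>\<^sup>+t\<in>{0<..}. (ennreal (t powr (1 / p)) * decr_rearrangement F t) powre enn2real q
                              / ennreal t \<partial>lborel))
           powre (1 / enn2real q))"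

definition lr_norm :: "ennreal \<Rightarrow> (nat \<Rightarrow> ennreal) \<Rightarrow> ennreal" where
  "lr_norm r a =
     (if r = \<infinity> then SUP j. a j
      else (\<Sum>j. a j powre enn2real r) powre (1 / enn2real r))"

text \<open>For \<open>r = \<infinity>\<close> the outer exponent \<open>1 / r\<close> and the inner \<open>r / s\<close> leave \<open>a j powre (1 / s)\<close>.\<close>

definition lrs_norm :: "ennreal \<Rightarrow> real \<Rightarrow> (nat \<Rightarrow> ennreal) \<Rightarrow> ennreal" where
  "lrs_norm r s a =
     (if r = \<infinity> then SUP j. a j powre (1 / s)
      else (\<Sum>j. a j powre (enn2real r / s)) powre (1 / enn2real r))"

definition complex_eigenvalue :: "real^'n^'n \<Rightarrow> complex \<Rightarrow> bool" where
  "complex_eigenvalue A l \<longleftrightarrow>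
     (\<exists>v::complex^'n. v \<noteq> 0 \<and> (\<chi> i j. complex_of_real (A $ i $ j)) *v v = l *s v)"

definition expansive :: "real^'n^'n \<Rightarrow> bool" where
  "expansive A \<longleftrightarrow> (\<forall>l. complex_eigenvalue A l \<longrightarrow> cmod l > 1)"

definition centered_open_ellipsoid :: "(real^'n) set \<Rightarrow> bool" where
  "centered_open_ellipsoid E \<longleftrightarrow>
     (\<exists>P::real^'n^'n. invertible P \<and> E = {x. norm (P *v x) < 1})"

text \<open>The operation \<open>(^)\<close> on \<open>real^'n^'n\<close> is componentwise, so matrix powers are defined here.\<close>

definition matrix_powi :: "real^'n^'n \<Rightarrow> int \<Rightarrow> real^'n^'n" where
  "matrix_powi A k =
     (if k \<ge> 0 then (((**) A) ^^ nat k) (mat 1)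
      else (((**) (matrix_inv A)) ^^ nat (- k)) (mat 1))"

definition dilated_ball :: "real^'n^'n \<Rightarrow> (real^'n) set \<Rightarrow> int \<Rightarrow> (real^'n) set" where
  "dilated_ball A \<Delta> k = (\<lambda>z. matrix_powi A k *v z) ` \<Delta>"

definition dilated_balls :: "real^'n^'n \<Rightarrow> (real^'n) set \<Rightarrow> (real^'n) set set" where
  "dilated_balls A \<Delta> = {(+) x ` dilated_ball A \<Delta> k | x k. True}"

definition HL_maximal ::
  "real^'n^'n \<Rightarrow> (real^'n) set \<Rightarrow> (real^'n \<Rightarrow> complex) \<Rightarrow> real^'n \<Rightarrow> ennreal" where
  "HL_maximal A \<Delta> f x =
     (SUP B\<in>{B \<in> dilated_balls A \<Delta>. x \<in> B}.
        (\<integral>\<^sup>+z\<in>B. ennreal (cmod (f z)) \<partial>lebesgue) / emeasure lebesgue B)"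

end

theory Submission
  imports Defs
begin

text \<open>
  All functions are replaced by their moduli, so the work takes place among measurable functions
  with values in \<open>[0, \<infinity>]\<close>. Two reductions come first. Part (i) is the case \<open>s = 1\<close> of part (ii), and
  \<open>r = \<infinity>\<close> is a scalar inequality, because \<open>SUP j. M f\<^sub>j \<le> M (SUP j. f\<^sub>j)\<close>; a scalar inequality is the case of
  a sequence with one nonzero entry. Since \<open>\<parallel>F\<^sup>e\<parallel>\<close> in \<open>L\<^sup>p\<^sup>,\<^sup>q\<close> is the \<open>e\<close>-th power of \<open>\<parallel>F\<parallel>\<close> in \<open>L\<^sup>p\<^sup>e\<^sup>,\<^sup>q\<^sup>e\<close>
  (\<open>lorentz_norm_powre\<close>), everything else follows from one inequality: with \<open>\<Phi> = \<Sum>j. f\<^sub>j\<^sup>r\<close> and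
  \<open>\<Gamma> = \<Sum>j. (M f\<^sub>j)\<^sup>r\<close>, where \<open>1 < r < \<infinity>\<close>, the \<open>L\<^sup>P\<^sup>,\<^sup>Q\<close> norm of \<open>\<Gamma>\<close> is bounded by that of \<open>\<Phi>\<close> for all
  \<open>P > 1/r\<close> and \<open>Q > 0\<close> (\<open>vector_maximal_lorentz\<close>).

  For \<open>P = 1\<close> and \<open>Q = 1\<close> this is the boundedness of \<open>M\<close> on \<open>L\<^sup>r\<close>, summed over \<open>j\<close>. The same summation works with a
  weight, so the other exponents are reached by extrapolation with Muckenhoupt \<open>A\<^sub>1\<close> weights \<open>w\<close>, the
  weights with \<open>M w \<le> K w\<close>. A Vitali covering argument bounds the maximal operator \<open>M\<^sub>w\<close> of the measure
  \<open>w dx\<close> on \<open>L\<^sup>r(w dx)\<close> (\<open>maximal_strong_type\<close>). The \<open>A\<^sub>1\<close> condition yields the two pointwise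
  bounds \<open>M f \<le> K M\<^sub>w f\<close> and \<open>M f \<le> K w M\<^sub>w (f / w)\<close>, hence the boundedness of \<open>M\<close> on \<open>L\<^sup>r(w dx)\<close> and on
  \<open>L\<^sup>r(w\<^sup>1\<^sup>-\<^sup>r dx)\<close>. The Rubio de Francia iteration (\<open>rubio_de_francia\<close>) dominates any nonzero function in \<open>L\<^sup>p\<close>, \<open>p > 1\<close>,
  by an \<open>A\<^sub>1\<close> weight of comparable norm. Dominating the indicator of a subset of \<open>{\<Gamma> > m}\<close> gives a weak
  type inequality at every exponent \<open>u > 1\<close> (\<open>vector_weak_type_upper\<close>), and dominating a power of \<open>\<Phi>\<close> gives
  one at every \<open>v\<close> between \<open>1/r\<close> and \<open>1\<close> (\<open>vector_weak_type_lower\<close>).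

  Interpolation between \<open>v < P < u\<close> then has to reach all \<open>Q\<close>, also \<open>Q < 1\<close>. Truncating at height \<open>m\<close>
  bounds the distribution function of \<open>\<Gamma>\<close> at \<open>c m\<close> by truncated moments of \<open>\<Phi>\<close>. These moments are estimated
  not by integrals but by suprema of \<open>s\<^sup>a d\<^sub>\<Phi>(s)\<close>, and a supremum commutes with the power \<open>Q/P\<close>
  whether it is smaller or larger than \<open>1\<close>; two applications of Tonelli's theorem finish the proof
  (\<open>strong_lorentz_interpolation\<close>).

  The geometry of the dilation enters only through the axioms of \<open>ball_space\<close>: inclusion of neighbouring
  balls in enlarged ones, doubling, and exhaustion of the space.
\<close>

section \<open>Powers in the extended nonnegative reals\<close>

lemma powre_top [simp]: "\<infinity> powre a = \<infinity>"
  by (simp add: enn_powr_def)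

lemma powre_top' [simp]: "top powre a = top"
  using powre_top by simp

lemma powre_zero [simp]: "0 powre a = 0"
  by (simp add: enn_powr_def)

lemma powre_ennreal: "0 \<le> x \<Longrightarrow> ennreal x powre a = ennreal (x powr a)"
  by (simp add: enn_powr_def)

lemma powre_one [simp]: "x powre 1 = x"
  by (cases x) (auto simp: powre_ennreal)

lemma one_powre [simp]: "1 powre a = 1"
  using powre_ennreal[of 1 a] by simp

lemma powre_eq_zero_iff [simp]: "x powre a = 0 \<longleftrightarrow> x = 0"
  by (cases x) (auto simp: powre_ennreal)

lemma powre_eq_top_iff [simp]: "x powre a = top \<longleftrightarrow> x = top"
  by (cases x) (auto simp: powre_ennreal)

lemma powre_strict_mono:
  assumes "0 < a" "x < y"
  shows "x powre a < y powre a"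
proof (cases y)
  case (real b)
  then obtain c where "x = ennreal c" "0 \<le> c" "c < b"
    using assms(2) by (cases x) (auto simp: ennreal_less_iff)
  then show ?thesis
    using real assms(1) by (auto simp: powre_ennreal ennreal_less_iff powr_less_mono2)
next
  case top
  then have "x powre a \<noteq> top"
    using assms by simp
  then show ?thesis
    using top by (simp add: less_top[symmetric])
qed

lemma powre_less_iff: "0 < a \<Longrightarrow> x powre a < y powre a \<longleftrightarrow> x < y"
  by (metis linorder_less_linear powre_strict_mono order_less_asym)

lemma powre_le_iff: "0 < a \<Longrightarrow> x powre a \<le> y powre a \<longleftrightarrow> x \<le> y"
  by (meson linorder_not_le powre_less_iff)

lemma powre_mono: "0 < a \<Longrightarrow> x \<le> y \<Longrightarrow> x powre a \<le> y powre a"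
  by (simp add: powre_le_iff)

lemma powre_powre: "(x powre a) powre b = x powre (a * b)"
  by (cases x) (auto simp: powre_ennreal powr_powr)

lemma powre_mult:
  assumes "0 < a"
  shows "(x * y) powre a = x powre a * y powre a"
proof (cases "x = top \<or> y = top")
  case True
  then show ?thesis
    by (auto simp: ennreal_mult_top ennreal_top_mult)
next
  case False
  then obtain b c where "x = ennreal b" "0 \<le> b" "y = ennreal c" "0 \<le> c"
    by (metis ennreal_cases)
  then show ?thesis
    by (simp add: powre_ennreal ennreal_mult[symmetric] powr_mult)
qed

lemma powre_add:
  assumes "0 < a" "0 < b"
  shows "x powre a * x powre b = x powre (a + b)"
  by (cases x) (auto simp: powre_ennreal ennreal_mult[symmetric] powr_add)

lemma powre_add_le:
  assumes "0 < a"
  shows "(x + y) powre a \<le> ennreal (2 powr a) * (x powre a + y powre a)"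
proof -
  have "x + y \<le> ennreal 2 * max x y"
    by (metis add_mono ennreal_numeral max.cobounded1 max.cobounded2 mult_2 zero_le_numeral)
  then have "(x + y) powre a \<le> (ennreal 2 * max x y) powre a"
    using assms by (rule powre_mono[rotated])
  also have "\<dots> = ennreal (2 powr a) * max x y powre a"
    using assms by (simp add: powre_mult powre_ennreal del: ennreal_numeral)
  also have "\<dots> \<le> ennreal (2 powr a) * (x powre a + y powre a)"
    by (intro mult_left_mono) (auto simp: max_def)
  finally show ?thesis .
qed

lemma powre_divide:
  assumes "0 < y" "y < top"
  shows "(x / y) powre a = x powre a / y powre a"
proof -
  obtain c where c: "y = ennreal c" "0 < c"
    using assms by (cases y) auto
  show ?thesis
  proof (cases x)
    case (real b)
    then show ?thesis
      using c by (simp add: powre_ennreal divide_ennreal powr_divide)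
  next
    case top
    then show ?thesis
      using c by (simp add: powre_ennreal ennreal_top_divide)
  qed
qed

lemma powre_SUP:
  assumes "0 < a"
  shows "(SUP i\<in>I. g i) powre a = (SUP i\<in>I. g i powre a)"
proof (rule antisym)
  have inv: "(x powre (1 / a)) powre a = x" "(x powre a) powre (1 / a) = x" for x
    using assms by (simp_all add: powre_powre)
  have "(SUP i\<in>I. g i) \<le> (SUP i\<in>I. g i powre a) powre (1 / a)"
  proof (rule SUP_least)
    fix i assume "i \<in> I"
    then have "(g i powre a) powre (1 / a) \<le> (SUP i\<in>I. g i powre a) powre (1 / a)"
      using assms by (intro powre_mono SUP_upper) auto
    then show "g i \<le> (SUP i\<in>I. g i powre a) powre (1 / a)"
      by (simp add: inv)
  qed
  then have "(SUP i\<in>I. g i) powre a \<le> ((SUP i\<in>I. g i powre a) powre (1 / a)) powre a"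
    using assms by (intro powre_mono) auto
  then show "(SUP i\<in>I. g i) powre a \<le> (SUP i\<in>I. g i powre a)"
    by (simp add: inv)
  show "(SUP i\<in>I. g i powre a) \<le> (SUP i\<in>I. g i) powre a"
    using assms by (intro SUP_least powre_mono SUP_upper) auto
qed

lemma borel_measurable_powre [measurable (raw)]:
  "f \<in> borel_measurable M \<Longrightarrow> (\<lambda>x. f x powre a) \<in> borel_measurable M"
  unfolding enn_powr_def by (intro measurable_If) auto

lemma ennreal_powr_mult: "ennreal (x powr a) * ennreal (x powr b) = ennreal (x powr (a + b))"
  by (simp add: ennreal_mult[symmetric] powr_add)

lemma ennreal_divide_self_le_one: "(x :: ennreal) / x \<le> 1"
  by (cases "x = 0 \<or> x = top") (auto simp: ennreal_divide_self less_top)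

text \<open>
  The conventions \<open>a / \<infinity> = 0\<close> and \<open>0 / 0 = 0\<close> make this true for all \<open>a\<close> and \<open>b\<close>, so that averages
  over balls can be compared with a level without discussing the size of the denominator.
\<close>

lemma ennreal_mult_le_of_less_divide:
  assumes "(l :: ennreal) < a / b"
  shows "l * b \<le> a"
proof (cases "b = 0 \<or> b = top")
  case True
  then show ?thesis
    using assms by auto
next
  case False
  then have "l * b \<le> a / b * b"
    using assms by (intro mult_right_mono) auto
  also have "\<dots> = a"
    using False by (simp add: ennreal_divide_times ennreal_divide_self less_top)
  finally show ?thesis .
qed

lemma ennreal_divide_le_mult_divide:
  fixes F K \<mu> G W :: ennreal
  assumes "0 < W" "W < top" "0 < \<mu>" "\<mu> < top" and le: "F * W \<le> K * \<mu> * G"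
  shows "F / \<mu> \<le> K * (G / W)"
proof -
  have "F = F * W / W"
    using assms by (simp add: ennreal_mult_divide_eq)
  also have "\<dots> \<le> K * \<mu> * G / W"
    using le by (rule divide_right_mono_ennreal)
  also have "\<dots> = K * (G / W) * \<mu>"
    by (simp add: ennreal_times_divide mult.assoc mult.commute mult.left_commute)
  finally have "F / \<mu> \<le> K * (G / W) * \<mu> / \<mu>"
    by (rule divide_right_mono_ennreal)
  then show ?thesis
    using assms by (simp add: ennreal_mult_divide_eq)
qed

text \<open>
  Young's inequality without its sharp constants: compare \<open>b\<close> with \<open>a\<^sup>u\<^sup>-\<^sup>1\<close>, and replace one factor
  accordingly.
\<close>

lemma young_crude:
  fixes a b :: ennreal
  assumes u: "1 < u"
  shows "a * b \<le> a powre u + b powre (u / (u - 1))"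
proof (cases "b \<le> a powre (u - 1)")
  case True
  then have "a * b \<le> a * a powre (u - 1)"
    by (rule mult_left_mono) simp
  also have "\<dots> = a powre u"
    using powre_add[of 1 "u - 1" a] u by simp
  finally show ?thesis
    by (simp add: add_increasing2)
next
  case False
  then have "a powre (u - 1) \<le> b"
    by simp
  then have "(a powre (u - 1)) powre (1 / (u - 1)) \<le> b powre (1 / (u - 1))"
    using u by (intro powre_mono) auto
  then have "a \<le> b powre (1 / (u - 1))"
    using u by (simp add: powre_powre)
  then have "a * b \<le> b powre (1 / (u - 1)) * b"
    by (rule mult_right_mono) simp
  also have "\<dots> = b powre (1 / (u - 1) + 1)"
    using powre_add[of "1 / (u - 1)" 1 b] u by simp
  also have "1 / (u - 1) + 1 = u / (u - 1)"
    using u by (simp add: field_simps)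
  finally show ?thesis
    by (simp add: add_increasing)
qed

lemma suminf_geometric_le:
  assumes "\<And>k. a k \<le> (b :: ennreal)"
  shows "(\<Sum>k. ennreal ((1 / 2) ^ k) * a k) \<le> 2 * b"
proof -
  have "(\<Sum>k. ennreal ((1 / 2) ^ k) * a k) \<le> (\<Sum>k. ennreal ((1 / 2) ^ k) * b)"
    using assms by (intro suminf_le mult_left_mono) auto
  also have "\<dots> = (\<Sum>k. ennreal ((1 / 2) ^ k)) * b"
    by (rule ennreal_suminf_multc)
  also have "(\<Sum>k. ennreal ((1 / 2) ^ k)) = ennreal (\<Sum>k. (1 / 2) ^ k)"
    by (intro suminf_ennreal2 summable_geometric) auto
  also have "\<dots> = 2"
    by (subst suminf_geometric) auto
  finally show ?thesis .
qed

lemma ennreal_inverse_antimono: "(x :: ennreal) \<le> y \<Longrightarrow> inverse y \<le> inverse x"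
proof (cases "x = 0 \<or> y = top")
  case False
  assume le: "x \<le> y"
  obtain b where b: "y = ennreal b" "0 \<le> b"
    using False by (cases y) auto
  obtain a where a: "x = ennreal a" "0 < a"
    using False le b by (cases x) (auto simp: top_unique)
  then show ?thesis
    using le b by (simp add: inverse_ennreal ennreal_leI)
qed auto

lemma ennreal_le_if_reals_below:
  assumes "\<And>t. 0 < t \<Longrightarrow> ennreal t < x \<Longrightarrow> ennreal t \<le> y"
  shows "x \<le> y"
proof (rule ccontr)
  assume "\<not> x \<le> y"
  then obtain z where z: "y < z" "z < x"
    using dense[of y x] by (auto simp: not_le)
  then obtain t where "z = ennreal t" "0 \<le> t"
    by (cases z) auto
  moreover have "0 < z"
    using z(1) by (rule order_le_less_trans[rotated]) simp
  ultimately show False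
    using assms[of t] z by (auto simp: not_le)
qed

lemma ennreal_eqI_reals_below:
  assumes "\<And>t. 0 < t \<Longrightarrow> ennreal t < x \<longleftrightarrow> ennreal t < y"
  shows "x = y"
  by (rule antisym; rule ennreal_le_if_reals_below; metis assms less_imp_le)

lemma ennreal_divide_powre:
  assumes "0 < s"
  shows "(L / ennreal s) powre p = L powre p * ennreal (s powr - p)"
proof -
  have "(L / ennreal s) powre p = L powre p / ennreal s powre p"
    using assms by (intro powre_divide) auto
  then show ?thesis
    using assms by (simp add: powre_ennreal divide_ennreal_def inverse_ennreal powr_minus)
qed

text \<open>
  This turns a bound on \<open>s\<^sup>a\<^sup>\<theta> d\<^sup>\<theta>\<close> into the bound on \<open>s\<^sup>a d\<close> that the truncation estimates take as
  input.
\<close>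

lemma le_powre_times_powr_minus:
  assumes \<theta>: "0 < \<theta>" and s: "0 < s" and le: "ennreal (s powr (a * \<theta>)) * d powre \<theta> \<le> X"
  shows "d \<le> X powre (1 / \<theta>) * ennreal (s powr - a)"
proof -
  have "(ennreal (s powr a) * d) powre \<theta> \<le> X"
    using le \<theta> by (simp add: powre_mult powre_ennreal powr_powr)
  then have "((ennreal (s powr a) * d) powre \<theta>) powre (1 / \<theta>) \<le> X powre (1 / \<theta>)"
    using \<theta> by (intro powre_mono) auto
  then have le: "ennreal (s powr a) * d \<le> X powre (1 / \<theta>)"
    using \<theta> by (simp add: powre_powre)
  have "d = ennreal (s powr a) * ennreal (s powr - a) * d"
    using s by (simp add: ennreal_powr_mult)
  also have "\<dots> = ennreal (s powr a) * d * ennreal (s powr - a)"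
    by (simp only: mult_ac)
  also have "\<dots> \<le> X powre (1 / \<theta>) * ennreal (s powr - a)"
    using le by (rule mult_right_mono) simp
  finally show ?thesis .
qed

section \<open>The layer cake formula\<close>

lemma nn_integral_powr_below:
  assumes "0 < a" "0 \<le> c"
  shows "(\<integral>\<^sup>+l. ennreal (l powr (a - 1)) * indicator {0<..<c} l \<partial>lborel) = ennreal (c powr a / a)"
proof -
  have "((\<lambda>l. l powr (a - 1)) has_integral (c powr a / a)) {0..c}"
    using has_integral_powr_from_0[of "a - 1" c] assms by simp
  then have "((\<lambda>l. l powr (a - 1) * indicator {0..c} l) has_integral (c powr a / a)) UNIV"
    by (subst (asm) has_integral_restrict_UNIV[symmetric])
       (auto elim!: has_integral_eq[rotated] simp: indicator_def)
  then have "(\<integral>\<^sup>+l. ennreal (l powr (a - 1) * indicator {0..c} l) \<partial>lborel) = ennreal (c powr a / a)"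
    by (intro nn_integral_has_integral_lborel) auto
  moreover have "AE l in lborel. l \<noteq> 0" "AE l in lborel. l \<noteq> c"
    by (rule AE_lborel_singleton)+
  then have "AE l in lborel. ennreal (l powr (a - 1)) * indicator {0<..<c} l
      = ennreal (l powr (a - 1) * indicator {0..c} l)"
    by eventually_elim (auto simp: indicator_def)
  then have "(\<integral>\<^sup>+l. ennreal (l powr (a - 1)) * indicator {0<..<c} l \<partial>lborel)
      = (\<integral>\<^sup>+l. ennreal (l powr (a - 1) * indicator {0..c} l) \<partial>lborel)"
    by (rule nn_integral_cong_AE)
  ultimately show ?thesis
    by simp
qed

lemma nn_integral_powr_above:
  assumes "0 < a" "0 < c"
  shows "(\<integral>\<^sup>+l. ennreal (l powr (- a - 1)) * indicator {c<..} l \<partial>lborel) = ennreal (c powr - a / a)"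
proof -
  have "((\<lambda>l. l powr (- a - 1)) has_integral (c powr - a / a)) {c..}"
    using has_integral_powr_to_inf[of "- a - 1" c] assms by simp
  then have "((\<lambda>l. l powr (- a - 1) * indicator {c..} l) has_integral (c powr - a / a)) UNIV"
    by (subst (asm) has_integral_restrict_UNIV[symmetric])
       (auto elim!: has_integral_eq[rotated] simp: indicator_def)
  then have "(\<integral>\<^sup>+l. ennreal (l powr (- a - 1) * indicator {c..} l) \<partial>lborel) = ennreal (c powr - a / a)"
    by (intro nn_integral_has_integral_lborel) auto
  moreover have "AE l in lborel. l \<noteq> c"
    by (rule AE_lborel_singleton)
  then have "AE l in lborel. ennreal (l powr (- a - 1)) * indicator {c<..} l
      = ennreal (l powr (- a - 1) * indicator {c..} l)"
    by eventually_elim (auto simp: indicator_def)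
  then have "(\<integral>\<^sup>+l. ennreal (l powr (- a - 1)) * indicator {c<..} l \<partial>lborel)
      = (\<integral>\<^sup>+l. ennreal (l powr (- a - 1) * indicator {c..} l) \<partial>lborel)"
    by (rule nn_integral_cong_AE)
  ultimately show ?thesis
    by simp
qed

lemma borel_measurable_antimono_ennreal:
  fixes h :: "real \<Rightarrow> ennreal"
  assumes "antimono h"
  shows "h \<in> borel_measurable borel"
proof (rule borel_measurableI_greater)
  fix y
  have "is_interval {l. y < h l}"
    unfolding is_interval_1 using assms by (auto simp: antimono_def intro: order_less_le_trans)
  then show "{l \<in> space borel. y < h l} \<in> sets borel"
    using real_interval_borel_measurable by simp
qed

lemma borel_measurable_mono_ennreal:
  fixes h :: "real \<Rightarrow> ennreal"
  assumes "mono h"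
  shows "h \<in> borel_measurable borel"
proof -
  have "antimono (\<lambda>x. h (- x))"
    using assms by (intro antimonoI) (auto simp: mono_def)
  then have "(\<lambda>x. h (- x)) \<in> borel_measurable borel"
    by (rule borel_measurable_antimono_ennreal)
  then have "(\<lambda>x. h (- (- x))) \<in> borel_measurable borel"
    by (rule measurable_compose[rotated]) simp
  then show ?thesis
    by simp
qed

text \<open>
  The identity \<open>y\<^sup>a = \<integral>\<^sub>0\<^sup>y a l\<^sup>a\<^sup>-\<^sup>1 dl\<close>, valid for \<open>y = \<infinity>\<close> as well.
\<close>

lemma powre_eq_nn_integral:
  assumes "0 < a"
  shows "ennreal a * (\<integral>\<^sup>+l. ennreal (l powr (a - 1)) * indicator {l. 0 < l \<and> ennreal l < y} l \<partial>lborel)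
    = y powre a"
proof (cases y)
  case (real c)
  then have eq: "{l. 0 < l \<and> ennreal l < y} = {0<..<c}"
    by (auto simp: ennreal_less_iff)
  show ?thesis
    unfolding eq nn_integral_powr_below[OF assms real(1)]
    using real assms by (simp add: powre_ennreal ennreal_mult[symmetric])
next
  case top
  let ?I = "ennreal a * (\<integral>\<^sup>+l. ennreal (l powr (a - 1)) * indicator {l. 0 < l \<and> ennreal l < y} l \<partial>lborel)"
  have "ennreal x \<le> ?I" if "0 \<le> x" for x
  proof -
    have "ennreal x = ennreal a * ennreal ((x powr (1 / a)) powr a / a)"
      using assms that by (simp add: powr_powr ennreal_mult[symmetric])
    also have "\<dots> = ennreal a * (\<integral>\<^sup>+l. ennreal (l powr (a - 1)) * indicator {0<..<x powr (1 / a)} l \<partial>lborel)"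
      using assms by (subst nn_integral_powr_below) auto
    also have "\<dots> \<le> ?I"
      using top by (intro mult_left_mono nn_integral_mono) (auto simp: indicator_def)
    finally show ?thesis .
  qed
  note le = this
  have "?I = top"
  proof (cases ?I)
    case (real x)
    have "ennreal (x + 1) \<le> ennreal x"
      using le[of "x + 1"] real by simp
    then show ?thesis
      using real by (simp add: ennreal_le_iff)
  qed
  then show ?thesis
    using top by simp
qed

text \<open>
  Tonelli's theorem applied to the previous identity. The factor \<open>w\<close> lets the same formula serve for
  the measure \<open>w dx\<close> and, in the proof of the strong type inequality, for \<open>g w dx\<close>.
\<close>

lemma (in sigma_finite_measure) layer_cake:
  assumes [measurable]: "h \<in> borel_measurable M" "w \<in> borel_measurable M" and a: "0 < a"
  shows "(\<integral>\<^sup>+x. h x powre a * w x \<partial>M) =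
    ennreal a * (\<integral>\<^sup>+l\<in>{0<..}. ennreal (l powr (a - 1)) *
      emeasure (density M w) {x\<in>space M. ennreal l < h x} \<partial>lborel)"
proof -
  interpret P: pair_sigma_finite lborel M ..
  let ?k = "\<lambda>l x. ennreal (l powr (a - 1)) * indicator {l. 0 < l \<and> ennreal l < h x} l * w x"
  have meas: "(\<lambda>(l, x). ?k l x) \<in> borel_measurable (lborel \<Otimes>\<^sub>M M)"
  proof -
    have "(\<lambda>z. ennreal (fst z powr (a - 1)) *
        indicator {z \<in> space (lborel \<Otimes>\<^sub>M M). 0 < fst z \<and> ennreal (fst z) < h (snd z)} z * w (snd z))
        \<in> borel_measurable (lborel \<Otimes>\<^sub>M M)"
      by measurable
    then show ?thesis
      by (rule measurable_cong[THEN iffD1, rotated]) (auto simp: indicator_def space_pair_measure)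
  qed
  have "(\<integral>\<^sup>+x. h x powre a * w x \<partial>M) = (\<integral>\<^sup>+x. ennreal a * (\<integral>\<^sup>+l. ?k l x \<partial>lborel) \<partial>M)"
    unfolding powre_eq_nn_integral[OF a, symmetric]
    by (intro nn_integral_cong) (subst nn_integral_multc, auto simp: mult.assoc)
  also have "\<dots> = ennreal a * (\<integral>\<^sup>+x. (\<integral>\<^sup>+l. ?k l x \<partial>lborel) \<partial>M)"
    using measurable_pair_swap[OF meas] by (intro nn_integral_cmult lborel.borel_measurable_nn_integral) simp
  also have "(\<integral>\<^sup>+x. (\<integral>\<^sup>+l. ?k l x \<partial>lborel) \<partial>M) = (\<integral>\<^sup>+l. (\<integral>\<^sup>+x. ?k l x \<partial>M) \<partial>lborel)"
    using P.Fubini'[OF meas] by simp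
  also have "\<dots> = (\<integral>\<^sup>+l\<in>{0<..}. ennreal (l powr (a - 1)) *
      emeasure (density M w) {x\<in>space M. ennreal l < h x} \<partial>lborel)"
  proof (intro nn_integral_cong)
    fix l :: real
    show "(\<integral>\<^sup>+x. ?k l x \<partial>M) = ennreal (l powr (a - 1)) *
        emeasure (density M w) {x\<in>space M. ennreal l < h x} * indicator {0<..} l"
    proof (cases "0 < l")
      case True
      then have "(\<integral>\<^sup>+x. ?k l x \<partial>M) = (\<integral>\<^sup>+x. ennreal (l powr (a - 1)) *
          (w x * indicator {x\<in>space M. ennreal l < h x} x) \<partial>M)"
        by (intro nn_integral_cong) (auto simp: indicator_def)
      also have "\<dots> = ennreal (l powr (a - 1)) *
          (\<integral>\<^sup>+x. w x * indicator {x\<in>space M. ennreal l < h x} x \<partial>M)"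
        by (intro nn_integral_cmult) measurable
      finally show ?thesis
        using True by (simp add: emeasure_density)
    qed simp
  qed
  finally show ?thesis .
qed

section \<open>Ball spaces and weighted maximal functions\<close>

text \<open>
  A family of open sets with just enough structure for the Vitali covering lemma. Balls are named by indices,
  since a set may be a ball for several centres and radii; \<open>rank\<close> plays the role of the logarithm of
  the radius and \<open>star\<close> that of a fixed enlargement. The last assumption replaces the statement that
  balls through a point grow to the whole space; it is what makes a weight that vanishes at one point
  vanish almost everywhere.
\<close>

locale ball_space = sigma_finite_measure M
  for M :: "'a::second_countable_topology measure" +
  fixes B :: "'i \<Rightarrow> 'a set" and star :: "'i \<Rightarrow> 'i" and rank :: "'i \<Rightarrow> int" and D :: ennreal
  assumes borel_sets: "sets borel \<subseteq> sets M"
    and open_B: "open (B i)"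
    and pos_B: "0 < emeasure M (B i)"
    and fin_B: "emeasure M (B i) < top"
    and engulf: "rank j \<le> rank i \<Longrightarrow> B i \<inter> B j \<noteq> {} \<Longrightarrow> B j \<subseteq> B (star i)"
    and doubling: "emeasure M (B (star i)) \<le> D * emeasure M (B i)"
    and D_fin: "D < top"
    and exhausting: "\<exists>I. countable I \<and> (\<forall>i\<in>I. x \<in> B i) \<and> (\<Union>i\<in>I. B i) = UNIV"
begin

lemma open_sets: "open U \<Longrightarrow> U \<in> sets M"
  using borel_sets by auto

lemma B_sets [measurable, simp]: "B i \<in> sets M"
  by (simp add: open_B open_sets)

lemma space_UNIV: "space M = UNIV"
  using open_sets[of UNIV] sets.sets_into_space by auto

text \<open>
  The greedy choice: keep a ball of largest rank, discard all balls that meet it, since they lie in its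
  enlargement, and continue with the rest.
\<close>

lemma vitali_covering_finite:
  "finite I \<Longrightarrow> \<exists>J\<subseteq>I. disjoint_family_on B J \<and> (\<Union>i\<in>I. B i) \<subseteq> (\<Union>j\<in>J. B (star j))"
proof (induction I rule: finite_psubset_induct)
  case (psubset I)
  show ?case
  proof (cases "I = {}")
    case False
    obtain i where i: "i \<in> I" "\<And>j. j \<in> I \<Longrightarrow> rank j \<le> rank i"
      using obtains_MAX[OF psubset.hyps(1) False, of rank]
      by (metis (no_types) Max_ge finite_imageI image_eqI psubset.hyps(1))
    have ne: "B i \<noteq> {}"
      using pos_B[of i] by auto
    define I' where "I' = {j \<in> I. B i \<inter> B j = {}}"
    have "I' \<subset> I"
      using i ne by (auto simp: I'_def)
    then obtain J where J: "J \<subseteq> I'" "disjoint_family_on B J"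
        "(\<Union>i\<in>I'. B i) \<subseteq> (\<Union>j\<in>J. B (star j))"
      using psubset.IH by meson
    have "disjoint_family_on B (insert i J)"
      using J(1,2) by (auto simp: disjoint_family_on_def I'_def)
    moreover have "B j \<subseteq> (\<Union>j\<in>insert i J. B (star j))" if "j \<in> I" for j
    proof (cases "j \<in> I'")
      case True
      then show ?thesis
        using J(3) by auto
    next
      case False
      then have "B j \<subseteq> B (star i)"
        using that i by (intro engulf) (auto simp: I'_def)
      then show ?thesis
        by auto
    qed
    ultimately show ?thesis
      using J(1) i(1) \<open>I' \<subset> I\<close> by (intro exI[of _ "insert i J"]) blast
  qed (auto simp: disjoint_family_on_def)
qed

text \<open>
  The Muckenhoupt condition \<open>M w \<le> K w\<close>, required at every point rather than almost everywhere.
  The weights built below satisfy it everywhere, and the pointwise comparisons need no exceptional sets. Averages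
  are also required to be positive and finite, so that quotients by them can be cancelled.
\<close>

definition A1 :: "ennreal \<Rightarrow> ('a \<Rightarrow> ennreal) \<Rightarrow> bool" where
  "A1 K w \<longleftrightarrow> w \<in> borel_measurable M \<and>
     (\<forall>i. 0 < (\<integral>\<^sup>+x\<in>B i. w x \<partial>M) \<and> (\<integral>\<^sup>+x\<in>B i. w x \<partial>M) < top) \<and>
     (\<forall>i. \<forall>x\<in>B i. (\<integral>\<^sup>+x\<in>B i. w x \<partial>M) \<le> K * emeasure M (B i) * w x)"

text \<open>
  The maximal function of \<open>g\<close> for the measure \<open>w dx\<close>. The constant weight \<open>1\<close> gives the
  Hardy-Littlewood maximal function \<open>Mx\<close>.
\<close>

definition maximal :: "('a \<Rightarrow> ennreal) \<Rightarrow> ('a \<Rightarrow> ennreal) \<Rightarrow> 'a \<Rightarrow> ennreal" where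
  "maximal w g x = (SUP i\<in>{i. x \<in> B i}. (\<integral>\<^sup>+y\<in>B i. g y * w y \<partial>M) / (\<integral>\<^sup>+y\<in>B i. w y \<partial>M))"

abbreviation Mx :: "('a \<Rightarrow> ennreal) \<Rightarrow> 'a \<Rightarrow> ennreal" where
  "Mx \<equiv> maximal (\<lambda>_. 1)"

lemma A1_measurable: "A1 K w \<Longrightarrow> w \<in> borel_measurable M"
  by (simp add: A1_def)

lemma less_maximal_set:
  "{x. l < maximal w g x} =
    (\<Union>i\<in>{i. l < (\<integral>\<^sup>+y\<in>B i. g y * w y \<partial>M) / (\<integral>\<^sup>+y\<in>B i. w y \<partial>M)}. B i)"
  by (auto simp: maximal_def less_SUP_iff)

lemma maximal_measurable [measurable]: "maximal w g \<in> borel_measurable M"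
proof (rule borel_measurableI_greater)
  fix l
  have "open {x. l < maximal w g x}"
    unfolding less_maximal_set by (intro open_UN ballI open_B)
  then show "{x \<in> space M. l < maximal w g x} \<in> sets M"
    by (simp add: space_UNIV open_sets)
qed

text \<open>
  Every value of \<open>w\<close> on a ball controls the average of \<open>w\<close> over the enlarged ball; averaging over
  the values on the ball itself shows that \<open>w dx\<close> inherits doubling from the underlying measure.
\<close>

lemma A1_doubling:
  assumes w: "A1 K w"
  shows "emeasure (density M w) (B (star i)) \<le> K * D * emeasure (density M w) (B i)"
proof -
  have [measurable]: "w \<in> borel_measurable M"
    using w by (rule A1_measurable)
  let ?S = "\<integral>\<^sup>+x\<in>B (star i). w x \<partial>M"
  have sub: "B i \<subseteq> B (star i)"
    using engulf[of i i] pos_B[of i] by fastforce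
  have "?S * emeasure M (B i) = (\<integral>\<^sup>+x\<in>B i. ?S \<partial>M)"
    by (simp add: nn_integral_cmult_indicator)
  also have "\<dots> \<le> (\<integral>\<^sup>+x. K * emeasure M (B (star i)) * (w x * indicator (B i) x) \<partial>M)"
    using w sub by (intro nn_integral_mono) (auto simp: A1_def indicator_def)
  also have "\<dots> = K * emeasure M (B (star i)) * emeasure (density M w) (B i)"
    by (simp add: nn_integral_cmult emeasure_density)
  also have "\<dots> \<le> K * (D * emeasure M (B i)) * emeasure (density M w) (B i)"
    by (intro mult_right_mono mult_left_mono doubling) auto
  finally have "?S * emeasure M (B i) / emeasure M (B i)
      \<le> K * D * emeasure (density M w) (B i) * emeasure M (B i) / emeasure M (B i)"
    by (intro divide_right_mono_ennreal) (simp add: mult_ac)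
  then show ?thesis
    using pos_B[of i] fin_B[of i] by (simp add: ennreal_mult_divide_eq emeasure_density)
qed

text \<open>
  The level set is a union of balls on which \<open>l w(B) \<le> \<integral>\<^sub>B g w\<close>. It is open, so countably many of
  these balls suffice, and by monotone convergence finitely many; then the covering lemma and doubling
  apply.
\<close>

proposition maximal_weak_type:
  assumes w: "A1 K w" and [measurable]: "g \<in> borel_measurable M"
  shows "l * emeasure (density M w) {x. l < maximal w g x} \<le> K * D * (\<integral>\<^sup>+x. g x * w x \<partial>M)"
proof -
  have [measurable]: "w \<in> borel_measurable M"
    using w by (rule A1_measurable)
  define N where "N = density M w"
  define G where "G = density M (\<lambda>x. g x * w x)"
  have sets: "sets N = sets M" "sets G = sets M"
    by (auto simp: N_def G_def)
  define I where "I = {i. l < (\<integral>\<^sup>+y\<in>B i. g y * w y \<partial>M) / (\<integral>\<^sup>+y\<in>B i. w y \<partial>M)}"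
  have I: "l * emeasure N (B i) \<le> emeasure G (B i)" if "i \<in> I" for i
    using that by (auto simp: I_def N_def G_def emeasure_density intro: ennreal_mult_le_of_less_divide)
  have finite_case: "l * emeasure N (\<Union>i\<in>I'. B i) \<le> K * D * (\<integral>\<^sup>+x. g x * w x \<partial>M)"
    if I': "finite I'" "I' \<subseteq> I" for I'
  proof -
    obtain J where J: "J \<subseteq> I'" "disjoint_family_on B J"
        "(\<Union>i\<in>I'. B i) \<subseteq> (\<Union>j\<in>J. B (star j))"
      using vitali_covering_finite[OF I'(1)] by auto
    have fin: "finite J"
      using J(1) I'(1) finite_subset by auto
    have "l * emeasure N (\<Union>i\<in>I'. B i) \<le> l * emeasure N (\<Union>j\<in>J. B (star j))"
      using J(3) fin by (intro mult_left_mono emeasure_mono) (auto simp: sets)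
    also have "\<dots> \<le> l * (\<Sum>j\<in>J. emeasure N (B (star j)))"
      using fin by (intro mult_left_mono emeasure_subadditive_finite) (auto simp: sets)
    also have "\<dots> \<le> l * (\<Sum>j\<in>J. K * D * emeasure N (B j))"
      using A1_doubling[OF w] by (intro mult_left_mono sum_mono) (auto simp: N_def)
    also have "\<dots> = K * D * (\<Sum>j\<in>J. l * emeasure N (B j))"
      by (simp add: sum_distrib_left mult_ac)
    also have "\<dots> \<le> K * D * (\<Sum>j\<in>J. emeasure G (B j))"
      using I J(1) I'(2) by (intro mult_left_mono sum_mono) auto
    also have "(\<Sum>j\<in>J. emeasure G (B j)) = emeasure G (\<Union>j\<in>J. B j)"
      using fin J(2) by (intro sum_emeasure) (auto simp: sets)
    also have "\<dots> \<le> emeasure G (space G)"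
      by (rule emeasure_space)
    also have "\<dots> = (\<integral>\<^sup>+x. g x * w x \<partial>M)"
      by (simp add: G_def emeasure_density)
    finally show ?thesis
      by (simp add: mult_left_mono)
  qed
  obtain \<F> where \<F>: "\<F> \<subseteq> B ` I" "countable \<F>" "\<Union>\<F> = \<Union>(B ` I)"
    using Lindelof[of "B ` I"] open_B by auto
  then obtain I' where I': "countable I'" "I' \<subseteq> I" "\<F> = B ` I'"
    by (metis countable_subset_image)
  have set_eq: "{x. l < maximal w g x} = (\<Union>i\<in>I'. B i)"
    unfolding less_maximal_set using \<F>(3) I'(3) by (simp add: I_def)
  show ?thesis
  proof (cases "I' = {}")
    case False
    define e where "e = from_nat_into I'"
    have e: "range e = I'"
      unfolding e_def using False I'(1) by (rule range_from_nat_into)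
    define U where "U n = (\<Union>i\<in>e ` {..n}. B i)" for n :: nat
    have U: "(\<Union>n. U n) = (\<Union>i\<in>I'. B i)"
      unfolding e[symmetric] by (auto simp: U_def)
    have "incseq U"
      by (auto simp: incseq_def U_def intro: order_trans)
    moreover have "range U \<subseteq> sets N"
      by (auto simp: sets U_def)
    ultimately have "(SUP n. emeasure N (U n)) = emeasure N (\<Union>n. U n)"
      by (intro SUP_emeasure_incseq)
    then have "l * emeasure N {x. l < maximal w g x} = l * (SUP n. emeasure N (U n))"
      by (simp add: set_eq U)
    also have "\<dots> = (SUP n. l * emeasure N (U n))"
      by (rule SUP_mult_left_ennreal)
    also have "\<dots> \<le> K * D * (\<integral>\<^sup>+x. g x * w x \<partial>M)"
    proof (rule SUP_least)
      fix n
      have "finite (e ` {..n})" "e ` {..n} \<subseteq> I"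
        using e I'(2) by auto
      then show "l * emeasure N (U n) \<le> K * D * (\<integral>\<^sup>+x. g x * w x \<partial>M)"
        unfolding U_def by (rule finite_case)
    qed
    finally show ?thesis
      by (simp add: N_def)
  qed (simp add: set_eq)
qed

text \<open>
  Interpolation between the weak type inequality and the trivial bound on bounded functions. The constant does not depend on the weight
  except through \<open>K\<close>, which the extrapolation below requires.
\<close>

proposition maximal_strong_type:
  assumes r: "1 < r" and K: "K < top"
  shows "\<exists>C<top. \<forall>w g. A1 K w \<longrightarrow> g \<in> borel_measurable M \<longrightarrow>
    (\<integral>\<^sup>+x. maximal w g x powre r * w x \<partial>M) \<le> C * (\<integral>\<^sup>+x. g x powre r * w x \<partial>M)"
proof (intro exI conjI allI impI)
  define c where "c = ennreal r * (2 * K * D) * (ennreal (1 / (r - 1)) * ennreal (2 powr (r - 1)))"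
  show "c < top"
    using K D_fin by (simp add: c_def ennreal_mult_less_top)
  fix w g :: "'a \<Rightarrow> ennreal" assume w: "A1 K w" and [measurable]: "g \<in> borel_measurable M"
  have [measurable]: "w \<in> borel_measurable M"
    using w by (rule A1_measurable)
  let ?G = "density M (\<lambda>x. g x * w x)"
  have level: "ennreal l * emeasure (density M w) {x. ennreal l < maximal w g x}
      \<le> 2 * K * D * emeasure ?G {x\<in>space M. ennreal l < 2 * g x}" if l: "0 < l" for l
  proof -
    \<comment> \<open>Cutting \<open>g\<close> at \<open>l / 2\<close> changes the maximal function by at most \<open>l / 2\<close>.\<close>
    define g' where "g' x = g x * indicator {x\<in>space M. ennreal l < 2 * g x} x" for x
    have [measurable]: "g' \<in> borel_measurable M"
      unfolding g'_def by measurable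
    have half: "ennreal l = ennreal (l / 2) + ennreal (l / 2)" "ennreal l = 2 * ennreal (l / 2)"
      using l by (simp_all add: ennreal_plus[symmetric] mult_2 del: ennreal_plus)
    have g_le: "g y \<le> g' y + ennreal (l / 2)" for y
    proof (cases "ennreal l < 2 * g y")
      case False
      then have "2 * g y \<le> 2 * ennreal (l / 2)"
        using half(2) by simp
      then have "g y \<le> ennreal (l / 2)"
        by (simp add: ennreal_mult_le_mult_iff)
      then show ?thesis
        by (simp add: add_increasing)
    qed (simp add: g'_def space_UNIV)
    have "maximal w g x \<le> maximal w g' x + ennreal (l / 2)" for x
      unfolding maximal_def[of w g]
    proof (rule SUP_least)
      fix i assume i: "i \<in> {i. x \<in> B i}"
      let ?W = "\<integral>\<^sup>+y\<in>B i. w y \<partial>M"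
      have "(\<integral>\<^sup>+y\<in>B i. g y * w y \<partial>M)
          \<le> (\<integral>\<^sup>+y. g' y * w y * indicator (B i) y + ennreal (l / 2) * (w y * indicator (B i) y) \<partial>M)"
        using g_le by (intro nn_integral_mono) (auto simp: indicator_def distrib_right[symmetric] intro!: mult_right_mono)
      also have "\<dots> = (\<integral>\<^sup>+y\<in>B i. g' y * w y \<partial>M) + ennreal (l / 2) * ?W"
        by (simp add: nn_integral_add nn_integral_cmult)
      finally have "(\<integral>\<^sup>+y\<in>B i. g y * w y \<partial>M) / ?W
          \<le> ((\<integral>\<^sup>+y\<in>B i. g' y * w y \<partial>M) + ennreal (l / 2) * ?W) / ?W"
        by (rule divide_right_mono_ennreal)
      also have "\<dots> = (\<integral>\<^sup>+y\<in>B i. g' y * w y \<partial>M) / ?W + ennreal (l / 2) * (?W / ?W)"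
        by (simp add: add_divide_distrib_ennreal ennreal_times_divide)
      also have "\<dots> \<le> maximal w g' x + ennreal (l / 2) * 1"
        unfolding maximal_def using i
        by (intro add_mono SUP_upper mult_left_mono ennreal_divide_self_le_one) auto
      finally show "(\<integral>\<^sup>+y\<in>B i. g y * w y \<partial>M) / ?W \<le> maximal w g' x + ennreal (l / 2)"
        by simp
    qed
    then have "{x. ennreal l < maximal w g x} \<subseteq> {x. ennreal (l / 2) < maximal w g' x}"
    proof safe
      fix x assume "ennreal l < maximal w g x"
      also have "\<dots> \<le> maximal w g' x + ennreal (l / 2)"
        by fact
      finally have "ennreal (l / 2) + ennreal (l / 2) < maximal w g' x + ennreal (l / 2)"
        using half(1) by simp
      then show "ennreal (l / 2) < maximal w g' x"
        by (metis add_right_mono linorder_not_le)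
    qed
    then have "ennreal l * emeasure (density M w) {x. ennreal l < maximal w g x}
        \<le> ennreal l * emeasure (density M w) {x\<in>space M. ennreal (l / 2) < maximal w g' x}"
    proof (intro mult_left_mono emeasure_mono)
      show "{x \<in> space M. ennreal (l / 2) < maximal w g' x} \<in> sets (density M w)"
        by simp
    qed (simp_all add: space_UNIV)
    also have "\<dots> = 2 * (ennreal (l / 2) * emeasure (density M w) {x. ennreal (l / 2) < maximal w g' x})"
      by (simp add: half(2) mult.assoc space_UNIV)
    also have "\<dots> \<le> 2 * (K * D * (\<integral>\<^sup>+x. g' x * w x \<partial>M))"
      by (intro mult_left_mono maximal_weak_type w) auto
    also have "(\<integral>\<^sup>+x. g' x * w x \<partial>M) = emeasure ?G {x\<in>space M. ennreal l < 2 * g x}"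
      by (subst emeasure_density) (auto simp: g'_def mult_ac intro!: nn_integral_cong)
    finally show ?thesis
      by (simp add: mult.assoc)
  qed
  have "(\<integral>\<^sup>+x. maximal w g x powre r * w x \<partial>M) = ennreal r *
      (\<integral>\<^sup>+l\<in>{0<..}. ennreal (l powr (r - 1)) * emeasure (density M w) {x. ennreal l < maximal w g x} \<partial>lborel)"
    using r by (subst layer_cake) (auto simp: space_UNIV)
  also have "\<dots> \<le> ennreal r * (\<integral>\<^sup>+l. 2 * K * D * (ennreal (l powr (r - 1 - 1)) *
      emeasure ?G {x\<in>space M. ennreal l < 2 * g x} * indicator {0<..} l) \<partial>lborel)"
  proof (intro mult_left_mono nn_integral_mono, goal_cases)
    case (1 l)
    show ?case
    proof (cases "0 < l")
      case True
      have "ennreal (l powr (r - 1)) = ennreal (l powr (r - 1 - 1)) * ennreal l"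
        using True ennreal_powr_mult[of l "r - 1 - 1" 1] by simp
      then have "ennreal (l powr (r - 1)) * emeasure (density M w) {x. ennreal l < maximal w g x}
          = ennreal (l powr (r - 1 - 1)) * (ennreal l * emeasure (density M w) {x. ennreal l < maximal w g x})"
        by (simp add: mult.assoc)
      also have "\<dots> \<le> ennreal (l powr (r - 1 - 1)) *
          (2 * K * D * emeasure ?G {x\<in>space M. ennreal l < 2 * g x})"
        using level[OF True] by (rule mult_left_mono) simp
      finally show ?thesis
        using True by (simp add: mult_ac)
    qed simp
  qed simp
  also have "\<dots> = ennreal r * (2 * K * D) * (\<integral>\<^sup>+l\<in>{0<..}. ennreal (l powr (r - 1 - 1)) *
      emeasure ?G {x\<in>space M. ennreal l < 2 * g x} \<partial>lborel)"
  proof -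
    have "antimono (\<lambda>l. emeasure ?G {x\<in>space M. ennreal l < 2 * g x})"
      by (intro antimonoI emeasure_mono) (auto intro: order_le_less_trans[OF ennreal_leI])
    then have [measurable]: "(\<lambda>l. emeasure ?G {x\<in>space M. ennreal l < 2 * g x}) \<in> borel_measurable borel"
      by (rule borel_measurable_antimono_ennreal)
    show ?thesis
      by (subst nn_integral_cmult) (auto simp: mult.assoc)
  qed
  also have "\<dots> = ennreal r * (2 * K * D) * (ennreal (1 / (r - 1)) * (\<integral>\<^sup>+x. (2 * g x) powre (r - 1) * (g x * w x) \<partial>M))"
    using r by (subst layer_cake) (auto simp: mult.assoc[symmetric] ennreal_mult[symmetric])
  also have "(\<integral>\<^sup>+x. (2 * g x) powre (r - 1) * (g x * w x) \<partial>M)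
      = (\<integral>\<^sup>+x. ennreal (2 powr (r - 1)) * (g x powre r * w x) \<partial>M)"
  proof (intro nn_integral_cong)
    fix x
    have "g x powre r = g x powre (r - 1) * g x"
      using r powre_add[of "r - 1" 1 "g x"] by simp
    moreover have "2 powre (r - 1) = ennreal (2 powr (r - 1))"
      using powre_ennreal[of 2 "r - 1"] by simp
    ultimately show "(2 * g x) powre (r - 1) * (g x * w x) = ennreal (2 powr (r - 1)) * (g x powre r * w x)"
      using r by (simp add: powre_mult mult_ac)
  qed
  also have "\<dots> = ennreal (2 powr (r - 1)) * (\<integral>\<^sup>+x. g x powre r * w x \<partial>M)"
    by (simp add: nn_integral_cmult)
  finally show "(\<integral>\<^sup>+x. maximal w g x powre r * w x \<partial>M) \<le> c * (\<integral>\<^sup>+x. g x powre r * w x \<partial>M)"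
    by (simp add: c_def mult.assoc)
qed

lemma A1_one: "A1 1 (\<lambda>_. 1)"
  using pos_B fin_B by (auto simp: A1_def)

lemma Mx_alt: "Mx g x = (SUP i\<in>{i. x \<in> B i}. (\<integral>\<^sup>+y\<in>B i. g y \<partial>M) / emeasure M (B i))"
  by (simp add: maximal_def)

lemma average_le_Mx: "x \<in> B i \<Longrightarrow> (\<integral>\<^sup>+y\<in>B i. g y \<partial>M) \<le> emeasure M (B i) * Mx g x"
proof -
  assume x: "x \<in> B i"
  let ?I = "\<integral>\<^sup>+y\<in>B i. g y \<partial>M" and ?m = "emeasure M (B i)"
  have "?I = ?m * (?I / ?m)"
    using pos_B[of i] fin_B[of i]
    by (simp add: ennreal_times_divide mult.commute[of ?m] ennreal_mult_divide_eq)
  also have "\<dots> \<le> ?m * Mx g x"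
    unfolding Mx_alt using x by (intro mult_left_mono SUP_upper) auto
  finally show ?thesis .
qed

lemma Mx_bounded:
  assumes "1 < p"
  shows "\<exists>C<top. \<forall>g. g \<in> borel_measurable M \<longrightarrow>
    (\<integral>\<^sup>+x. Mx g x powre p \<partial>M) \<le> C * (\<integral>\<^sup>+x. g x powre p \<partial>M)"
proof -
  obtain C where C: "C < top" "\<forall>w g. A1 1 w \<longrightarrow> g \<in> borel_measurable M \<longrightarrow>
    (\<integral>\<^sup>+x. maximal w g x powre p * w x \<partial>M) \<le> C * (\<integral>\<^sup>+x. g x powre p * w x \<partial>M)"
    using maximal_strong_type[OF assms, of 1] by auto
  then show ?thesis
    using C(2)[rule_format, OF A1_one] by (intro exI[of _ C]) simp
qed

section \<open>Muckenhoupt weights and the Rubio de Francia iteration\<close>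

lemma nn_integral_eq_0_if_balls_through:
  assumes [measurable]: "w \<in> borel_measurable M"
    and "\<And>i. x \<in> B i \<Longrightarrow> (\<integral>\<^sup>+y\<in>B i. w y \<partial>M) = 0"
  shows "AE y in M. w y = 0"
proof -
  obtain I where I: "countable I" "\<forall>i\<in>I. x \<in> B i" "(\<Union>i\<in>I. B i) = UNIV"
    using exhausting[of x] by blast
  have "AE y in M. y \<in> B i \<longrightarrow> w y = 0" if "i \<in> I" for i
  proof -
    have "AE y in M. w y * indicator (B i) y = 0"
      using assms(2)[of i] that I(2) by (subst nn_integral_0_iff_AE[symmetric]) auto
    then show ?thesis
      by eventually_elim (auto simp: indicator_def)
  qed
  then have "AE y in M. \<forall>i\<in>I. y \<in> B i \<longrightarrow> w y = 0"
    by (intro AE_ball_countable[OF I(1), THEN iffD2] ballI)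
  then show ?thesis
    by eventually_elim (use I(3) in blast)
qed

lemma in_some_ball: "\<exists>i. x \<in> B i"
proof -
  obtain I where "(\<Union>i\<in>I. B i) = UNIV"
    using exhausting[of x] by blast
  then have "x \<in> (\<Union>i\<in>I. B i)"
    by simp
  then show ?thesis
    by blast
qed

lemma A1_pos:
  assumes "A1 K w"
  shows "0 < w x"
proof -
  obtain i where i: "x \<in> B i"
    using in_some_ball by blast
  have "0 < (\<integral>\<^sup>+x\<in>B i. w x \<partial>M)" "(\<integral>\<^sup>+x\<in>B i. w x \<partial>M) \<le> K * emeasure M (B i) * w x"
    using assms i by (auto simp: A1_def)
  then have "0 < K * emeasure M (B i) * w x"
    by (rule order.strict_trans2)
  then show ?thesis
    by (cases "w x = 0") (auto simp: zero_less_iff_neq_zero)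
qed

lemma A1_finite_AE:
  assumes w: "A1 K w"
  shows "AE x in M. w x < top"
proof -
  have [measurable]: "w \<in> borel_measurable M"
    using w by (rule A1_measurable)
  obtain I where I: "countable I" "(\<Union>i\<in>I. B i) = UNIV"
    using exhausting[of undefined] by blast
  have "AE y in M. y \<in> B i \<longrightarrow> w y \<noteq> \<infinity>" for i
  proof -
    have "(\<integral>\<^sup>+x\<in>B i. w x \<partial>M) < top"
      using w by (simp add: A1_def)
    then have "AE y in M. w y * indicator (B i) y \<noteq> \<infinity>"
      by (intro nn_integral_PInf_AE) auto
    then show ?thesis
      by eventually_elim (auto simp: indicator_def)
  qed
  then have "AE y in M. \<forall>i\<in>I. y \<in> B i \<longrightarrow> w y \<noteq> \<infinity>"
    by (intro AE_ball_countable[OF I(1), THEN iffD2] ballI)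
  then show ?thesis
    by eventually_elim (metis I(2) UN_iff UNIV_I infinity_ennreal_def less_top)
qed

lemma nn_integral_eq_0_cong:
  assumes "f \<in> borel_measurable M" "g \<in> borel_measurable M"
    and "\<And>x. f x = 0 \<Longrightarrow> g x = (0 :: ennreal)" "(\<integral>\<^sup>+x. f x \<partial>M) = 0"
  shows "(\<integral>\<^sup>+x. g x \<partial>M) = 0"
proof -
  have "AE x in M. f x = 0"
    using assms(1,4) by (simp add: nn_integral_0_iff_AE)
  then have "AE x in M. g x = 0"
    by eventually_elim (rule assms(3))
  then show ?thesis
    using assms(2) by (simp add: nn_integral_0_iff_AE)
qed

text \<open>
  Let \<open>T = M / N\<close>, where \<open>N\<close> is so large that \<open>T\<close> does not increase \<open>L\<^sup>p\<close> norms. The weight is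
  \<open>w = \<Sum>k. 4\<^sup>-\<^sup>k T\<^sup>k g\<close>: the term \<open>k = 0\<close> gives \<open>g \<le> w\<close>, and applying \<open>M\<close> shifts the series, so
  that \<open>M w \<le> 4 N w\<close>. For the norm, the geometric factor is split between convergence of the sum and
  a pointwise bound by an \<open>\<ell>\<^sup>p\<close> sum, which avoids the triangle inequality in \<open>L\<^sup>p\<close>.
\<close>

proposition rubio_de_francia:
  assumes p: "1 < p"
  shows "\<exists>K<top. \<forall>g. g \<in> borel_measurable M \<longrightarrow> (\<integral>\<^sup>+x. g x powre p \<partial>M) < top \<longrightarrow>
      (\<integral>\<^sup>+x. g x powre p \<partial>M) \<noteq> 0 \<longrightarrow>
    (\<exists>w. A1 K w \<and> (\<forall>x. g x \<le> w x) \<and> (\<integral>\<^sup>+x. w x powre p \<partial>M) \<le> K * (\<integral>\<^sup>+x. g x powre p \<partial>M))"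
proof -
  obtain C where C: "C < top"
    "\<And>g. g \<in> borel_measurable M \<Longrightarrow> (\<integral>\<^sup>+x. Mx g x powre p \<partial>M) \<le> C * (\<integral>\<^sup>+x. g x powre p \<partial>M)"
    using Mx_bounded[OF p] by auto
  define N where "N = max 1 (C powre (1 / p))"
  have N: "0 < N" "N < top" "1 \<le> N"
    using C(1) by (auto simp: N_def max_def less_top[symmetric] intro: order_less_le_trans[of 0 1])
  have "(C powre (1 / p)) powre p \<le> N powre p"
    using p by (intro powre_mono) (auto simp: N_def)
  then have CN: "C \<le> N powre p"
    using p by (simp add: powre_powre)
  have Np: "0 < N powre p" "N powre p < top"
    using N p by (auto simp: zero_less_iff_neq_zero less_top[symmetric])
  define T where "T g x = Mx g x / N" for g x
  have T_meas: "T g \<in> borel_measurable M" for g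
    unfolding T_def[abs_def] by measurable
  have T_contr: "(\<integral>\<^sup>+x. T g x powre p \<partial>M) \<le> (\<integral>\<^sup>+x. g x powre p \<partial>M)"
    if [measurable]: "g \<in> borel_measurable M" for g
  proof -
    have "(\<integral>\<^sup>+x. T g x powre p \<partial>M) = (\<integral>\<^sup>+x. Mx g x powre p / N powre p \<partial>M)"
      unfolding T_def using N by (simp add: powre_divide)
    also have "\<dots> = (\<integral>\<^sup>+x. Mx g x powre p \<partial>M) / N powre p"
      by (rule nn_integral_divide) measurable
    also have "\<dots> \<le> N powre p * (\<integral>\<^sup>+x. g x powre p \<partial>M) / N powre p"
      using C(2)[OF that] CN by (intro divide_right_mono_ennreal) (meson mult_right_mono order_trans zero_le)
    also have "\<dots> = (\<integral>\<^sup>+x. g x powre p \<partial>M)"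
      using N Np by (subst mult.commute) (auto simp: ennreal_mult_divide_eq)
    finally show ?thesis .
  qed
  define K where "K = max (4 * N) (2 * ennreal (2 powr p))"
  have K: "K < top" "4 * N \<le> K" "2 * ennreal (2 powr p) \<le> K"
    using N(2) by (auto simp: K_def max_def ennreal_mult_less_top)
  have "\<exists>w. A1 K w \<and> (\<forall>x. g x \<le> w x) \<and> (\<integral>\<^sup>+x. w x powre p \<partial>M) \<le> K * (\<integral>\<^sup>+x. g x powre p \<partial>M)"
    if g[measurable]: "g \<in> borel_measurable M" and g_fin: "(\<integral>\<^sup>+x. g x powre p \<partial>M) < top"
      and g_nz: "(\<integral>\<^sup>+x. g x powre p \<partial>M) \<noteq> 0" for g
  proof -
    define X where "X k = (T ^^ k) g" for k
    have X0: "X 0 = g" and XS: "X (Suc k) = T (X k)" for k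
      by (simp_all add: X_def)
    have X_meas [measurable]: "X k \<in> borel_measurable M" for k
      by (cases k) (simp_all add: X0 XS T_meas)
    have X_int: "(\<integral>\<^sup>+x. X k x powre p \<partial>M) \<le> (\<integral>\<^sup>+x. g x powre p \<partial>M)" for k
      by (induction k) (auto simp: X0 XS intro: order_trans[OF T_contr])
    define w where "w x = (\<Sum>k. ennreal ((1 / 4) ^ k) * X k x)" for x
    have w_meas [measurable]: "w \<in> borel_measurable M"
      unfolding w_def[abs_def] by measurable
    have g_le: "g x \<le> w x" for x
    proof -
      have "(\<Sum>k<1. ennreal ((1 / 4) ^ k) * X k x) \<le> w x"
        unfolding w_def by (rule sum_le_suminf) auto
      then show ?thesis
        by (simp add: X0)
    qed
    have w_avg: "(\<integral>\<^sup>+y\<in>B i. w y \<partial>M) \<le> K * emeasure M (B i) * w x" if x: "x \<in> B i" for i x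
    proof -
      have "(\<integral>\<^sup>+y\<in>B i. w y \<partial>M) = (\<integral>\<^sup>+y. (\<Sum>k. ennreal ((1 / 4) ^ k) * (X k y * indicator (B i) y)) \<partial>M)"
        unfolding w_def by (simp add: ennreal_suminf_multc[symmetric] mult.assoc)
      also have "\<dots> = (\<Sum>k. (\<integral>\<^sup>+y. ennreal ((1 / 4) ^ k) * (X k y * indicator (B i) y) \<partial>M))"
        by (rule nn_integral_suminf) measurable
      also have "\<dots> = (\<Sum>k. ennreal ((1 / 4) ^ k) * (\<integral>\<^sup>+y\<in>B i. X k y \<partial>M))"
        by (simp add: nn_integral_cmult)
      also have "\<dots> \<le> (\<Sum>k. (4 * N * emeasure M (B i)) * (ennreal ((1 / 4) ^ Suc k) * X (Suc k) x))"
      proof (rule suminf_le)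
        fix k
        have "(\<integral>\<^sup>+y\<in>B i. X k y \<partial>M) \<le> emeasure M (B i) * Mx (X k) x"
          using x by (rule average_le_Mx)
        also have "Mx (X k) x = N * X (Suc k) x"
          using N by (simp add: XS T_def ennreal_times_divide mult.commute[of N] ennreal_mult_divide_eq)
        finally have le: "(\<integral>\<^sup>+y\<in>B i. X k y \<partial>M) \<le> emeasure M (B i) * (N * X (Suc k) x)" .
        have "ennreal ((1 / 4) ^ k) = 4 * ennreal ((1 / 4) ^ Suc k)"
          by (simp add: ennreal_mult[symmetric] flip: ennreal_numeral)
        then show "ennreal ((1 / 4) ^ k) * (\<integral>\<^sup>+y\<in>B i. X k y \<partial>M)
            \<le> (4 * N * emeasure M (B i)) * (ennreal ((1 / 4) ^ Suc k) * X (Suc k) x)"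
          using mult_left_mono[OF le, of "ennreal ((1 / 4) ^ k)"] by (simp only: mult_ac) simp
      qed auto
      also have "\<dots> = (4 * N * emeasure M (B i)) * (\<Sum>k. ennreal ((1 / 4) ^ Suc k) * X (Suc k) x)"
        by (rule ennreal_suminf_cmult)
      also have "(\<Sum>k. ennreal ((1 / 4) ^ Suc k) * X (Suc k) x) \<le> w x"
        unfolding w_def by (subst (2) suminf_offset[of _ 1]) (auto intro: add_increasing)
      finally have "(\<integral>\<^sup>+y\<in>B i. w y \<partial>M) \<le> 4 * N * emeasure M (B i) * w x"
        by (simp add: mult_left_mono)
      also have "\<dots> \<le> K * emeasure M (B i) * w x"
        using K(2) by (intro mult_right_mono) auto
      finally show ?thesis .
    qed
    have w_pow: "w x powre p \<le> ennreal (2 powr p) * (\<Sum>k. ennreal ((1 / 2) ^ k) * X k x powre p)" for x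
    proof -
      define S where "S = (\<Sum>k. ennreal ((1 / 2) ^ k) * X k x powre p)"
      have term_le: "ennreal ((1 / 2) ^ k) * X k x \<le> S powre (1 / p)" for k
      proof -
        have "((1 / 2) ^ k) powr p \<le> ((1 / 2 :: real) ^ k) powr 1"
          using p by (intro powr_mono') (auto simp: power_le_one)
        then have "(ennreal ((1 / 2) ^ k) * X k x) powre p \<le> ennreal ((1 / 2) ^ k) * X k x powre p"
          using p by (simp add: powre_mult powre_ennreal ennreal_leI mult_right_mono)
        also have "\<dots> \<le> S"
          unfolding S_def using sum_le_suminf[of "\<lambda>k. ennreal ((1 / 2) ^ k) * X k x powre p" "{k}"] by simp
        finally have "((ennreal ((1 / 2) ^ k) * X k x) powre p) powre (1 / p) \<le> S powre (1 / p)"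
          using p by (intro powre_mono) auto
        then show ?thesis
          using p by (simp add: powre_powre)
      qed
      have "w x = (\<Sum>k. ennreal ((1 / 2) ^ k) * (ennreal ((1 / 2) ^ k) * X k x))"
        unfolding w_def by (simp add: mult.assoc[symmetric] ennreal_mult[symmetric] power_mult_distrib[symmetric])
      also have "\<dots> \<le> 2 * S powre (1 / p)"
        by (intro suminf_geometric_le term_le)
      finally have "w x powre p \<le> (2 * S powre (1 / p)) powre p"
        using p by (intro powre_mono) auto
      also have "\<dots> = ennreal (2 powr p) * S"
        using p powre_ennreal[of 2 p] by (simp add: powre_mult powre_powre)
      finally show ?thesis
        by (simp add: S_def)
    qed
    have w_int: "(\<integral>\<^sup>+x. w x powre p \<partial>M) \<le> K * (\<integral>\<^sup>+x. g x powre p \<partial>M)"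
    proof -
      have "(\<integral>\<^sup>+x. w x powre p \<partial>M)
          \<le> (\<integral>\<^sup>+x. ennreal (2 powr p) * (\<Sum>k. ennreal ((1 / 2) ^ k) * X k x powre p) \<partial>M)"
        by (intro nn_integral_mono w_pow)
      also have "\<dots> = ennreal (2 powr p) * (\<Sum>k. ennreal ((1 / 2) ^ k) * (\<integral>\<^sup>+x. X k x powre p \<partial>M))"
        by (simp add: nn_integral_cmult nn_integral_suminf)
      also have "\<dots> \<le> ennreal (2 powr p) * (2 * (\<integral>\<^sup>+x. g x powre p \<partial>M))"
        by (intro mult_left_mono suminf_geometric_le X_int) auto
      also have "\<dots> \<le> K * (\<integral>\<^sup>+x. g x powre p \<partial>M)"
        using mult_right_mono[OF K(3), of "\<integral>\<^sup>+x. g x powre p \<partial>M"] by (simp add: mult_ac)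
      finally show ?thesis .
    qed
    \<comment> \<open>Averages are finite because \<open>w \<le> 1 + w\<^sup>p\<close> and balls have finite measure.\<close>
    have w_fin: "(\<integral>\<^sup>+y\<in>B i. w y \<partial>M) < top" for i
    proof -
      have le: "w y \<le> 1 + w y powre p" for y
      proof (cases "w y \<le> 1")
        case False
        then have "w y * 1 \<le> w y * w y powre (p - 1)"
          using p powre_mono[of "p - 1" 1 "w y"] by (intro mult_left_mono) auto
        also have "\<dots> = w y powre p"
          using p powre_add[of 1 "p - 1" "w y"] by simp
        finally show ?thesis
          by (simp add: add_increasing)
      qed (simp add: add_increasing2)
      have "(\<integral>\<^sup>+y\<in>B i. w y \<partial>M) \<le> (\<integral>\<^sup>+y. indicator (B i) y + w y powre p \<partial>M)"
        using le by (intro nn_integral_mono) (auto simp: indicator_def)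
      also have "\<dots> = emeasure M (B i) + (\<integral>\<^sup>+y. w y powre p \<partial>M)"
        by (simp add: nn_integral_add)
      also have "\<dots> \<le> emeasure M (B i) + K * (\<integral>\<^sup>+y. g y powre p \<partial>M)"
        by (intro add_left_mono w_int)
      also have "\<dots> < top"
        using fin_B K g_fin by (simp add: ennreal_mult_less_top)
      finally show ?thesis .
    qed
    have w_pos: "0 < (\<integral>\<^sup>+y\<in>B i. w y \<partial>M)" for i
    proof (rule ccontr)
      assume "\<not> 0 < (\<integral>\<^sup>+y\<in>B i. w y \<partial>M)"
      then have z: "(\<integral>\<^sup>+y\<in>B i. w y \<partial>M) = 0"
        by (simp add: zero_less_iff_neq_zero)
      have "\<exists>x\<in>B i. w x = 0"
      proof (rule ccontr)
        assume "\<not> (\<exists>x\<in>B i. w x = 0)"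
        then have "w y * indicator (B i) y = 0 \<Longrightarrow> (indicator (B i) y :: ennreal) = 0" for y
          by (auto simp: indicator_def)
        then have "(\<integral>\<^sup>+y. indicator (B i) y \<partial>M) = 0"
          by (intro nn_integral_eq_0_cong[OF _ _ _ z]) measurable
        then show False
          using pos_B[of i] by simp
      qed
      then obtain x where x: "x \<in> B i" "w x = 0"
        by auto
      have "(\<integral>\<^sup>+y\<in>B i. w y \<partial>M) = 0" if "x \<in> B i" for i
        using w_avg[OF that] x(2) by simp
      then have "AE y in M. w y = 0"
        by (intro nn_integral_eq_0_if_balls_through[OF w_meas])
      then have "AE y in M. g y powre p = 0"
        by eventually_elim (metis g_le le_zero_eq powre_eq_zero_iff)
      then show False
        using g_nz by (simp add: nn_integral_0_iff_AE)
    qed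
    show ?thesis
      using w_meas w_avg w_fin w_pos g_le w_int by (intro exI[of _ w]) (auto simp: A1_def)
  qed
  then show ?thesis
    using K(1) by blast
qed

section \<open>Weighted inequalities for the Hardy-Littlewood maximal function\<close>

text \<open>
  On a ball, \<open>w\<close> is nowhere smaller than \<open>1/K\<close> times its average, hence
  \<open>w(B) \<integral>\<^sub>B f \<le> K \<bar>B\<bar> \<integral>\<^sub>B f w\<close>.
\<close>

lemma Mx_le_maximal:
  assumes w: "A1 K w" and [measurable]: "f \<in> borel_measurable M"
  shows "Mx f x \<le> K * maximal w f x"
  unfolding Mx_alt
proof (rule SUP_least)
  fix i assume i: "i \<in> {i. x \<in> B i}"
  have [measurable]: "w \<in> borel_measurable M"
    using w by (rule A1_measurable)
  let ?W = "\<integral>\<^sup>+y\<in>B i. w y \<partial>M" and ?F = "\<integral>\<^sup>+y\<in>B i. f y \<partial>M"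
  have W: "0 < ?W" "?W < top"
    using w by (auto simp: A1_def)
  have "?F * ?W = (\<integral>\<^sup>+y\<in>B i. f y * ?W \<partial>M)"
    by (simp add: nn_integral_multc[symmetric] mult_ac)
  also have "\<dots> \<le> (\<integral>\<^sup>+y. K * emeasure M (B i) * (f y * w y * indicator (B i) y) \<partial>M)"
  proof (rule nn_integral_mono)
    fix y
    show "f y * ?W * indicator (B i) y \<le> K * emeasure M (B i) * (f y * w y * indicator (B i) y)"
    proof (cases "y \<in> B i")
      case True
      then have "f y * ?W \<le> f y * (K * emeasure M (B i) * w y)"
        using w by (intro mult_left_mono) (auto simp: A1_def)
      then show ?thesis
        using True by (simp add: mult_ac)
    qed simp
  qed
  also have "\<dots> = K * emeasure M (B i) * (\<integral>\<^sup>+y\<in>B i. f y * w y \<partial>M)"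
    by (rule nn_integral_cmult) measurable
  finally have "?F / emeasure M (B i) \<le> K * ((\<integral>\<^sup>+y\<in>B i. f y * w y \<partial>M) / ?W)"
    by (intro ennreal_divide_le_mult_divide W pos_B fin_B)
  also have "\<dots> \<le> K * maximal w f x"
    unfolding maximal_def using i by (intro mult_left_mono SUP_upper) auto
  finally show "?F / emeasure M (B i) \<le> K * maximal w f x" .
qed

text \<open>
  Here the average of \<open>f\<close> is written as the \<open>w dx\<close>-average of \<open>f / w\<close> times the average
  \<open>w(B) / \<bar>B\<bar>\<close>, and the latter is at most \<open>K w x\<close>.
\<close>

lemma Mx_le_dual_maximal:
  assumes w: "A1 K w" and [measurable]: "f \<in> borel_measurable M"
  shows "Mx f x \<le> K * w x * maximal w (\<lambda>y. f y / w y) x"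
  unfolding Mx_alt
proof (rule SUP_least)
  fix i assume i: "i \<in> {i. x \<in> B i}"
  have [measurable]: "w \<in> borel_measurable M"
    using w by (rule A1_measurable)
  let ?W = "\<integral>\<^sup>+y\<in>B i. w y \<partial>M" and ?F = "\<integral>\<^sup>+y\<in>B i. f y \<partial>M"
  have W: "0 < ?W" "?W < top" and Wx: "?W \<le> K * emeasure M (B i) * w x"
    using w i by (auto simp: A1_def)
  have "AE y in M. f y * indicator (B i) y = f y / w y * w y * indicator (B i) y"
    using A1_finite_AE[OF w]
  proof eventually_elim
    case (elim y)
    then have "f y / w y * w y = f y"
      using A1_pos[OF w, of y]
      by (metis ennreal_divide_times ennreal_divide_self mult.right_neutral order_less_irrefl)
    then show ?case
      by simp
  qed
  then have F: "?F = (\<integral>\<^sup>+y\<in>B i. f y / w y * w y \<partial>M)"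
    by (rule nn_integral_cong_AE)
  have "?F * ?W \<le> ?F * (K * emeasure M (B i) * w x)"
    using Wx by (rule mult_left_mono) simp
  then have "?F * ?W \<le> K * w x * emeasure M (B i) * ?F"
    by (simp add: mult_ac)
  then have "?F / emeasure M (B i) \<le> K * w x * (?F / ?W)"
    by (intro ennreal_divide_le_mult_divide W pos_B fin_B)
  also have "\<dots> \<le> K * w x * maximal w (\<lambda>y. f y / w y) x"
    unfolding maximal_def F using i by (intro mult_left_mono SUP_upper) auto
  finally show "?F / emeasure M (B i) \<le> K * w x * maximal w (\<lambda>y. f y / w y) x" .
qed

proposition Mx_weighted:
  assumes r: "1 < r" and K: "K < top"
  shows "\<exists>C<top. \<forall>w f. A1 K w \<longrightarrow> f \<in> borel_measurable M \<longrightarrow>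
    (\<integral>\<^sup>+x. Mx f x powre r * w x \<partial>M) \<le> C * (\<integral>\<^sup>+x. f x powre r * w x \<partial>M)"
proof -
  obtain C where C: "C < top" "\<And>w f. A1 K w \<Longrightarrow> f \<in> borel_measurable M \<Longrightarrow>
      (\<integral>\<^sup>+x. maximal w f x powre r * w x \<partial>M) \<le> C * (\<integral>\<^sup>+x. f x powre r * w x \<partial>M)"
    using maximal_strong_type[OF r K] by auto
  have "(\<integral>\<^sup>+x. Mx f x powre r * w x \<partial>M) \<le> K powre r * C * (\<integral>\<^sup>+x. f x powre r * w x \<partial>M)"
    if w: "A1 K w" and f[measurable]: "f \<in> borel_measurable M" for w f
  proof -
    have [measurable]: "w \<in> borel_measurable M"
      using w by (rule A1_measurable)
    have "(\<integral>\<^sup>+x. Mx f x powre r * w x \<partial>M) \<le> (\<integral>\<^sup>+x. K powre r * (maximal w f x powre r * w x) \<partial>M)"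
    proof (rule nn_integral_mono)
      fix x
      have "Mx f x powre r \<le> (K * maximal w f x) powre r"
        using r by (intro powre_mono Mx_le_maximal[OF w f]) auto
      then show "Mx f x powre r * w x \<le> K powre r * (maximal w f x powre r * w x)"
        using r by (simp add: powre_mult mult.assoc[symmetric] mult_right_mono)
    qed
    also have "\<dots> = K powre r * (\<integral>\<^sup>+x. maximal w f x powre r * w x \<partial>M)"
      by (rule nn_integral_cmult) measurable
    also have "\<dots> \<le> K powre r * (C * (\<integral>\<^sup>+x. f x powre r * w x \<partial>M))"
      by (intro mult_left_mono C(2) w f) simp
    finally show ?thesis
      by (simp add: mult.assoc)
  qed
  moreover have "K powre r * C < top"
    using K C(1) by (simp add: ennreal_mult_eq_top_iff less_top[symmetric])
  ultimately show ?thesis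
    by blast
qed

text \<open>
  The weight \<open>w\<^sup>1\<^sup>-\<^sup>r\<close> is written as a division by \<open>w\<^sup>r\<^sup>-\<^sup>1\<close> to keep exponents positive. The identity
  \<open>w\<^sup>r w\<^sup>1\<^sup>-\<^sup>r = w\<close> turns the dual pointwise bound into the strong type inequality for \<open>f / w\<close>.
\<close>

proposition Mx_weighted_dual:
  assumes r: "1 < r" and K: "K < top"
  shows "\<exists>C<top. \<forall>w f. A1 K w \<longrightarrow> f \<in> borel_measurable M \<longrightarrow>
    (\<integral>\<^sup>+x. Mx f x powre r / w x powre (r - 1) \<partial>M) \<le> C * (\<integral>\<^sup>+x. f x powre r / w x powre (r - 1) \<partial>M)"
proof -
  obtain C where C: "C < top" "\<And>w f. A1 K w \<Longrightarrow> f \<in> borel_measurable M \<Longrightarrow>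
      (\<integral>\<^sup>+x. maximal w f x powre r * w x \<partial>M) \<le> C * (\<integral>\<^sup>+x. f x powre r * w x \<partial>M)"
    using maximal_strong_type[OF r K] by auto
  have cancel: "y * v powre r / v powre (r - 1) = y * v" if v: "0 < v" "v < top" for y v
  proof -
    have "v powre r = v * v powre (r - 1)"
      using powre_add[of 1 "r - 1" v] r by simp
    then have "y * v powre r / v powre (r - 1) = y * v * v powre (r - 1) / v powre (r - 1)"
      by (simp add: mult.assoc)
    also have "\<dots> = y * v"
      using v by (intro ennreal_mult_divide_eq) (auto simp: less_top[symmetric])
    finally show ?thesis .
  qed
  have "(\<integral>\<^sup>+x. Mx f x powre r / w x powre (r - 1) \<partial>M)
      \<le> K powre r * C * (\<integral>\<^sup>+x. f x powre r / w x powre (r - 1) \<partial>M)"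
    if w: "A1 K w" and f[measurable]: "f \<in> borel_measurable M" for w f
  proof -
    have [measurable]: "w \<in> borel_measurable M"
      using w by (rule A1_measurable)
    define h where "h y = f y / w y" for y
    have h[measurable]: "h \<in> borel_measurable M"
      unfolding h_def[abs_def] by measurable
    have "AE x in M. Mx f x powre r / w x powre (r - 1) \<le> K powre r * (maximal w h x powre r * w x)"
      using A1_finite_AE[OF w]
    proof eventually_elim
      case (elim x)
      have "Mx f x powre r \<le> (K * w x * maximal w h x) powre r"
        unfolding h_def[abs_def] using r by (intro powre_mono Mx_le_dual_maximal[OF w f]) auto
      also have "\<dots> = K powre r * maximal w h x powre r * w x powre r"
        using r by (simp add: powre_mult mult_ac)
      finally have "Mx f x powre r / w x powre (r - 1)
          \<le> K powre r * maximal w h x powre r * w x powre r / w x powre (r - 1)"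
        by (rule divide_right_mono_ennreal)
      then show ?case
        using cancel[OF A1_pos[OF w] elim, of "K powre r * maximal w h x powre r"]
        by (simp only: mult.assoc)
    qed
    then have "(\<integral>\<^sup>+x. Mx f x powre r / w x powre (r - 1) \<partial>M)
        \<le> (\<integral>\<^sup>+x. K powre r * (maximal w h x powre r * w x) \<partial>M)"
      by (rule nn_integral_mono_AE)
    also have "\<dots> = K powre r * (\<integral>\<^sup>+x. maximal w h x powre r * w x \<partial>M)"
      by (rule nn_integral_cmult) measurable
    also have "\<dots> \<le> K powre r * (C * (\<integral>\<^sup>+x. h x powre r * w x \<partial>M))"
      by (intro mult_left_mono C(2) w h) simp
    also have "(\<integral>\<^sup>+x. h x powre r * w x \<partial>M) = (\<integral>\<^sup>+x. f x powre r / w x powre (r - 1) \<partial>M)"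
    proof (rule nn_integral_cong_AE)
      show "AE x in M. h x powre r * w x = f x powre r / w x powre (r - 1)"
        using A1_finite_AE[OF w]
      proof eventually_elim
        case (elim x)
        note pos = A1_pos[OF w, of x]
        have "h x powre r * w x = h x powre r * w x powre r / w x powre (r - 1)"
          using cancel[OF pos elim] by simp
        also have "h x powre r * w x powre r = (h x * w x) powre r"
          using r by (simp add: powre_mult)
        also have "h x * w x = f x"
          unfolding h_def using pos elim
          by (metis ennreal_divide_times ennreal_divide_self mult.right_neutral order_less_irrefl)
        finally show ?case .
      qed
    qed
    finally show ?thesis
      by (simp add: mult.assoc)
  qed
  moreover have "K powre r * C < top"
    using K C(1) by (simp add: ennreal_mult_eq_top_iff less_top[symmetric])
  ultimately show ?thesis
    by blast
qed

section \<open>Vector-valued weak type inequalities\<close>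

lemma emeasure_le_if_finite_parts:
  assumes "A \<in> sets M" and "\<And>E. E \<in> sets M \<Longrightarrow> E \<subseteq> A \<Longrightarrow> emeasure M E < top \<Longrightarrow> c * emeasure M E \<le> b"
  shows "c * emeasure M A \<le> b"
proof -
  obtain S :: "nat \<Rightarrow> 'a set" where S: "range S \<subseteq> sets M" "(\<Union>n. S n) = space M"
      "\<And>n. emeasure M (S n) \<noteq> \<infinity>" "incseq S"
    using sigma_finite_incseq by metis
  have Sn: "S n \<in> sets M" for n
    using S(1) by auto
  have "(SUP n. emeasure M (A \<inter> S n)) = emeasure M (\<Union>n. A \<inter> S n)"
    using assms(1) Sn S(4) by (intro SUP_emeasure_incseq) (auto simp: incseq_def)
  also have "(\<Union>n. A \<inter> S n) = A"
    using S(2) by (auto simp: space_UNIV)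
  finally have "c * emeasure M A = (SUP n. c * emeasure M (A \<inter> S n))"
    using SUP_mult_left_ennreal[of c "\<lambda>n. emeasure M (A \<inter> S n)" UNIV] by simp
  also have "\<dots> \<le> b"
  proof (rule SUP_least)
    fix n
    have "emeasure M (A \<inter> S n) \<le> emeasure M (S n)"
      using Sn by (intro emeasure_mono) auto
    also have "\<dots> < top"
      using S(3)[of n] by (simp add: less_top)
    finally show "c * emeasure M (A \<inter> S n) \<le> b"
      using assms(1) Sn[of n] by (intro assms(2)) auto
  qed
  finally show ?thesis .
qed

definition vector_weak_type :: "real \<Rightarrow> real \<Rightarrow> ennreal \<Rightarrow> bool" where
  "vector_weak_type r u C \<longleftrightarrow> (\<forall>f :: nat \<Rightarrow> 'a \<Rightarrow> ennreal. (\<forall>j. f j \<in> borel_measurable M) \<longrightarrow> (\<forall>m>0.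
    ennreal (m powr u) * emeasure M {x. ennreal m < (\<Sum>j. Mx (f j) x powre r)}
      \<le> C * (\<integral>\<^sup>+x. (\<Sum>j. f j x powre r) powre u \<partial>M)))"

text \<open>
  Let \<open>E\<close> be a part of \<open>{\<Gamma> > m}\<close> of finite measure and \<open>w\<close> an \<open>A\<^sub>1\<close> weight above its
  indicator, with \<open>\<integral>w\<^sup>u\<^sup>' \<le> K \<bar>E\<bar>\<close> for the conjugate exponent \<open>u'\<close>. Then
  \<open>m \<bar>E\<bar> \<le> \<integral>\<Gamma> w \<le> C \<integral>\<Phi> w\<close>, and Young's inequality splits the last integral into a multiple of \<open>\<integral>\<Phi>\<^sup>u\<close> and a
  multiple of \<open>\<bar>E\<bar>\<close> that is small enough to be absorbed on the left.
\<close>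

proposition vector_weak_type_upper:
  assumes r: "1 < r" and u: "1 < u"
  shows "\<exists>C<top. vector_weak_type r u C"
proof -
  define u' where "u' = u / (u - 1)"
  have u': "1 < u'"
    using u by (simp add: u'_def)
  obtain K where K: "K < top" and RdF: "\<And>g. g \<in> borel_measurable M \<Longrightarrow> (\<integral>\<^sup>+x. g x powre u' \<partial>M) < top \<Longrightarrow>
      (\<integral>\<^sup>+x. g x powre u' \<partial>M) \<noteq> 0 \<Longrightarrow>
      (\<exists>w. A1 K w \<and> (\<forall>x. g x \<le> w x) \<and> (\<integral>\<^sup>+x. w x powre u' \<partial>M) \<le> K * (\<integral>\<^sup>+x. g x powre u' \<partial>M))"
    using rubio_de_francia[OF u'] by auto
  obtain C where C: "C < top" "\<And>w f. A1 K w \<Longrightarrow> f \<in> borel_measurable M \<Longrightarrow>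
      (\<integral>\<^sup>+x. Mx f x powre r * w x \<partial>M) \<le> C * (\<integral>\<^sup>+x. f x powre r * w x \<partial>M)"
    using Mx_weighted[OF r K] by auto
  \<comment> \<open>The summand \<open>1\<close> makes \<open>L\<close> positive, so that it can be divided by.\<close>
  define L where "L = enn2real (C * K) + 1"
  have L: "0 < L" "C * K \<le> ennreal L"
  proof -
    show "0 < L"
      unfolding L_def by (simp add: add_nonneg_pos)
    have "C * K < top"
      using C(1) K by (simp add: ennreal_mult_less_top)
    then have "C * K = ennreal (enn2real (C * K))"
      by simp
    also have "\<dots> \<le> ennreal L"
      unfolding L_def by (intro ennreal_leI) simp
    finally show "C * K \<le> ennreal L" .
  qed
  define C' where "C' = ennreal (2 * (2 * L) powr (u - 1)) * C"
  have "ennreal (m powr u) * emeasure M {x. ennreal m < (\<Sum>j. Mx (f j) x powre r)}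
      \<le> C' * (\<integral>\<^sup>+x. (\<Sum>j. f j x powre r) powre u \<partial>M)"
    if f[measurable]: "\<And>j. f j \<in> borel_measurable M" and m: "0 < m" for f :: "nat \<Rightarrow> 'a \<Rightarrow> ennreal" and m :: real
  proof -
    define \<Phi> where "\<Phi> x = (\<Sum>j. f j x powre r)" for x
    define \<Gamma> where "\<Gamma> x = (\<Sum>j. Mx (f j) x powre r)" for x
    have [measurable]: "\<Phi> \<in> borel_measurable M" "\<Gamma> \<in> borel_measurable M"
      unfolding \<Phi>_def[abs_def] \<Gamma>_def[abs_def] by measurable
    have "ennreal (m powr u) * emeasure M {x\<in>space M. ennreal m < \<Gamma> x} \<le> C' * (\<integral>\<^sup>+x. \<Phi> x powre u \<partial>M)"
    proof (rule emeasure_le_if_finite_parts)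
      show "{x\<in>space M. ennreal m < \<Gamma> x} \<in> sets M"
        by measurable
      fix E assume E[measurable]: "E \<in> sets M" and E_sub: "E \<subseteq> {x\<in>space M. ennreal m < \<Gamma> x}"
        and E_fin: "emeasure M E < top"
      show "ennreal (m powr u) * emeasure M E \<le> C' * (\<integral>\<^sup>+x. \<Phi> x powre u \<partial>M)"
      proof (cases "emeasure M E = 0")
        case False
        have ind: "(indicator E x :: ennreal) powre u' = indicator E x" for x
          by (simp add: indicator_def)
        obtain w where w: "A1 K w" "\<And>x. indicator E x \<le> w x" "(\<integral>\<^sup>+x. w x powre u' \<partial>M) \<le> K * emeasure M E"
          using RdF[of "indicator E"] False E_fin by (auto simp: ind)
        have [measurable]: "w \<in> borel_measurable M"
          using w(1) by (rule A1_measurable)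
        \<comment> \<open>This scaling gives \<open>L t\<^sup>-\<^sup>u\<^sup>' = m / 2\<close>, half of the factor on the left-hand side.\<close>
        define t where "t = (2 * L / m) powr (1 / u')"
        have t: "0 < t" "t powr u = (2 * L / m) powr (u - 1)" "t powr - u' = m / (2 * L)"
        proof -
          show "0 < t"
            using L(1) m by (simp add: t_def)
          have "1 / u' * u = u - 1"
            using u by (simp add: u'_def field_simps)
          then show "t powr u = (2 * L / m) powr (u - 1)"
            by (simp add: t_def powr_powr)
          have "1 / u' * - u' = - 1"
            using u' by simp
          then show "t powr - u' = m / (2 * L)"
            using L(1) m by (simp only: t_def powr_powr) (simp add: powr_minus_divide)
        qed
        have young: "\<Phi> x * w x \<le> ennreal (t powr u) * \<Phi> x powre u + ennreal (t powr - u') * w x powre u'" for x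
        proof -
          have "\<Phi> x * w x = (ennreal t * \<Phi> x) * (ennreal (1 / t) * w x)"
            using t(1) by (simp add: mult.assoc mult.left_commute[of "\<Phi> x"])
              (simp add: mult.assoc[symmetric] ennreal_mult[symmetric])
          also have "\<dots> \<le> (ennreal t * \<Phi> x) powre u + (ennreal (1 / t) * w x) powre u'"
            unfolding u'_def by (rule young_crude[OF u])
          also have "\<dots> = ennreal (t powr u) * \<Phi> x powre u + ennreal (t powr - u') * w x powre u'"
            using t(1) u u' by (simp add: powre_mult powre_ennreal powr_divide powr_minus_divide)
          finally show ?thesis .
        qed
        have "ennreal m * emeasure M E = (\<integral>\<^sup>+x. ennreal m * indicator E x \<partial>M)"
          by (simp add: nn_integral_cmult_indicator)
        also have "\<dots> \<le> (\<integral>\<^sup>+x. \<Gamma> x * w x \<partial>M)"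
        proof (rule nn_integral_mono)
          fix x
          show "ennreal m * indicator E x \<le> \<Gamma> x * w x"
          proof (cases "x \<in> E")
            case True
            then have "ennreal m * indicator E x \<le> \<Gamma> x * indicator E x"
              using E_sub by (intro mult_right_mono) (auto intro: less_imp_le)
            also have "\<dots> \<le> \<Gamma> x * w x"
              by (intro mult_left_mono w(2)) simp
            finally show ?thesis .
          qed simp
        qed
        also have "\<dots> = (\<Sum>j. \<integral>\<^sup>+x. Mx (f j) x powre r * w x \<partial>M)"
          unfolding \<Gamma>_def by (subst nn_integral_suminf[symmetric]) (auto simp: ennreal_suminf_multc)
        also have "\<dots> \<le> (\<Sum>j. C * (\<integral>\<^sup>+x. f j x powre r * w x \<partial>M))"
          by (intro suminf_le C(2) w f) auto
        also have "\<dots> = C * (\<Sum>j. \<integral>\<^sup>+x. f j x powre r * w x \<partial>M)"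
          by simp
        also have "(\<Sum>j. \<integral>\<^sup>+x. f j x powre r * w x \<partial>M) = (\<integral>\<^sup>+x. \<Phi> x * w x \<partial>M)"
          unfolding \<Phi>_def by (subst nn_integral_suminf[symmetric]) (auto simp: ennreal_suminf_multc)
        also have "\<dots> \<le> (\<integral>\<^sup>+x. ennreal (t powr u) * \<Phi> x powre u + ennreal (t powr - u') * w x powre u' \<partial>M)"
          by (intro nn_integral_mono young)
        also have "\<dots> = ennreal (t powr u) * (\<integral>\<^sup>+x. \<Phi> x powre u \<partial>M) + ennreal (t powr - u') * (\<integral>\<^sup>+x. w x powre u' \<partial>M)"
          by (simp add: nn_integral_add nn_integral_cmult)
        also have "\<dots> \<le> ennreal (t powr u) * (\<integral>\<^sup>+x. \<Phi> x powre u \<partial>M) + ennreal (t powr - u') * (K * emeasure M E)"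
          by (intro add_left_mono mult_left_mono w(3)) simp
        finally have "ennreal m * emeasure M E \<le> C * (ennreal (t powr u) * (\<integral>\<^sup>+x. \<Phi> x powre u \<partial>M)
            + ennreal (t powr - u') * (K * emeasure M E))"
          by (simp add: mult_left_mono)
        also have "\<dots> = C * ennreal (t powr u) * (\<integral>\<^sup>+x. \<Phi> x powre u \<partial>M) + C * K * ennreal (t powr - u') * emeasure M E"
          by (simp add: distrib_left mult_ac)
        also have "\<dots> \<le> C * ennreal (t powr u) * (\<integral>\<^sup>+x. \<Phi> x powre u \<partial>M) + ennreal L * ennreal (t powr - u') * emeasure M E"
          by (intro add_left_mono mult_right_mono L(2)) auto
        also have "ennreal L * ennreal (t powr - u') = ennreal (m / 2)"
          using L(1) m by (simp add: t(3) ennreal_mult[symmetric])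
        finally have le: "ennreal m * emeasure M E
            \<le> C * ennreal (t powr u) * (\<integral>\<^sup>+x. \<Phi> x powre u \<partial>M) + ennreal (m / 2) * emeasure M E" .
        have "ennreal m = ennreal (m / 2) + ennreal (m / 2)"
          using m by (simp flip: ennreal_plus)
        then have "ennreal (m / 2) * emeasure M E + ennreal (m / 2) * emeasure M E
            \<le> ennreal (m / 2) * emeasure M E + C * ennreal (t powr u) * (\<integral>\<^sup>+x. \<Phi> x powre u \<partial>M)"
          using le by (simp add: distrib_right add.commute)
        moreover have "ennreal (m / 2) * emeasure M E \<noteq> \<infinity>"
          using E_fin by (simp add: ennreal_mult_eq_top_iff)
        ultimately have half: "ennreal (m / 2) * emeasure M E \<le> C * ennreal (t powr u) * (\<integral>\<^sup>+x. \<Phi> x powre u \<partial>M)"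
          using ennreal_add_left_cancel_le by blast
        have "m powr u = 2 * m powr (u - 1) * (m / 2)"
          using m powr_add[of m "u - 1" 1] by simp
        then have "ennreal (m powr u) = ennreal (2 * m powr (u - 1)) * ennreal (m / 2)"
          using m ennreal_mult[of "2 * m powr (u - 1)" "m / 2"] by simp
        then have "ennreal (m powr u) * emeasure M E = ennreal (2 * m powr (u - 1)) * (ennreal (m / 2) * emeasure M E)"
          by (simp only: mult.assoc)
        also have "\<dots> \<le> ennreal (2 * m powr (u - 1)) * (C * ennreal (t powr u) * (\<integral>\<^sup>+x. \<Phi> x powre u \<partial>M))"
          by (intro mult_left_mono half) simp
        also have "\<dots> = ennreal (2 * m powr (u - 1)) * ennreal (t powr u) * C * (\<integral>\<^sup>+x. \<Phi> x powre u \<partial>M)"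
          by (simp only: mult_ac)
        also have "ennreal (2 * m powr (u - 1)) * ennreal (t powr u) = ennreal (2 * (2 * L) powr (u - 1))"
          using m L(1) by (simp add: t(2) ennreal_mult[symmetric] powr_divide)
        finally show ?thesis
          by (simp add: C'_def)
      qed simp
    qed
    then show ?thesis
      by (simp add: \<Phi>_def \<Gamma>_def space_UNIV)
  qed
  moreover have "C' < top"
    using C(1) by (simp add: C'_def ennreal_mult_less_top)
  ultimately show ?thesis
    unfolding vector_weak_type_def by blast
qed

lemma Mx_eq_0:
  assumes "AE x in M. f x = 0"
  shows "Mx f x = 0"
proof -
  have "(\<integral>\<^sup>+y\<in>B i. f y \<partial>M) = (\<integral>\<^sup>+y. 0 \<partial>M)" for i
    using assms by (intro nn_integral_cong_AE) auto
  then show ?thesis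
    unfolding Mx_alt by (intro antisym SUP_least) auto
qed

text \<open>
  Let \<open>w\<close> be an \<open>A\<^sub>1\<close> weight above \<open>\<Phi>\<^sup>e\<close>, with \<open>e (r - 1) = 1 - v\<close>, so that
  \<open>\<Phi> / w\<^sup>r\<^sup>-\<^sup>1 \<le> \<Phi>\<^sup>v\<close>. The condition \<open>v > 1/r\<close> says exactly that \<open>\<Phi>\<^sup>e\<close> lies in a space \<open>L\<^sup>P\<close> with
  \<open>P = v / e > 1\<close> when \<open>\<Phi>\<^sup>v\<close> is integrable. Where \<open>\<Gamma> > m\<close>, either \<open>w\<^sup>r\<^sup>-\<^sup>1\<close> exceeds \<open>m\<^sup>1\<^sup>-\<^sup>v\<close>, which
  the integral of \<open>w\<^sup>P\<close> controls, or \<open>\<Gamma> / w\<^sup>r\<^sup>-\<^sup>1\<close> is at least \<open>m\<^sup>v\<close>, which the dual weighted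
  inequality controls.
\<close>

proposition vector_weak_type_lower:
  assumes r: "1 < r" and v: "1 / r < v" "v < 1"
  shows "\<exists>C<top. vector_weak_type r v C"
proof -
  define e where "e = (1 - v) / (r - 1)"
  have v0: "0 < v"
    using r v(1) by (smt (verit) divide_pos_pos)
  have e: "0 < e" "e * (r - 1) = 1 - v"
    using r v(2) by (simp_all add: e_def)
  define P where "P = v / e"
  have "1 < v * r"
    using r v(1) by (simp add: field_simps)
  then have "e < v"
    using r v by (simp add: e_def field_simps)
  then have P: "1 < P" "e * P = v"
    using e(1) by (simp_all add: P_def)
  obtain K where K: "K < top" and RdF: "\<And>g. g \<in> borel_measurable M \<Longrightarrow> (\<integral>\<^sup>+x. g x powre P \<partial>M) < top \<Longrightarrow>
      (\<integral>\<^sup>+x. g x powre P \<partial>M) \<noteq> 0 \<Longrightarrow>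
      (\<exists>w. A1 K w \<and> (\<forall>x. g x \<le> w x) \<and> (\<integral>\<^sup>+x. w x powre P \<partial>M) \<le> K * (\<integral>\<^sup>+x. g x powre P \<partial>M))"
    using rubio_de_francia[OF P(1)] by auto
  obtain C where C: "C < top" "\<And>w f. A1 K w \<Longrightarrow> f \<in> borel_measurable M \<Longrightarrow>
      (\<integral>\<^sup>+x. Mx f x powre r / w x powre (r - 1) \<partial>M) \<le> C * (\<integral>\<^sup>+x. f x powre r / w x powre (r - 1) \<partial>M)"
    using Mx_weighted_dual[OF r K] by auto
  \<comment> \<open>The summand \<open>1\<close> keeps the bound true when \<open>C = K = 0\<close> and the integral of \<open>\<Phi>\<^sup>v\<close> is infinite.\<close>
  define C' where "C' = C + K + 1"
  have "ennreal (m powr v) * emeasure M {x. ennreal m < (\<Sum>j. Mx (f j) x powre r)}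
      \<le> C' * (\<integral>\<^sup>+x. (\<Sum>j. f j x powre r) powre v \<partial>M)"
    if f[measurable]: "\<And>j. f j \<in> borel_measurable M" and m: "0 < m" for f :: "nat \<Rightarrow> 'a \<Rightarrow> ennreal" and m :: real
  proof -
    define \<Phi> where "\<Phi> x = (\<Sum>j. f j x powre r)" for x
    define \<Gamma> where "\<Gamma> x = (\<Sum>j. Mx (f j) x powre r)" for x
    have [measurable]: "\<Phi> \<in> borel_measurable M" "\<Gamma> \<in> borel_measurable M"
      unfolding \<Phi>_def[abs_def] \<Gamma>_def[abs_def] by measurable
    let ?I = "\<integral>\<^sup>+x. \<Phi> x powre v \<partial>M"
    have "ennreal (m powr v) * emeasure M {x. ennreal m < \<Gamma> x} \<le> C' * ?I"
    proof (cases "?I = 0 \<or> ?I = top")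
      case True
      then show ?thesis
      proof
        assume "?I = 0"
        then have z: "AE x in M. \<Phi> x = 0"
          by (subst (asm) nn_integral_0_iff_AE) auto
        have "AE x in M. f j x = 0" for j
          using z
        proof eventually_elim
          case (elim x)
          have "f j x powre r \<le> \<Phi> x"
            unfolding \<Phi>_def using sum_le_suminf[of "\<lambda>j. f j x powre r" "{j}"] by simp
          then show ?case
            using elim by simp
        qed
        then have "Mx (f j) x = 0" for j x
          by (rule Mx_eq_0)
        then show ?thesis
          by (simp add: \<Gamma>_def)
      next
        assume "?I = top"
        then show ?thesis
          by (simp add: C'_def ennreal_mult_top)
      qed
    next
      case False
      define g where "g x = \<Phi> x powre e" for x
      have [measurable]: "g \<in> borel_measurable M"
        unfolding g_def[abs_def] by measurable
      have gP: "g x powre P = \<Phi> x powre v" for x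
        using P(2) by (simp add: g_def powre_powre)
      obtain w where w: "A1 K w" "\<And>x. g x \<le> w x" "(\<integral>\<^sup>+x. w x powre P \<partial>M) \<le> K * ?I"
        using RdF[of g] False by (auto simp: gP less_top)
      have [measurable]: "w \<in> borel_measurable M"
        using w(1) by (rule A1_measurable)
      have pointwise: "ennreal (m powr v) * indicator {x\<in>space M. ennreal m < \<Gamma> x} x
          \<le> \<Gamma> x / w x powre (r - 1) + w x powre P" for x
      proof (cases "ennreal m < \<Gamma> x")
        case True
        let ?z = "w x powre (r - 1)"
        have z0: "?z \<noteq> 0"
          using A1_pos[OF w(1), of x] by auto
        have "ennreal (m powr v) \<le> \<Gamma> x / ?z + w x powre P"
        proof (cases "?z \<le> ennreal (m powr (1 - v))")
          case le: True
          have "ennreal (m powr v) * ?z \<le> ennreal (m powr v) * ennreal (m powr (1 - v))"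
            using le by (rule mult_left_mono) simp
          also have "\<dots> = ennreal m"
            using m by (simp only: ennreal_powr_mult) simp
          finally have "ennreal (m powr v) * ?z / ?z \<le> \<Gamma> x / ?z"
            using True by (intro divide_right_mono_ennreal) simp
          moreover have "?z \<noteq> top"
            using le by (metis ennreal_neq_top top_unique)
          ultimately show ?thesis
            using z0 by (simp add: ennreal_mult_divide_eq add_increasing2)
        next
          case False
          have "1 - v \<noteq> 0" "P = (r - 1) * (v / (1 - v))"
            using e v r by (auto simp: P_def e_def)
          then have "w x powre P = ?z powre (v / (1 - v))"
            by (simp add: powre_powre)
          also have "\<dots> \<ge> ennreal (m powr (1 - v)) powre (v / (1 - v))"
            using False v v0 by (intro powre_mono) auto
          also have "ennreal (m powr (1 - v)) powre (v / (1 - v)) = ennreal (m powr v)"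
            using v by (simp add: powre_ennreal powr_powr)
          finally show ?thesis
            by (simp add: add_increasing)
        qed
        then show ?thesis
          by (simp add: indicator_def)
      qed simp
      have \<Phi>_le: "\<Phi> x / w x powre (r - 1) \<le> \<Phi> x powre v" for x
      proof (cases "\<Phi> x = 0 \<or> \<Phi> x = top")
        case True
        have "w x powre (r - 1) = top" if "\<Phi> x = top"
          using w(2)[of x] that by (simp add: g_def top_unique)
        then show ?thesis
          using True by auto
      next
        case False
        have "\<Phi> x powre (1 - v) = g x powre (r - 1)"
          by (simp add: g_def powre_powre e(2))
        also have "\<dots> \<le> w x powre (r - 1)"
          using r w(2) by (intro powre_mono) auto
        finally have "\<Phi> x / w x powre (r - 1) \<le> \<Phi> x / \<Phi> x powre (1 - v)"
          unfolding divide_ennreal_def by (intro mult_left_mono ennreal_inverse_antimono) auto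
        also have "\<dots> = \<Phi> x powre v * \<Phi> x powre (1 - v) / \<Phi> x powre (1 - v)"
          using v v0 by (simp add: powre_add)
        also have "\<dots> = \<Phi> x powre v"
          using False by (intro ennreal_mult_divide_eq) auto
        finally show ?thesis .
      qed
      have "ennreal (m powr v) * emeasure M {x\<in>space M. ennreal m < \<Gamma> x}
          = (\<integral>\<^sup>+x. ennreal (m powr v) * indicator {x\<in>space M. ennreal m < \<Gamma> x} x \<partial>M)"
        by (rule nn_integral_cmult_indicator[symmetric]) measurable
      also have "\<dots> \<le> (\<integral>\<^sup>+x. \<Gamma> x / w x powre (r - 1) + w x powre P \<partial>M)"
        by (intro nn_integral_mono pointwise)
      also have "\<dots> = (\<integral>\<^sup>+x. \<Gamma> x / w x powre (r - 1) \<partial>M) + (\<integral>\<^sup>+x. w x powre P \<partial>M)"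
        by (rule nn_integral_add) measurable
      also have "(\<integral>\<^sup>+x. \<Gamma> x / w x powre (r - 1) \<partial>M) = (\<Sum>j. \<integral>\<^sup>+x. Mx (f j) x powre r / w x powre (r - 1) \<partial>M)"
        unfolding \<Gamma>_def divide_ennreal_def
        by (subst nn_integral_suminf[symmetric]) (auto simp: ennreal_suminf_multc)
      also have "\<dots> \<le> (\<Sum>j. C * (\<integral>\<^sup>+x. f j x powre r / w x powre (r - 1) \<partial>M))"
        by (intro suminf_le C(2) w f) auto
      also have "\<dots> = C * (\<Sum>j. \<integral>\<^sup>+x. f j x powre r / w x powre (r - 1) \<partial>M)"
        by simp
      also have "(\<Sum>j. \<integral>\<^sup>+x. f j x powre r / w x powre (r - 1) \<partial>M) = (\<integral>\<^sup>+x. \<Phi> x / w x powre (r - 1) \<partial>M)"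
        unfolding \<Phi>_def divide_ennreal_def
        by (subst nn_integral_suminf[symmetric]) (auto simp: ennreal_suminf_multc)
      also have "C * \<dots> + (\<integral>\<^sup>+x. w x powre P \<partial>M) \<le> C * ?I + K * ?I"
        by (intro add_mono mult_left_mono nn_integral_mono \<Phi>_le w(3)) simp
      also have "\<dots> \<le> C' * ?I"
        by (simp add: C'_def distrib_right add_increasing2)
      finally show ?thesis
        by (simp add: add_mono space_UNIV)
    qed
    then show ?thesis
      by (simp add: \<Phi>_def \<Gamma>_def)
  qed
  moreover have "C' < top"
    using C(1) K by (simp add: C'_def)
  ultimately show ?thesis
    unfolding vector_weak_type_def by blast
qed

end

section \<open>The Lorentz quasi-norm\<close>

lemma distribution_fun_antimono:
  assumes "F \<in> borel_measurable lebesgue" "a \<le> b"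
  shows "distribution_fun F b \<le> distribution_fun F a"
proof -
  have [measurable]: "F \<in> borel_measurable lebesgue"
    by fact
  have "{x \<in> space lebesgue. F x > a} \<in> sets lebesgue"
    by measurable
  then show ?thesis
    unfolding distribution_fun_def using assms(2) by (intro emeasure_mono) auto
qed

text \<open>
  Rearrangement and distribution function are inverse to each other up to this symmetric relation. The
  direction from right to left uses the right continuity of the distribution function.
\<close>

lemma less_decr_rearrangement_iff:
  assumes F: "F \<in> borel_measurable lebesgue" and \<alpha>: "0 < \<alpha>"
  shows "ennreal \<alpha> < decr_rearrangement F t \<longleftrightarrow> ennreal t < distribution_fun F (ennreal \<alpha>)"
proof
  show "ennreal t < distribution_fun F (ennreal \<alpha>)" if "ennreal \<alpha> < decr_rearrangement F t"
  proof (rule ccontr)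
    assume "\<not> ennreal t < distribution_fun F (ennreal \<alpha>)"
    then have "decr_rearrangement F t \<le> ennreal \<alpha>"
      unfolding decr_rearrangement_def using \<alpha> by (intro Inf_lower) (auto simp: not_less)
    then show False
      using that by simp
  qed
  assume t: "ennreal t < distribution_fun F (ennreal \<alpha>)"
  have [measurable]: "F \<in> borel_measurable lebesgue"
    by fact
  define U where "U n = {x \<in> space lebesgue. F x > ennreal (\<alpha> + 1 / Suc n)}" for n
  have "(SUP n. emeasure lebesgue (U n)) = emeasure lebesgue (\<Union>n. U n)"
  proof (rule SUP_emeasure_incseq)
    show "range U \<subseteq> sets lebesgue"
      unfolding U_def by (intro image_subsetI) measurable
    have "ennreal (\<alpha> + 1 / Suc (Suc n)) \<le> ennreal (\<alpha> + 1 / Suc n)" for n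
      by (intro ennreal_leI) (simp add: frac_le)
    then show "incseq U"
      unfolding U_def by (intro incseq_SucI) (auto intro: order_le_less_trans)
  qed
  also have "(\<Union>n. U n) = {x. F x > ennreal \<alpha>}"
  proof (intro antisym subsetI)
    fix x assume "x \<in> (\<Union>n. U n)"
    then obtain n where "ennreal (\<alpha> + 1 / Suc n) < F x"
      by (auto simp: U_def)
    moreover have "ennreal \<alpha> \<le> ennreal (\<alpha> + 1 / Suc n)"
      by (intro ennreal_leI) simp
    ultimately show "x \<in> {x. F x > ennreal \<alpha>}"
      by auto
  next
    fix x assume "x \<in> {x. F x > ennreal \<alpha>}"
    then obtain z where z: "ennreal \<alpha> < z" "z < F x"
      using dense by blast
    then obtain b where b: "z = ennreal b" "0 \<le> b"
      by (cases z) auto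
    then have "0 < b - \<alpha>"
      using z(1) \<alpha> by (simp add: ennreal_less_iff)
    then obtain n where "1 / Suc n < b - \<alpha>"
      using nat_approx_posE by blast
    then have "ennreal (\<alpha> + 1 / Suc n) \<le> z"
      unfolding b(1) by (intro ennreal_leI) simp
    then have "ennreal (\<alpha> + 1 / Suc n) < F x"
      using z(2) by (rule order_le_less_trans)
    then show "x \<in> (\<Union>n. U n)"
      by (auto simp: U_def)
  qed
  finally have "ennreal t < (SUP n. emeasure lebesgue (U n))"
    using t by (simp add: distribution_fun_def)
  then obtain n where n: "ennreal t < distribution_fun F (ennreal (\<alpha> + 1 / Suc n))"
    by (auto simp: less_SUP_iff U_def distribution_fun_def)
  have "ennreal (\<alpha> + 1 / Suc n) \<le> decr_rearrangement F t"
    unfolding decr_rearrangement_def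
  proof (rule Inf_greatest, rule ccontr)
    fix b assume b: "b \<in> {\<alpha>. 0 < \<alpha> \<and> \<alpha> < \<infinity> \<and> distribution_fun F \<alpha> \<le> ennreal t}"
      and "\<not> ennreal (\<alpha> + 1 / Suc n) \<le> b"
    then have "distribution_fun F (ennreal (\<alpha> + 1 / Suc n)) \<le> distribution_fun F b"
      by (intro distribution_fun_antimono F) simp
    then show False
      using b n by auto
  qed
  moreover have "ennreal \<alpha> < ennreal (\<alpha> + 1 / Suc n)"
    using \<alpha> by (simp add: ennreal_less_iff)
  ultimately show "ennreal \<alpha> < decr_rearrangement F t"
    by (rule order_less_le_trans[rotated])
qed

lemma decr_rearrangement_antimono: "antimono (decr_rearrangement F)"
  unfolding decr_rearrangement_def
  by (intro antimonoI Inf_superset_mono) (auto intro: order_trans[OF _ ennreal_leI])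

lemma decr_rearrangement_measurable [measurable]: "decr_rearrangement F \<in> borel_measurable borel"
  by (rule borel_measurable_antimono_ennreal[OF decr_rearrangement_antimono])

lemma decr_rearrangement_powre:
  assumes F[measurable]: "F \<in> borel_measurable lebesgue" and e: "0 < e"
  shows "decr_rearrangement (\<lambda>x. F x powre e) t = decr_rearrangement F t powre e"
proof (rule ennreal_eqI_reals_below)
  fix \<alpha> :: real assume \<alpha>: "0 < \<alpha>"
  have iff: "ennreal \<alpha> < x powre e \<longleftrightarrow> ennreal (\<alpha> powr (1 / e)) < x" for x
  proof -
    have "ennreal \<alpha> = ennreal (\<alpha> powr (1 / e)) powre e"
      using e \<alpha> by (simp add: powre_ennreal powr_powr)
    then show ?thesis
      using powre_less_iff[OF e] by simp
  qed
  have "distribution_fun (\<lambda>x. F x powre e) (ennreal \<alpha>) = distribution_fun F (ennreal (\<alpha> powr (1 / e)))"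
    unfolding distribution_fun_def iff ..
  then show "ennreal \<alpha> < decr_rearrangement (\<lambda>x. F x powre e) t \<longleftrightarrow> ennreal \<alpha> < decr_rearrangement F t powre e"
    using \<alpha> by (simp add: iff less_decr_rearrangement_iff F)
qed

lemma lorentz_norm_powre:
  assumes F: "F \<in> borel_measurable lebesgue" and e: "0 < e" and p: "0 < p" and q: "0 < q"
  shows "lorentz_norm p q (\<lambda>x. F x powre e) = lorentz_norm (p * e) (q * ennreal e) F powre e"
proof -
  have base: "ennreal (t powr (1 / p)) * decr_rearrangement (\<lambda>x. F x powre e) t
      = (ennreal (t powr (1 / (p * e))) * decr_rearrangement F t) powre e" for t
    using e p by (simp add: decr_rearrangement_powre F powre_mult powre_ennreal powr_powr)
  show ?thesis
  proof (cases q)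
    case top
    then show ?thesis
      using e by (simp add: lorentz_norm_def base powre_SUP ennreal_top_mult)
  next
    case (real b)
    then have b: "0 < b"
      using q by simp
    have "q * ennreal e = ennreal (b * e)"
      using real e b by (simp add: ennreal_mult)
    then show ?thesis
      using real e p b by (simp add: lorentz_norm_def base powre_powre mult.commute[of e b])
  qed
qed

text \<open>
  The Lorentz quasi-norm through the distribution function: write the power of the rearrangement as an
  integral over levels, exchange the integrals, and integrate out the variable of the rearrangement.
\<close>

lemma lorentz_norm_powre_eq_integral:
  assumes F[measurable]: "F \<in> borel_measurable lebesgue" and p: "0 < p" and q: "0 < q"
  shows "lorentz_norm p (ennreal q) F powre q = ennreal q *
    (\<integral>\<^sup>+\<alpha>\<in>{0<..}. ennreal (\<alpha> powr (q - 1)) * distribution_fun F (ennreal \<alpha>) powre (q / p) \<partial>lborel)"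
proof -
  define w where "w t = ennreal (t powr (q / p - 1)) * indicator {0<..} t" for t :: real
  have [measurable]: "w \<in> borel_measurable borel"
    unfolding w_def[abs_def] by measurable
  have "lorentz_norm p (ennreal q) F powre q = ennreal (q / p) *
      (\<integral>\<^sup>+t\<in>{0<..}. (ennreal (t powr (1 / p)) * decr_rearrangement F t) powre q / ennreal t \<partial>lborel)"
    using q by (simp add: lorentz_norm_def powre_powre)
  also have "(\<integral>\<^sup>+t\<in>{0<..}. (ennreal (t powr (1 / p)) * decr_rearrangement F t) powre q / ennreal t \<partial>lborel)
      = (\<integral>\<^sup>+t. decr_rearrangement F t powre q * w t \<partial>lborel)"
  proof (rule nn_integral_cong, goal_cases)
    case (1 t)
    show ?case
    proof (cases "0 < t")
      case True
      have "ennreal (t powr (q / p)) / ennreal t = ennreal (t powr (q / p - 1))"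
        using True by (simp add: divide_ennreal powr_diff)
      then have "(ennreal (t powr (1 / p)) * decr_rearrangement F t) powre q / ennreal t
          = decr_rearrangement F t powre q * ennreal (t powr (q / p - 1))"
        using q by (simp add: powre_mult powre_ennreal powr_powr mult.commute[of "ennreal _"] ennreal_times_divide[symmetric])
      then show ?thesis
        using True by (simp add: w_def)
    qed (simp add: w_def)
  qed
  also have "\<dots> = ennreal q * (\<integral>\<^sup>+\<alpha>\<in>{0<..}. ennreal (\<alpha> powr (q - 1)) *
      emeasure (density lborel w) {t\<in>space lborel. ennreal \<alpha> < decr_rearrangement F t} \<partial>lborel)"
    using q by (intro lborel.layer_cake) measurable
  also have "\<dots> = ennreal q * (\<integral>\<^sup>+\<alpha>\<in>{0<..}. ennreal (\<alpha> powr (q - 1)) *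
      (ennreal (p / q) * distribution_fun F (ennreal \<alpha>) powre (q / p)) \<partial>lborel)"
  proof (intro arg_cong[where f = "(*) (ennreal q)"] nn_integral_cong, goal_cases)
    case (1 \<alpha>)
    have "emeasure (density lborel w) {t\<in>space lborel. ennreal \<alpha> < decr_rearrangement F t}
        = ennreal (p / q) * distribution_fun F (ennreal \<alpha>) powre (q / p)" if \<alpha>: "0 < \<alpha>"
    proof -
      let ?D = "distribution_fun F (ennreal \<alpha>)"
      have "emeasure (density lborel w) {t\<in>space lborel. ennreal \<alpha> < decr_rearrangement F t}
          = (\<integral>\<^sup>+t. w t * indicator {t\<in>space lborel. ennreal \<alpha> < decr_rearrangement F t} t \<partial>lborel)"
        by (rule emeasure_density) measurable
      also have "\<dots> = (\<integral>\<^sup>+t. ennreal (t powr (q / p - 1)) * indicator {t. 0 < t \<and> ennreal t < ?D} t \<partial>lborel)"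
        using \<alpha> by (intro nn_integral_cong) (auto simp: w_def indicator_def less_decr_rearrangement_iff)
      also have "\<dots> = ennreal (p / q) * (ennreal (q / p) * \<dots>)"
        using p q by (simp add: mult.assoc[symmetric] ennreal_mult[symmetric])
      also have "ennreal (q / p) * (\<integral>\<^sup>+t. ennreal (t powr (q / p - 1)) * indicator {t. 0 < t \<and> ennreal t < ?D} t \<partial>lborel)
          = ?D powre (q / p)"
        using p q by (intro powre_eq_nn_integral) simp
      finally show ?thesis .
    qed
    then show ?case
      by (auto simp: indicator_def)
  qed
  also have "\<dots> = ennreal q * (ennreal (p / q) * (\<integral>\<^sup>+\<alpha>\<in>{0<..}. ennreal (\<alpha> powr (q - 1)) *
      distribution_fun F (ennreal \<alpha>) powre (q / p) \<partial>lborel))"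
  proof -
    have "antimono (\<lambda>\<alpha>. distribution_fun F (ennreal \<alpha>))"
      by (intro antimonoI distribution_fun_antimono F ennreal_leI)
    then have [measurable]: "(\<lambda>\<alpha>. distribution_fun F (ennreal \<alpha>)) \<in> borel_measurable borel"
      by (rule borel_measurable_antimono_ennreal)
    show ?thesis
      by (subst nn_integral_cmult[symmetric]) (auto simp: mult_ac)
  qed
  also have "ennreal (q / p) * \<dots> = ennreal q * (\<integral>\<^sup>+\<alpha>\<in>{0<..}. ennreal (\<alpha> powr (q - 1)) *
      distribution_fun F (ennreal \<alpha>) powre (q / p) \<partial>lborel)"
  proof -
    have "ennreal (q / p) * ennreal (p / q) = 1"
      using p q by (simp add: ennreal_mult[symmetric])
    moreover have "a * (c * (b * d)) = c * d" if "a * b = 1" for a b c d :: ennreal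
    proof -
      have "a * (c * (b * d)) = (a * b) * (c * d)"
        by (simp only: mult_ac)
      then show ?thesis
        by (simp add: that)
    qed
    ultimately show ?thesis
      by blast
  qed
  finally show ?thesis .
qed

lemma weak_lorentz_norm_le_iff:
  assumes F: "F \<in> borel_measurable lebesgue" and p: "0 < p"
  shows "lorentz_norm p \<infinity> F \<le> L \<longleftrightarrow> (\<forall>\<alpha>>0. distribution_fun F (ennreal \<alpha>) \<le> (L / ennreal \<alpha>) powre p)"
proof -
  have div: "ennreal a * x \<le> L \<longleftrightarrow> x \<le> L / ennreal a" if "0 < a" for a x
    using that by (metis ennreal_less_zero_iff ennreal_neq_top less_top mult.commute order_less_irrefl
        divide_less_ennreal linorder_not_le)
  have root: "x powre (1 / p) \<le> y \<longleftrightarrow> x \<le> y powre p" for x y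
  proof -
    have "x powre (1 / p) \<le> y \<longleftrightarrow> (x powre (1 / p)) powre p \<le> y powre p"
      using powre_le_iff[OF p] by simp
    then show ?thesis
      using p by (simp add: powre_powre)
  qed
  have "lorentz_norm p \<infinity> F \<le> L \<longleftrightarrow> (\<forall>t>0. decr_rearrangement F t \<le> L / ennreal (t powr (1 / p)))"
    by (auto simp: lorentz_norm_def SUP_le_iff div)
  also have "\<dots> \<longleftrightarrow> (\<forall>t>0. \<forall>\<alpha>>0. ennreal \<alpha> < decr_rearrangement F t \<longrightarrow> ennreal \<alpha> \<le> L / ennreal (t powr (1 / p)))"
    by (meson ennreal_le_if_reals_below less_imp_le order_trans)
  also have "\<dots> \<longleftrightarrow> (\<forall>\<alpha>>0. \<forall>t>0. ennreal t < distribution_fun F (ennreal \<alpha>) \<longrightarrow> ennreal t \<le> (L / ennreal \<alpha>) powre p)"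
  proof -
    have "ennreal \<alpha> \<le> L / ennreal (t powr (1 / p)) \<longleftrightarrow> ennreal t \<le> (L / ennreal \<alpha>) powre p"
      if "0 < t" "0 < \<alpha>" for t \<alpha>
    proof -
      have "ennreal \<alpha> \<le> L / ennreal (t powr (1 / p)) \<longleftrightarrow> ennreal t powre (1 / p) \<le> L / ennreal \<alpha>"
        using that div[of \<alpha> "ennreal (t powr (1 / p))"] div[of "t powr (1 / p)" "ennreal \<alpha>"]
        by (simp add: powre_ennreal mult.commute)
      then show ?thesis
        by (simp add: root)
    qed
    then show ?thesis
      by (auto simp: less_decr_rearrangement_iff F)
  qed
  also have "\<dots> \<longleftrightarrow> (\<forall>\<alpha>>0. distribution_fun F (ennreal \<alpha>) \<le> (L / ennreal \<alpha>) powre p)"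
    by (meson ennreal_le_if_reals_below less_imp_le order_trans)
  finally show ?thesis .
qed

lemma lorentz_norm_mono:
  assumes G: "G \<in> borel_measurable lebesgue" and le: "\<And>x. F x \<le> G x" and q: "0 < q"
  shows "lorentz_norm p q F \<le> lorentz_norm p q G"
proof -
  have [measurable]: "G \<in> borel_measurable lebesgue"
    by fact
  have dist: "distribution_fun F \<alpha> \<le> distribution_fun G \<alpha>" for \<alpha>
  proof -
    have "{x \<in> space lebesgue. \<alpha> < G x} \<in> sets lebesgue"
      by measurable
    then show ?thesis
      unfolding distribution_fun_def using le
      by (intro emeasure_mono) (auto intro: order_less_le_trans)
  qed
  then have decr: "decr_rearrangement F t \<le> decr_rearrangement G t" for t
    unfolding decr_rearrangement_def by (intro Inf_superset_mono) (auto intro: order_trans)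
  show ?thesis
  proof (cases "q = \<infinity>")
    case True
    then show ?thesis
      using decr by (auto simp: lorentz_norm_def intro!: SUP_mono' mult_left_mono)
  next
    case False
    then have "0 < enn2real q"
      using q by (simp add: enn2real_positive_iff less_top)
    then show ?thesis
      using False decr unfolding lorentz_norm_def
      by (auto intro!: powre_mono mult_left_mono nn_integral_mono mult_right_mono divide_right_mono_ennreal)
  qed
qed

section \<open>Interpolation in Lorentz spaces\<close>

lemma sigma_finite_lebesgue: "sigma_finite_measure (lebesgue :: 'a::euclidean_space measure)"
proof
  let ?A = "range (\<lambda>n::nat. cball (0::'a) (real n))"
  have "\<exists>n::nat. norm x \<le> real n" for x :: 'a
    by (rule real_arch_simple)
  then have "\<Union>?A = space lebesgue"
    by auto
  moreover have "emeasure lebesgue (cball (0::'a) (real n)) \<noteq> \<infinity>" for n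
    using fmeasurableD2[OF lmeasurable_cball, of "0 :: 'a" "real n"] by simp
  ultimately show "\<exists>A. countable A \<and> A \<subseteq> sets (lebesgue :: 'a measure) \<and> \<Union>A = space lebesgue \<and>
      (\<forall>a\<in>A. emeasure lebesgue a \<noteq> \<infinity>)"
    by (intro exI[of _ ?A]) auto
qed

lemma layer_cake_lebesgue:
  assumes [measurable]: "h \<in> borel_measurable lebesgue" and a: "0 < a"
  shows "(\<integral>\<^sup>+x. h x powre a \<partial>lebesgue) = ennreal a *
    (\<integral>\<^sup>+l\<in>{0<..}. ennreal (l powr (a - 1)) * distribution_fun h (ennreal l) \<partial>lborel)"
proof -
  have "(\<integral>\<^sup>+x. h x powre a * 1 \<partial>lebesgue) = ennreal a *
      (\<integral>\<^sup>+l\<in>{0<..}. ennreal (l powr (a - 1)) *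
        emeasure (density lebesgue (\<lambda>_. 1)) {x \<in> space lebesgue. ennreal l < h x} \<partial>lborel)"
    using a by (intro sigma_finite_measure.layer_cake[OF sigma_finite_lebesgue]) auto
  then show ?thesis
    by (simp only: distribution_fun_def density_1 mult_1_right space_completion space_lborel space_borel UNIV_I simp_thms)
qed

text \<open>
  The truncation has the distribution function of \<open>\<Phi>\<close> at \<open>max m l\<close>. The gap between \<open>v\<close> and \<open>a\<close>
  makes the layer cake integral converge at infinity.
\<close>

lemma upper_truncation_bound:
  assumes \<Phi>[measurable]: "\<Phi> \<in> borel_measurable lebesgue" and v: "0 < v" "v < a" and m: "0 < m"
    and D: "\<And>s. m \<le> s \<Longrightarrow> distribution_fun \<Phi> (ennreal s) \<le> A * ennreal (s powr - a)"
  shows "(\<integral>\<^sup>+x. (\<Phi> x * indicator {x. ennreal m < \<Phi> x} x) powre v \<partial>lebesgue)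
    \<le> ennreal (a / (a - v)) * A * ennreal (m powr (v - a))"
proof -
  define h where "h x = \<Phi> x * indicator {x \<in> space lebesgue. ennreal m < \<Phi> x} x" for x
  have [measurable]: "h \<in> borel_measurable lebesgue"
    unfolding h_def[abs_def] by measurable
  have h_le: "distribution_fun h (ennreal l) \<le> A * ennreal (max m l powr - a)" for l
  proof -
    have "{x \<in> space lebesgue. \<Phi> x > ennreal (max m l)} \<in> sets lebesgue"
      by measurable
    moreover have "{x. ennreal l < h x} \<subseteq> {x \<in> space lebesgue. \<Phi> x > ennreal (max m l)}"
      by (auto simp: h_def max_def indicator_def split: if_splits)
    ultimately have "distribution_fun h (ennreal l) \<le> distribution_fun \<Phi> (ennreal (max m l))"
      unfolding distribution_fun_def using emeasure_mono by fastforce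
    also have "\<dots> \<le> A * ennreal (max m l powr - a)"
      by (rule D) simp
    finally show ?thesis .
  qed
  have "(\<integral>\<^sup>+x. (\<Phi> x * indicator {x. ennreal m < \<Phi> x} x) powre v \<partial>lebesgue) = (\<integral>\<^sup>+x. h x powre v \<partial>lebesgue)"
    by (simp add: h_def)
  also have "\<dots> = ennreal v * (\<integral>\<^sup>+l\<in>{0<..}. ennreal (l powr (v - 1)) * distribution_fun h (ennreal l) \<partial>lborel)"
    using v by (intro layer_cake_lebesgue) auto
  also have "\<dots> \<le> ennreal v * (\<integral>\<^sup>+l. A * (ennreal (m powr - a) * (ennreal (l powr (v - 1)) * indicator {0<..<m} l)
      + ennreal (l powr (- (a - v) - 1)) * indicator {m<..} l) \<partial>lborel)"
  proof (intro mult_left_mono nn_integral_mono_AE, goal_cases)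
    case 1
    show ?case
      using AE_lborel_singleton[of m]
    proof eventually_elim
      case (elim l)
      have "ennreal (l powr (v - 1)) * distribution_fun h (ennreal l)
          \<le> ennreal (l powr (v - 1)) * (A * ennreal (max m l powr - a))"
        by (intro mult_left_mono h_le) simp
      moreover have "ennreal (l powr (v - 1)) * ennreal (l powr - a) = ennreal (l powr (- (a - v) - 1))"
        by (subst ennreal_powr_mult) (simp add: algebra_simps)
      ultimately show ?case
        using elim m by (cases "0 < l"; cases "l < m") (auto simp: max_def mult_ac)
    qed
  qed simp
  also have "(\<integral>\<^sup>+l. A * (ennreal (m powr - a) * (ennreal (l powr (v - 1)) * indicator {0<..<m} l)
      + ennreal (l powr (- (a - v) - 1)) * indicator {m<..} l) \<partial>lborel)
      = A * (ennreal (m powr - a) * ennreal (m powr v / v) + ennreal (m powr - (a - v) / (a - v)))"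
    using v m nn_integral_powr_below[of v m] nn_integral_powr_above[of "a - v" m]
    by (simp add: nn_integral_cmult nn_integral_add)
  also have "ennreal v * \<dots> = A * ennreal (v * (m powr - a * (m powr v / v) + m powr - (a - v) / (a - v)))"
    using v by (simp add: ennreal_mult[symmetric] ennreal_plus[symmetric] mult.left_commute[of _ A] del: ennreal_plus)
  also have "v * (m powr - a * (m powr v / v) + m powr - (a - v) / (a - v)) = a / (a - v) * m powr (v - a)"
  proof -
    have "m powr - a * m powr v = m powr (v - a)"
      by (simp add: powr_add[symmetric])
    then have "v * (m powr - a * (m powr v / v) + m powr - (a - v) / (a - v)) = m powr (v - a) + v * m powr (v - a) / (a - v)"
      using v by (simp add: distrib_left)
    also have "\<dots> = a / (a - v) * m powr (v - a)"
      using v by (simp add: field_simps)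
    finally show ?thesis .
  qed
  also have "A * ennreal (a / (a - v) * m powr (v - a)) = ennreal (a / (a - v)) * A * ennreal (m powr (v - a))"
    using v by (subst ennreal_mult) (auto simp: mult_ac)
  finally show ?thesis .
qed

lemma lower_truncation_bound:
  assumes \<Phi>[measurable]: "\<Phi> \<in> borel_measurable lebesgue" and b: "0 < b" "b < u" and m: "0 < m"
    and D: "\<And>s. 0 < s \<Longrightarrow> s < m \<Longrightarrow> distribution_fun \<Phi> (ennreal s) \<le> A * ennreal (s powr - b)"
  shows "(\<integral>\<^sup>+x. (\<Phi> x * indicator {x. \<Phi> x \<le> ennreal m} x) powre u \<partial>lebesgue)
    \<le> ennreal (u / (u - b)) * A * ennreal (m powr (u - b))"
proof -
  define h where "h x = \<Phi> x * indicator {x \<in> space lebesgue. \<Phi> x \<le> ennreal m} x" for x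
  have [measurable]: "h \<in> borel_measurable lebesgue"
    unfolding h_def[abs_def] by measurable
  have h_le: "distribution_fun h (ennreal l) \<le> A * ennreal (l powr - b) * indicator {0<..<m} l" if "0 < l" for l
  proof (cases "l < m")
    case True
    have "{x \<in> space lebesgue. \<Phi> x > ennreal l} \<in> sets lebesgue"
      by measurable
    moreover have "{x. ennreal l < h x} \<subseteq> {x \<in> space lebesgue. \<Phi> x > ennreal l}"
      by (auto simp: h_def indicator_def split: if_splits)
    ultimately have "distribution_fun h (ennreal l) \<le> distribution_fun \<Phi> (ennreal l)"
      unfolding distribution_fun_def using emeasure_mono by fastforce
    then show ?thesis
      using D[of l] True that by (simp add: order_trans)
  next
    case False
    then have "ennreal m \<le> ennreal l"
      by (intro ennreal_leI) simp
    then have "{x. ennreal l < h x} = {}"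
      by (auto simp: h_def indicator_def)
    then show ?thesis
      by (simp add: distribution_fun_def)
  qed
  have "(\<integral>\<^sup>+x. (\<Phi> x * indicator {x. \<Phi> x \<le> ennreal m} x) powre u \<partial>lebesgue) = (\<integral>\<^sup>+x. h x powre u \<partial>lebesgue)"
    by (simp add: h_def)
  also have "\<dots> = ennreal u * (\<integral>\<^sup>+l\<in>{0<..}. ennreal (l powr (u - 1)) * distribution_fun h (ennreal l) \<partial>lborel)"
    using b by (intro layer_cake_lebesgue) auto
  also have "\<dots> \<le> ennreal u * (\<integral>\<^sup>+l. A * (ennreal (l powr (u - b - 1)) * indicator {0<..<m} l) \<partial>lborel)"
  proof (intro mult_left_mono nn_integral_mono, goal_cases)
    case (1 l)
    show ?case
    proof (cases "0 < l")
      case True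
      have "ennreal (l powr (u - 1)) * distribution_fun h (ennreal l)
          \<le> ennreal (l powr (u - 1)) * (A * ennreal (l powr - b) * indicator {0<..<m} l)"
        using True by (intro mult_left_mono h_le) auto
      also have "\<dots> = A * (ennreal (l powr (u - 1)) * ennreal (l powr - b) * indicator {0<..<m} l)"
        by (simp only: mult_ac)
      also have "ennreal (l powr (u - 1)) * ennreal (l powr - b) = ennreal (l powr (u - b - 1))"
        by (subst ennreal_powr_mult) (simp add: algebra_simps)
      finally show ?thesis
        using True by simp
    qed simp
  qed simp
  also have "\<dots> = ennreal u * (A * ennreal (m powr (u - b) / (u - b)))"
    using b m nn_integral_powr_below[of "u - b" m] by (simp add: nn_integral_cmult)
  also have "\<dots> = ennreal (u / (u - b)) * A * ennreal (m powr (u - b))"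
  proof -
    have "ennreal u * ennreal (m powr (u - b) / (u - b)) = ennreal (u / (u - b)) * ennreal (m powr (u - b))"
      using b by (simp add: ennreal_mult[symmetric])
    then show ?thesis
      by (metis mult.assoc mult.commute)
  qed
  finally show ?thesis .
qed

text \<open>
  A nonincreasing function is at least \<open>h s\<close> on \<open>(s/2, s)\<close>. In this way a supremum of
  \<open>s\<^sup>\<beta> h(s)\<close> over a range of \<open>s\<close> is bounded by an integral, with no convexity assumption.
\<close>

lemma powr_times_antimono_le_integral:
  assumes \<beta>: "0 < \<beta>"
  shows "\<exists>k<top. \<forall>h :: real \<Rightarrow> ennreal. antimono h \<longrightarrow> (\<forall>s>0. ennreal (s powr \<beta>) * h s
    \<le> k * (\<integral>\<^sup>+x\<in>{s / 2<..<s}. ennreal (x powr (\<beta> - 1)) * h x \<partial>lborel))"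
proof -
  define \<kappa> where "\<kappa> = min 1 ((1 / 2) powr (\<beta> - 1))"
  have \<kappa>: "0 < \<kappa>"
    by (simp add: \<kappa>_def)
  have "ennreal (s powr \<beta>) * h s
      \<le> ennreal (2 / \<kappa>) * (\<integral>\<^sup>+x\<in>{s / 2<..<s}. ennreal (x powr (\<beta> - 1)) * h x \<partial>lborel)"
    if h: "antimono h" and s: "0 < s" for h :: "real \<Rightarrow> ennreal" and s
  proof -
    have "s powr \<beta> = s powr (\<beta> - 1) * s"
      using s powr_add[of s "\<beta> - 1" 1] by simp
    then have "s powr \<beta> = 2 / \<kappa> * (\<kappa> * s powr (\<beta> - 1) * (s / 2))"
      using \<kappa> by (simp add: field_simps)
    also have "ennreal \<dots> = ennreal (2 / \<kappa>) * (ennreal (\<kappa> * s powr (\<beta> - 1)) * ennreal (s / 2))"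
    proof -
      have "0 \<le> 2 / \<kappa>" "0 \<le> \<kappa> * s powr (\<beta> - 1)" "0 \<le> s / 2"
        using \<kappa> s by auto
      then show ?thesis
        by (simp only: ennreal_mult mult_nonneg_nonneg)
    qed
    finally have "ennreal (s powr \<beta>) * h s = ennreal (2 / \<kappa>) * (ennreal (\<kappa> * s powr (\<beta> - 1)) * h s * ennreal (s / 2))"
      by (simp only: mult_ac)
    also have "ennreal (s / 2) = emeasure lborel {s / 2<..<s}"
      using s by simp
    also have "ennreal (\<kappa> * s powr (\<beta> - 1)) * h s * \<dots> = (\<integral>\<^sup>+x\<in>{s / 2<..<s}. ennreal (\<kappa> * s powr (\<beta> - 1)) * h s \<partial>lborel)"
      by (rule nn_integral_cmult_indicator[symmetric]) simp
    also have "\<dots> \<le> (\<integral>\<^sup>+x\<in>{s / 2<..<s}. ennreal (x powr (\<beta> - 1)) * h x \<partial>lborel)"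
    proof (rule nn_integral_mono)
      fix x
      show "ennreal (\<kappa> * s powr (\<beta> - 1)) * h s * indicator {s / 2<..<s} x
          \<le> ennreal (x powr (\<beta> - 1)) * h x * indicator {s / 2<..<s} x"
      proof (cases "x \<in> {s / 2<..<s}")
        case True
        define y where "y = x / s"
        have y: "1 / 2 < y" "y < 1" "x = y * s"
          using True s by (auto simp: y_def field_simps)
        have "\<kappa> \<le> y powr (\<beta> - 1)"
        proof (cases "1 \<le> \<beta>")
          case True
          then have "(1 / 2) powr (\<beta> - 1) \<le> y powr (\<beta> - 1)"
            using y by (intro powr_mono2) auto
          then show ?thesis
            by (simp add: \<kappa>_def min.coboundedI2)
        next
          case False
          then have "1 powr (\<beta> - 1) \<le> y powr (\<beta> - 1)"
            using y by (intro powr_mono2') auto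
          then show ?thesis
            by (simp add: \<kappa>_def min.coboundedI1)
        qed
        then have "\<kappa> * s powr (\<beta> - 1) \<le> x powr (\<beta> - 1)"
          using y s by (simp add: powr_mult mult_right_mono)
        moreover have "h s \<le> h x"
          using True antimonoD[OF h, of x s] by simp
        ultimately show ?thesis
          by (intro mult_mono ennreal_leI) auto
      qed simp
    qed
    finally show ?thesis
      by (simp add: mult_left_mono)
  qed
  then show ?thesis
    by (intro exI[of _ "ennreal (2 / \<kappa>)"]) auto
qed

lemma nn_integral_swap_region:
  fixes f g :: "real \<Rightarrow> ennreal"
  assumes [measurable]: "f \<in> borel_measurable borel" "g \<in> borel_measurable borel"
    "Measurable.pred (borel \<Otimes>\<^sub>M borel) (\<lambda>(m, x). R m x)"
  shows "(\<integral>\<^sup>+m. g m * (\<integral>\<^sup>+x. f x * of_bool (R m x) \<partial>lborel) \<partial>lborel)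
    = (\<integral>\<^sup>+x. f x * (\<integral>\<^sup>+m. g m * of_bool (R m x) \<partial>lborel) \<partial>lborel)"
proof -
  have pred: "Measurable.pred (borel \<Otimes>\<^sub>M borel) (\<lambda>z. R (fst z) (snd z))"
    using assms(3) by (simp add: case_prod_beta)
  have R1 [measurable]: "Measurable.pred borel (\<lambda>x. R m x)" for m
    using measurable_compose[OF measurable_Pair1' pred, of m] by simp
  have R2 [measurable]: "Measurable.pred borel (\<lambda>m. R m x)" for x
    using measurable_compose[OF measurable_Pair2' pred, of x] by simp
  have "(\<lambda>z. f (snd z) * g (fst z) * (if R (fst z) (snd z) then 1 else 0))
      \<in> borel_measurable (borel \<Otimes>\<^sub>M borel)"
    using pred by measurable
  then have meas: "(\<lambda>(m, x). f x * g m * of_bool (R m x)) \<in> borel_measurable (lborel \<Otimes>\<^sub>M lborel)"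
    by (simp add: case_prod_beta of_bool_def measurable_completion cong: measurable_cong_sets sets_pair_measure_cong)
  have "(\<integral>\<^sup>+m. g m * (\<integral>\<^sup>+x. f x * of_bool (R m x) \<partial>lborel) \<partial>lborel)
      = (\<integral>\<^sup>+m. (\<integral>\<^sup>+x. f x * g m * of_bool (R m x) \<partial>lborel) \<partial>lborel)"
    by (intro nn_integral_cong) (subst nn_integral_cmult[symmetric], auto simp: of_bool_def mult_ac)
  also have "\<dots> = (\<integral>\<^sup>+x. (\<integral>\<^sup>+m. f x * g m * of_bool (R m x) \<partial>lborel) \<partial>lborel)"
    using lborel_pair.Fubini'[OF meas] by simp
  also have "\<dots> = (\<integral>\<^sup>+x. f x * (\<integral>\<^sup>+m. g m * of_bool (R m x) \<partial>lborel) \<partial>lborel)"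
    by (intro nn_integral_cong) (subst nn_integral_cmult[symmetric], auto simp: of_bool_def mult_ac)
  finally show ?thesis .
qed

text \<open>
  The Hardy inequalities at exponent one, where they are identities by Tonelli's theorem.
\<close>

lemma hardy_upper:
  assumes [measurable]: "h \<in> borel_measurable borel" and \<gamma>: "0 < \<gamma>"
  shows "(\<integral>\<^sup>+m\<in>{0<..}. ennreal (m powr (\<gamma> - 1)) *
      (\<integral>\<^sup>+x\<in>{m / 2<..}. ennreal (x powr (\<beta> - 1)) * h x \<partial>lborel) \<partial>lborel)
    = ennreal (2 powr \<gamma> / \<gamma>) * (\<integral>\<^sup>+x\<in>{0<..}. ennreal (x powr (\<beta> + \<gamma> - 1)) * h x \<partial>lborel)"
    (is "?L = _")
proof -
  have "?L = (\<integral>\<^sup>+m. ennreal (m powr (\<gamma> - 1)) *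
      (\<integral>\<^sup>+x. ennreal (x powr (\<beta> - 1)) * h x * of_bool (0 < m \<and> m < 2 * x) \<partial>lborel) \<partial>lborel)"
  proof (rule nn_integral_cong, goal_cases)
    case (1 m)
    show ?case
      by (cases "0 < m") (auto simp: indicator_def intro!: arg_cong[where f = "(*) _"] nn_integral_cong)
  qed
  also have "\<dots> = (\<integral>\<^sup>+x. ennreal (x powr (\<beta> - 1)) * h x *
      (\<integral>\<^sup>+m. ennreal (m powr (\<gamma> - 1)) * of_bool (0 < m \<and> m < 2 * x) \<partial>lborel) \<partial>lborel)"
    by (rule nn_integral_swap_region) measurable
  also have "\<dots> = (\<integral>\<^sup>+x. ennreal (2 powr \<gamma> / \<gamma>) * (ennreal (x powr (\<beta> + \<gamma> - 1)) * h x * indicator {0<..} x) \<partial>lborel)"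
  proof (rule nn_integral_cong, goal_cases)
    case (1 x)
    have "(\<integral>\<^sup>+m. ennreal (m powr (\<gamma> - 1)) * of_bool (0 < m \<and> m < 2 * x) \<partial>lborel)
        = ennreal (2 powr \<gamma> / \<gamma>) * ennreal (x powr \<gamma>)" if "0 < x"
      using that \<gamma> nn_integral_powr_below[of \<gamma> "2 * x"]
      by (simp add: indicator_def powr_mult ennreal_mult[symmetric])
    moreover have "ennreal (x powr (\<beta> + \<gamma> - 1)) = ennreal (x powr (\<beta> - 1)) * ennreal (x powr \<gamma>)"
      by (subst ennreal_powr_mult) (simp add: algebra_simps)
    moreover have "(\<integral>\<^sup>+m. ennreal (m powr (\<gamma> - 1)) * of_bool (0 < m \<and> m < 2 * x) \<partial>lborel) = 0" if "\<not> 0 < x"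
    proof -
      have "(of_bool (0 < m \<and> m < 2 * x) :: ennreal) = 0" for m
        using that by simp
      then show ?thesis
        by (simp only: mult_zero_right nn_integral_const mult_zero_left)
    qed
    ultimately show ?case
      by (cases "0 < x") (simp_all add: mult_ac)
  qed
  also have "\<dots> = ennreal (2 powr \<gamma> / \<gamma>) * (\<integral>\<^sup>+x\<in>{0<..}. ennreal (x powr (\<beta> + \<gamma> - 1)) * h x \<partial>lborel)"
    by (rule nn_integral_cmult) measurable
  finally show ?thesis .
qed

lemma hardy_lower:
  assumes [measurable]: "h \<in> borel_measurable borel" and \<gamma>: "0 < \<gamma>"
  shows "(\<integral>\<^sup>+m\<in>{0<..}. ennreal (m powr (- \<gamma> - 1)) *
      (\<integral>\<^sup>+x\<in>{0<..<m}. ennreal (x powr (\<beta> - 1)) * h x \<partial>lborel) \<partial>lborel)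
    = ennreal (1 / \<gamma>) * (\<integral>\<^sup>+x\<in>{0<..}. ennreal (x powr (\<beta> - \<gamma> - 1)) * h x \<partial>lborel)"
    (is "?L = _")
proof -
  have "?L = (\<integral>\<^sup>+m. ennreal (m powr (- \<gamma> - 1)) *
      (\<integral>\<^sup>+x. ennreal (x powr (\<beta> - 1)) * h x * of_bool (0 < x \<and> x < m) \<partial>lborel) \<partial>lborel)"
  proof (rule nn_integral_cong, goal_cases)
    case (1 m)
    have "(\<integral>\<^sup>+x. ennreal (x powr (\<beta> - 1)) * h x * of_bool (0 < x \<and> x < m) \<partial>lborel) = 0" if "\<not> 0 < m"
    proof -
      have "(of_bool (0 < x \<and> x < m) :: ennreal) = 0" for x
        using that by simp
      then show ?thesis
        by (simp only: mult_zero_right nn_integral_const mult_zero_left)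
    qed
    then show ?case
      by (cases "0 < m") (auto simp: indicator_def intro!: arg_cong[where f = "(*) _"] nn_integral_cong)
  qed
  also have "\<dots> = (\<integral>\<^sup>+x. ennreal (x powr (\<beta> - 1)) * h x *
      (\<integral>\<^sup>+m. ennreal (m powr (- \<gamma> - 1)) * of_bool (0 < x \<and> x < m) \<partial>lborel) \<partial>lborel)"
    by (rule nn_integral_swap_region) measurable
  also have "\<dots> = (\<integral>\<^sup>+x. ennreal (1 / \<gamma>) * (ennreal (x powr (\<beta> - \<gamma> - 1)) * h x * indicator {0<..} x) \<partial>lborel)"
  proof (rule nn_integral_cong, goal_cases)
    case (1 x)
    have "(\<integral>\<^sup>+m. ennreal (m powr (- \<gamma> - 1)) * of_bool (0 < x \<and> x < m) \<partial>lborel)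
        = ennreal (1 / \<gamma>) * ennreal (x powr - \<gamma>)" if "0 < x"
      using that \<gamma> nn_integral_powr_above[of \<gamma> x]
      by (simp add: indicator_def ennreal_mult[symmetric])
    moreover have "ennreal (x powr (\<beta> - \<gamma> - 1)) = ennreal (x powr (\<beta> - 1)) * ennreal (x powr - \<gamma>)"
      by (subst ennreal_powr_mult) (simp add: algebra_simps)
    ultimately show ?case
      by (cases "0 < x") (simp_all add: mult_ac)
  qed
  also have "\<dots> = ennreal (1 / \<gamma>) * (\<integral>\<^sup>+x\<in>{0<..}. ennreal (x powr (\<beta> - \<gamma> - 1)) * h x \<partial>lborel)"
    by (rule nn_integral_cmult) measurable
  finally show ?thesis .
qed

text \<open>
  What weak type inequalities at \<open>v\<close> and \<open>u\<close> yield for a sublinear operator taking \<open>\<Phi>\<close> to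
  \<open>\<Gamma>\<close>, when \<open>\<Phi>\<close> is cut at height \<open>m\<close>. The interpolation theorems use no other link between the two
  functions.
\<close>

definition truncation_bound :: "real \<Rightarrow> real \<Rightarrow> real \<Rightarrow> ennreal \<Rightarrow> ('a::euclidean_space \<Rightarrow> ennreal) \<Rightarrow> ('a \<Rightarrow> ennreal) \<Rightarrow> bool" where
  "truncation_bound v u c C \<Phi> \<Gamma> \<longleftrightarrow> (\<forall>m>0. distribution_fun \<Gamma> (ennreal (c * m)) \<le> C *
     (ennreal (m powr - v) * (\<integral>\<^sup>+x. (\<Phi> x * indicator {x. ennreal m < \<Phi> x} x) powre v \<partial>lebesgue) +
      ennreal (m powr - u) * (\<integral>\<^sup>+x. (\<Phi> x * indicator {x. \<Phi> x \<le> ennreal m} x) powre u \<partial>lebesgue)))"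

lemma truncation_boundD:
  assumes tb: "truncation_bound v u c C \<Phi> \<Gamma>" and \<Phi>: "\<Phi> \<in> borel_measurable lebesgue"
    and "0 < v" "v < a" "0 < b" "b < u" and m: "0 < m"
    and A: "\<And>s. m \<le> s \<Longrightarrow> distribution_fun \<Phi> (ennreal s) \<le> A * ennreal (s powr - a)"
    and A': "\<And>s. 0 < s \<Longrightarrow> s < m \<Longrightarrow> distribution_fun \<Phi> (ennreal s) \<le> A' * ennreal (s powr - b)"
  shows "distribution_fun \<Gamma> (ennreal (c * m)) \<le> C *
    (ennreal (a / (a - v)) * A * ennreal (m powr - a) + ennreal (u / (u - b)) * A' * ennreal (m powr - b))"
proof -
  have "distribution_fun \<Gamma> (ennreal (c * m)) \<le> C *
     (ennreal (m powr - v) * (\<integral>\<^sup>+x. (\<Phi> x * indicator {x. ennreal m < \<Phi> x} x) powre v \<partial>lebesgue) +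
      ennreal (m powr - u) * (\<integral>\<^sup>+x. (\<Phi> x * indicator {x. \<Phi> x \<le> ennreal m} x) powre u \<partial>lebesgue))"
    using tb m unfolding truncation_bound_def by blast
  also have "\<dots> \<le> C *
     (ennreal (m powr - v) * (ennreal (a / (a - v)) * A * ennreal (m powr (v - a))) +
      ennreal (m powr - u) * (ennreal (u / (u - b)) * A' * ennreal (m powr (u - b))))"
    using assms by (intro mult_left_mono add_mono upper_truncation_bound lower_truncation_bound) auto
  also have "ennreal (m powr - v) * (ennreal (a / (a - v)) * A * ennreal (m powr (v - a)))
      = ennreal (a / (a - v)) * A * (ennreal (m powr - v) * ennreal (m powr (v - a)))"
    by (simp only: mult_ac)
  also have "ennreal (m powr - v) * ennreal (m powr (v - a)) = ennreal (m powr - a)"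
    by (subst ennreal_powr_mult) simp
  also have "ennreal (m powr - u) * (ennreal (u / (u - b)) * A' * ennreal (m powr (u - b)))
      = ennreal (u / (u - b)) * A' * (ennreal (m powr - u) * ennreal (m powr (u - b)))"
    by (simp only: mult_ac)
  also have "ennreal (m powr - u) * ennreal (m powr (u - b)) = ennreal (m powr - b)"
    by (subst ennreal_powr_mult) simp
  finally show ?thesis .
qed

text \<open>
  For \<open>Q = \<infinity>\<close> the distribution function of \<open>\<Phi>\<close> is itself bounded by a power, and both truncation
  estimates apply with the exponent \<open>P\<close>.
\<close>

lemma weak_lorentz_interpolation:
  assumes v: "0 < v" "v < P" "P < u" and c: "0 < c" and C: "C < top"
  shows "\<exists>C'<top. \<forall>\<Phi> \<Gamma> :: 'a::euclidean_space \<Rightarrow> ennreal. \<Phi> \<in> borel_measurable lebesgue \<longrightarrow>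
    \<Gamma> \<in> borel_measurable lebesgue \<longrightarrow> truncation_bound v u c C \<Phi> \<Gamma> \<longrightarrow>
    lorentz_norm P \<infinity> \<Gamma> \<le> C' * lorentz_norm P \<infinity> \<Phi>"
proof -
  have P: "0 < P"
    using v by simp
  define \<kappa> where "\<kappa> = C * (ennreal (P / (P - v)) + ennreal (u / (u - P)))"
  define C' where "C' = \<kappa> powre (1 / P) * ennreal c"
  have "\<kappa> < top"
    using C by (simp add: \<kappa>_def ennreal_mult_less_top)
  then have "C' < top"
    by (simp add: C'_def ennreal_mult_less_top less_top[symmetric] ennreal_mult_eq_top_iff)
  moreover have "lorentz_norm P \<infinity> \<Gamma> \<le> C' * lorentz_norm P \<infinity> \<Phi>"
    if \<Phi>: "\<Phi> \<in> borel_measurable lebesgue" and \<Gamma>: "\<Gamma> \<in> borel_measurable lebesgue"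
      and tb: "truncation_bound v u c C \<Phi> \<Gamma>" for \<Phi> \<Gamma> :: "'a \<Rightarrow> ennreal"
  proof -
    define L where "L = lorentz_norm P \<infinity> \<Phi>"
    have D: "distribution_fun \<Phi> (ennreal s) \<le> L powre P * ennreal (s powr - P)" if "0 < s" for s
    proof -
      have "distribution_fun \<Phi> (ennreal s) \<le> (L / ennreal s) powre P"
        using weak_lorentz_norm_le_iff[OF \<Phi> P, of L] that by (auto simp: L_def)
      then show ?thesis
        using that by (simp add: ennreal_divide_powre)
    qed
    have "distribution_fun \<Gamma> (ennreal \<alpha>) \<le> (C' * L / ennreal \<alpha>) powre P" if \<alpha>: "0 < \<alpha>" for \<alpha>
    proof -
      define m where "m = \<alpha> / c"
      have m: "0 < m" "c * m = \<alpha>"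
        using \<alpha> c by (auto simp: m_def)
      have "distribution_fun \<Gamma> (ennreal \<alpha>) \<le> C *
          (ennreal (P / (P - v)) * L powre P * ennreal (m powr - P) + ennreal (u / (u - P)) * L powre P * ennreal (m powr - P))"
        using truncation_boundD[OF tb \<Phi> v(1,2) P v(3) m(1), of "L powre P" "L powre P"] D m by auto
      also have "\<dots> = \<kappa> * L powre P * ennreal (m powr - P)"
        by (simp add: \<kappa>_def distrib_left distrib_right mult.assoc)
      also have "m powr - P = c powr P * \<alpha> powr - P"
        using \<alpha> c by (simp add: m_def powr_divide powr_minus field_simps)
      also have "\<kappa> * L powre P * ennreal (c powr P * \<alpha> powr - P) = (C' * L) powre P * ennreal (\<alpha> powr - P)"
        using P c by (simp add: C'_def powre_mult powre_powre powre_ennreal ennreal_mult mult_ac)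
      also have "\<dots> = (C' * L / ennreal \<alpha>) powre P"
        using \<alpha> by (simp add: ennreal_divide_powre)
      finally show ?thesis .
    qed
    then show ?thesis
      unfolding L_def[symmetric] by (subst weak_lorentz_norm_le_iff[OF \<Gamma> P]) auto
  qed
  ultimately show ?thesis
    by blast
qed

text \<open>
  With \<open>\<theta> = q / P\<close> and exponents \<open>a\<close>, \<open>b\<close> strictly inside the two gaps \<open>v < a < P < b < u\<close>, the
  truncation estimates bound \<open>d\<^sub>\<Gamma>(c m)\<^sup>\<theta>\<close> by \<open>m\<^sup>-\<^sup>a\<^sup>\<theta> J(m) + m\<^sup>-\<^sup>b\<^sup>\<theta> J'(m)\<close>, where \<open>J\<close> and \<open>J'\<close> are
  integrals of \<open>d\<^sub>\<Phi>\<^sup>\<theta>\<close> above \<open>m/2\<close> and below \<open>m\<close>. The Hardy identities integrate this against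
  \<open>m\<^sup>q\<^sup>-\<^sup>1 dm\<close>.
\<close>

lemma strong_lorentz_interpolation:
  assumes v: "0 < v" "v < P" "P < u" and c: "0 < c" and C: "C < top" and q: "0 < q"
  shows "\<exists>C'<top. \<forall>\<Phi> \<Gamma> :: 'a::euclidean_space \<Rightarrow> ennreal. \<Phi> \<in> borel_measurable lebesgue \<longrightarrow>
    \<Gamma> \<in> borel_measurable lebesgue \<longrightarrow> truncation_bound v u c C \<Phi> \<Gamma> \<longrightarrow>
    lorentz_norm P (ennreal q) \<Gamma> \<le> C' * lorentz_norm P (ennreal q) \<Phi>"
proof -
  have P: "0 < P"
    using v by simp
  define \<theta> where "\<theta> = q / P"
  have \<theta>: "0 < \<theta>" "\<theta> * P = q"
    using q P by (simp_all add: \<theta>_def)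
  define a where "a = (v + P) / 2"
  define b where "b = (P + u) / 2"
  have a: "v < a" "a < P" "0 < a" and b: "P < b" "b < u" "0 < b"
    using v by (simp_all add: a_def b_def)
  define \<gamma> where "\<gamma> = q - a * \<theta>"
  define \<delta> where "\<delta> = b * \<theta> - q"
  have \<gamma>: "0 < \<gamma>" and \<delta>: "0 < \<delta>"
    using \<theta> a b by (auto simp: \<gamma>_def \<delta>_def mult.commute[of \<theta>] simp flip: \<theta>(2))
  obtain k where "k < top" and k: "\<And>h s. antimono h \<Longrightarrow> 0 < s \<Longrightarrow> ennreal (s powr (a * \<theta>)) * h s
    \<le> k * (\<integral>\<^sup>+x\<in>{s / 2<..<s}. ennreal (x powr (a * \<theta> - 1)) * h x \<partial>lborel)"
    using powr_times_antimono_le_integral[of "a * \<theta>"] \<theta>(1) a(3) by auto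
  obtain k' where "k' < top" and k': "\<And>h s. antimono h \<Longrightarrow> 0 < s \<Longrightarrow> ennreal (s powr (b * \<theta>)) * h s
    \<le> k' * (\<integral>\<^sup>+x\<in>{s / 2<..<s}. ennreal (x powr (b * \<theta> - 1)) * h x \<partial>lborel)"
    using powr_times_antimono_le_integral[of "b * \<theta>"] \<theta>(1) b(3) by auto
  define e where "e = C powre \<theta> * ennreal (2 powr \<theta>)"
  define \<kappa> where "\<kappa> = e * (ennreal (a / (a - v)) powre \<theta> * k)"
  define \<kappa>' where "\<kappa>' = e * (ennreal (u / (u - b)) powre \<theta> * k')"
  define K where "K = ennreal (c powr q) * (\<kappa> * ennreal (2 powr \<gamma> / \<gamma>) + \<kappa>' * ennreal (1 / \<delta>))"
  have "K < top"
    using \<open>k < top\<close> \<open>k' < top\<close> C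
    by (simp add: K_def \<kappa>_def \<kappa>'_def e_def less_top[symmetric] ennreal_mult_eq_top_iff)
  then have "K powre (1 / q) < top"
    by (simp add: less_top[symmetric])
  moreover have "lorentz_norm P (ennreal q) \<Gamma> \<le> K powre (1 / q) * lorentz_norm P (ennreal q) \<Phi>"
    if \<Phi>: "\<Phi> \<in> borel_measurable lebesgue" and \<Gamma>: "\<Gamma> \<in> borel_measurable lebesgue"
      and tb: "truncation_bound v u c C \<Phi> \<Gamma>" for \<Phi> \<Gamma> :: "'a \<Rightarrow> ennreal"
  proof -
    define h where "h x = distribution_fun \<Phi> (ennreal x) powre \<theta>" for x
    have h: "antimono h"
      unfolding h_def using \<theta>(1) by (intro antimonoI powre_mono distribution_fun_antimono \<Phi> ennreal_leI)
    have h_meas [measurable]: "h \<in> borel_measurable borel"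
      using h by (rule borel_measurable_antimono_ennreal)
    have "antimono (\<lambda>x. distribution_fun \<Gamma> (ennreal x))"
      by (intro antimonoI distribution_fun_antimono \<Gamma> ennreal_leI)
    then have [measurable]: "(\<lambda>x. distribution_fun \<Gamma> (ennreal x)) \<in> borel_measurable borel"
      by (rule borel_measurable_antimono_ennreal)
    define N where "N = (\<integral>\<^sup>+x\<in>{0<..}. ennreal (x powr (q - 1)) * h x \<partial>lborel)"
    define J where "J m = (\<integral>\<^sup>+x\<in>{m / 2<..}. ennreal (x powr (a * \<theta> - 1)) * h x \<partial>lborel)" for m
    define J' where "J' m = (\<integral>\<^sup>+x\<in>{0<..<m}. ennreal (x powr (b * \<theta> - 1)) * h x \<partial>lborel)" for m
    have [measurable]: "J \<in> borel_measurable borel"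
      unfolding J_def[abs_def]
      by (intro borel_measurable_antimono_ennreal antimonoI nn_integral_mono) (auto simp: indicator_def)
    have [measurable]: "J' \<in> borel_measurable borel"
      unfolding J'_def[abs_def]
      by (intro borel_measurable_mono_ennreal monoI nn_integral_mono) (auto simp: indicator_def)
    have pointwise: "distribution_fun \<Gamma> (ennreal (c * m)) powre \<theta>
        \<le> \<kappa> * (ennreal (m powr - (a * \<theta>)) * J m) + \<kappa>' * (ennreal (m powr - (b * \<theta>)) * J' m)" if m: "0 < m" for m
    proof -
      define A where "A = (k * J m) powre (1 / \<theta>)"
      define A' where "A' = (k' * J' m) powre (1 / \<theta>)"
      have A: "distribution_fun \<Phi> (ennreal s) \<le> A * ennreal (s powr - a)" if s: "m \<le> s" for s
        unfolding A_def
      proof (rule le_powre_times_powr_minus[OF \<theta>(1)])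
        show "0 < s"
          using s m by simp
        then have "ennreal (s powr (a * \<theta>)) * distribution_fun \<Phi> (ennreal s) powre \<theta>
            \<le> k * (\<integral>\<^sup>+x\<in>{s / 2<..<s}. ennreal (x powr (a * \<theta> - 1)) * h x \<partial>lborel)"
          using k[OF h] by (simp add: h_def)
        also have "\<dots> \<le> k * J m"
          unfolding J_def using s by (intro mult_left_mono nn_integral_mono) (auto simp: indicator_def)
        finally show "ennreal (s powr (a * \<theta>)) * distribution_fun \<Phi> (ennreal s) powre \<theta> \<le> k * J m" .
      qed
      have A': "distribution_fun \<Phi> (ennreal s) \<le> A' * ennreal (s powr - b)" if s: "0 < s" "s < m" for s
        unfolding A'_def
      proof (rule le_powre_times_powr_minus[OF \<theta>(1) s(1)])
        have "ennreal (s powr (b * \<theta>)) * distribution_fun \<Phi> (ennreal s) powre \<theta>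
            \<le> k' * (\<integral>\<^sup>+x\<in>{s / 2<..<s}. ennreal (x powr (b * \<theta> - 1)) * h x \<partial>lborel)"
          using k'[OF h s(1)] by (simp add: h_def)
        also have "\<dots> \<le> k' * J' m"
          unfolding J'_def using s by (intro mult_left_mono nn_integral_mono) (auto simp: indicator_def)
        finally show "ennreal (s powr (b * \<theta>)) * distribution_fun \<Phi> (ennreal s) powre \<theta> \<le> k' * J' m" .
      qed
      let ?X = "ennreal (a / (a - v)) * A * ennreal (m powr - a)"
      let ?Y = "ennreal (u / (u - b)) * A' * ennreal (m powr - b)"
      have X: "?X powre \<theta> = ennreal (a / (a - v)) powre \<theta> * k * (ennreal (m powr - (a * \<theta>)) * J m)"
        using \<theta>(1) m by (simp add: powre_mult A_def powre_powre powre_ennreal[of "m powr - a"] powr_powr mult_ac)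
      have Y: "?Y powre \<theta> = ennreal (u / (u - b)) powre \<theta> * k' * (ennreal (m powr - (b * \<theta>)) * J' m)"
        using \<theta>(1) m by (simp add: powre_mult A'_def powre_powre powre_ennreal[of "m powr - b"] powr_powr mult_ac)
      have "distribution_fun \<Gamma> (ennreal (c * m)) \<le> C * (?X + ?Y)"
        using A A' by (intro truncation_boundD[OF tb \<Phi> v(1) a(1) b(3,2) m])
      then have "distribution_fun \<Gamma> (ennreal (c * m)) powre \<theta> \<le> (C * (?X + ?Y)) powre \<theta>"
        by (rule powre_mono[OF \<theta>(1)])
      also have "\<dots> = C powre \<theta> * (?X + ?Y) powre \<theta>"
        using \<theta>(1) by (rule powre_mult)
      also have "\<dots> \<le> C powre \<theta> * (ennreal (2 powr \<theta>) * (?X powre \<theta> + ?Y powre \<theta>))"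
        by (intro mult_left_mono powre_add_le \<theta>(1)) simp
      also have "\<dots> = \<kappa> * (ennreal (m powr - (a * \<theta>)) * J m) + \<kappa>' * (ennreal (m powr - (b * \<theta>)) * J' m)"
        unfolding X Y by (simp only: \<kappa>_def \<kappa>'_def e_def distrib_left mult.assoc)
      finally show ?thesis .
    qed
    have int_J: "(\<integral>\<^sup>+m\<in>{0<..}. ennreal (m powr (\<gamma> - 1)) * J m \<partial>lborel) = ennreal (2 powr \<gamma> / \<gamma>) * N"
      unfolding J_def N_def using hardy_upper[OF h_meas \<gamma>, of "a * \<theta>"] by (simp add: \<gamma>_def)
    have int_J': "(\<integral>\<^sup>+m\<in>{0<..}. ennreal (m powr (- \<delta> - 1)) * J' m \<partial>lborel) = ennreal (1 / \<delta>) * N"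
      unfolding J'_def N_def using hardy_lower[OF h_meas \<delta>, of "b * \<theta>"] by (simp add: \<delta>_def)
    have "(\<integral>\<^sup>+\<alpha>\<in>{0<..}. ennreal (\<alpha> powr (q - 1)) * distribution_fun \<Gamma> (ennreal \<alpha>) powre \<theta> \<partial>lborel)
        = ennreal \<bar>c\<bar> * (\<integral>\<^sup>+m. ennreal ((0 + c * m) powr (q - 1)) * distribution_fun \<Gamma> (ennreal (0 + c * m)) powre \<theta>
            * indicator {0<..} (0 + c * m) \<partial>lborel)"
      using c by (intro nn_integral_real_affine) auto
    also have "\<dots> \<le> ennreal \<bar>c\<bar> * (\<integral>\<^sup>+m. ennreal (c powr (q - 1)) *
        (\<kappa> * (ennreal (m powr (\<gamma> - 1)) * J m * indicator {0<..} m)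
        + \<kappa>' * (ennreal (m powr (- \<delta> - 1)) * J' m * indicator {0<..} m)) \<partial>lborel)"
    proof (intro mult_left_mono nn_integral_mono, goal_cases)
      case (1 m)
      show ?case
      proof (cases "0 < m")
        case True
        have pw: "ennreal (m powr (q - 1)) * ennreal (m powr - (a * \<theta>)) = ennreal (m powr (\<gamma> - 1))"
          "ennreal (m powr (q - 1)) * ennreal (m powr - (b * \<theta>)) = ennreal (m powr (- \<delta> - 1))"
          by (subst ennreal_powr_mult, simp add: \<gamma>_def \<delta>_def algebra_simps)+
        have "ennreal ((c * m) powr (q - 1)) * distribution_fun \<Gamma> (ennreal (c * m)) powre \<theta>
            \<le> ennreal ((c * m) powr (q - 1)) * (\<kappa> * (ennreal (m powr - (a * \<theta>)) * J m) + \<kappa>' * (ennreal (m powr - (b * \<theta>)) * J' m))"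
          by (intro mult_left_mono pointwise True) simp
        also have cm: "ennreal ((c * m) powr (q - 1)) = ennreal (c powr (q - 1)) * ennreal (m powr (q - 1))"
          using c True by (simp add: powr_mult ennreal_mult)
        also have "ennreal (c powr (q - 1)) * ennreal (m powr (q - 1)) *
              (\<kappa> * (ennreal (m powr - (a * \<theta>)) * J m) + \<kappa>' * (ennreal (m powr - (b * \<theta>)) * J' m))
            = ennreal (c powr (q - 1)) * (\<kappa> * ((ennreal (m powr (q - 1)) * ennreal (m powr - (a * \<theta>))) * J m)
                + \<kappa>' * ((ennreal (m powr (q - 1)) * ennreal (m powr - (b * \<theta>))) * J' m))"
          by (simp only: distrib_left mult_ac)
        finally show ?thesis
          using True c by (simp add: pw cm)
      next
        case False
        then have "\<not> 0 < c * m"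
          using c by (simp add: zero_less_mult_iff)
        then show ?thesis
          by simp
      qed
    qed simp
    also have "\<dots> = ennreal \<bar>c\<bar> * (ennreal (c powr (q - 1)) * (\<kappa> * (ennreal (2 powr \<gamma> / \<gamma>) * N) + \<kappa>' * (ennreal (1 / \<delta>) * N)))"
      by (simp add: nn_integral_cmult nn_integral_add int_J int_J')
    also have "\<dots> = (ennreal c * ennreal (c powr (q - 1))) * (\<kappa> * (ennreal (2 powr \<gamma> / \<gamma>) * N) + \<kappa>' * (ennreal (1 / \<delta>) * N))"
      using c by (simp add: mult.assoc)
    also have "ennreal c * ennreal (c powr (q - 1)) = ennreal (c powr q)"
      using c ennreal_powr_mult[of c 1 "q - 1"] by simp
    also have "ennreal (c powr q) * (\<kappa> * (ennreal (2 powr \<gamma> / \<gamma>) * N) + \<kappa>' * (ennreal (1 / \<delta>) * N)) = K * N"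
      by (simp only: K_def distrib_left distrib_right mult.assoc)
    finally have "lorentz_norm P (ennreal q) \<Gamma> powre q \<le> ennreal q * (K * N)"
      unfolding lorentz_norm_powre_eq_integral[OF \<Gamma> P q] \<theta>_def[symmetric] by (rule mult_left_mono) simp
    also have "\<dots> = K * lorentz_norm P (ennreal q) \<Phi> powre q"
      unfolding lorentz_norm_powre_eq_integral[OF \<Phi> P q] \<theta>_def[symmetric] h_def[symmetric] N_def[symmetric]
      by (simp only: mult_ac)
    also have "\<dots> = (K powre (1 / q) * lorentz_norm P (ennreal q) \<Phi>) powre q"
      using q by (simp add: powre_mult powre_powre)
    finally show ?thesis
      using powre_le_iff[OF q] by blast
  qed
  ultimately show ?thesis
    by blast
qed

section \<open>The vector-valued inequality in a ball space\<close>

text \<open>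
  Split every \<open>f\<^sub>j\<close> according to whether \<open>\<Phi> > m\<close>. The common splitting set makes the \<open>\<ell>\<^sup>r\<close> sums of
  the pieces the two truncations of \<open>\<Phi>\<close>, to which the weak type inequalities below and above \<open>1\<close> apply.
\<close>

theorem vector_maximal_lorentz:
  fixes B :: "'i \<Rightarrow> 'a::euclidean_space set"
  assumes bs: "ball_space lebesgue B star rk D" and r: "1 < r" and P: "1 / r < P" and Q: "0 < Q"
  shows "\<exists>C<top. \<forall>f :: nat \<Rightarrow> 'a \<Rightarrow> ennreal. (\<forall>j. f j \<in> borel_measurable lebesgue) \<longrightarrow>
    lorentz_norm P Q (\<lambda>x. \<Sum>j. ball_space.maximal lebesgue B (\<lambda>_. 1) (f j) x powre r)
      \<le> C * lorentz_norm P Q (\<lambda>x. \<Sum>j. f j x powre r)"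
proof -
  interpret ball_space lebesgue B star rk D
    by (rule bs)
  define v where "v = (1 / r + min 1 P) / 2"
  define u where "u = max 1 P + 1"
  have lt: "1 / r < min 1 P"
    using r P by simp
  have "x < (x + y) / 2 \<and> (x + y) / 2 < y" if "x < y" for x y :: real
    using that by simp
  from this[OF lt] have v: "1 / r < v" "v < 1" "v < P"
    by (auto simp: v_def)
  have u: "1 < u" "P < u"
    by (auto simp: u_def)
  have v0: "0 < v"
    using v(1) r by (smt (verit) divide_pos_pos)
  obtain C1 where C1: "C1 < top" "vector_weak_type r v C1"
    using vector_weak_type_lower[OF r v(1,2)] by blast
  obtain C2 where C2: "C2 < top" "vector_weak_type r u C2"
    using vector_weak_type_upper[OF r u(1)] by blast
  \<comment> \<open>A factor \<open>2\<^sup>r\<close> from \<open>(y + z)\<^sup>r \<le> 2\<^sup>r (y\<^sup>r + z\<^sup>r)\<close>, and \<open>2\<close> from splitting the level between two summands.\<close>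
  define c where "c = 2 * 2 powr r"
  have c: "0 < c"
    by (simp add: c_def)
  have tb: "truncation_bound v u c (C1 + C2) (\<lambda>x. \<Sum>j. f j x powre r) (\<lambda>x. \<Sum>j. Mx (f j) x powre r)"
    if f: "\<forall>j. f j \<in> borel_measurable lebesgue" for f :: "nat \<Rightarrow> 'a \<Rightarrow> ennreal"
    unfolding truncation_bound_def
  proof (intro allI impI, goal_cases)
    case m: (1 m)
    have [measurable]: "f j \<in> borel_measurable lebesgue" for j
      using f by blast
    define \<Phi> where "\<Phi> x = (\<Sum>j. f j x powre r)" for x
    have [measurable]: "\<Phi> \<in> borel_measurable lebesgue"
      unfolding \<Phi>_def[abs_def] by measurable
    define f1 where "f1 j x = f j x * indicator {x \<in> space lebesgue. ennreal m < \<Phi> x} x" for j x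
    define f2 where "f2 j x = f j x * indicator {x \<in> space lebesgue. \<Phi> x \<le> ennreal m} x" for j x
    have f1_meas [measurable]: "f1 j \<in> borel_measurable lebesgue" and f2_meas [measurable]: "f2 j \<in> borel_measurable lebesgue" for j
      unfolding f1_def[abs_def] f2_def[abs_def] by measurable
    define \<Gamma> where "\<Gamma> g x = (\<Sum>j. Mx (g j) x powre r)" for g :: "nat \<Rightarrow> 'a \<Rightarrow> ennreal" and x
    have \<Gamma>_meas [measurable]: "\<Gamma> g \<in> borel_measurable lebesgue" for g
      unfolding \<Gamma>_def[abs_def] by measurable
    have Mx_le: "Mx (f j) x \<le> Mx (f1 j) x + Mx (f2 j) x" for j x
      unfolding Mx_alt[of "f j"]
    proof (rule SUP_least)
      fix i assume i: "i \<in> {i. x \<in> B i}"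
      have "(\<integral>\<^sup>+y\<in>B i. f j y \<partial>lebesgue) = (\<integral>\<^sup>+y. f1 j y * indicator (B i) y + f2 j y * indicator (B i) y \<partial>lebesgue)"
        by (intro nn_integral_cong) (auto simp: f1_def f2_def indicator_def not_le)
      also have "\<dots> = (\<integral>\<^sup>+y\<in>B i. f1 j y \<partial>lebesgue) + (\<integral>\<^sup>+y\<in>B i. f2 j y \<partial>lebesgue)"
        by (rule nn_integral_add) measurable
      finally have "(\<integral>\<^sup>+y\<in>B i. f j y \<partial>lebesgue) / emeasure lebesgue (B i)
          = (\<integral>\<^sup>+y\<in>B i. f1 j y \<partial>lebesgue) / emeasure lebesgue (B i) + (\<integral>\<^sup>+y\<in>B i. f2 j y \<partial>lebesgue) / emeasure lebesgue (B i)"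
        by (simp add: add_divide_distrib_ennreal)
      also have "\<dots> \<le> Mx (f1 j) x + Mx (f2 j) x"
        unfolding Mx_alt using i by (intro add_mono SUP_upper) auto
      finally show "(\<integral>\<^sup>+y\<in>B i. f j y \<partial>lebesgue) / emeasure lebesgue (B i) \<le> Mx (f1 j) x + Mx (f2 j) x" .
    qed
    have \<Gamma>_le: "\<Gamma> f x \<le> ennreal (2 powr r) * (\<Gamma> f1 x + \<Gamma> f2 x)" for x
    proof -
      have "\<Gamma> f x \<le> (\<Sum>j. ennreal (2 powr r) * (Mx (f1 j) x powre r + Mx (f2 j) x powre r))"
        unfolding \<Gamma>_def
      proof (rule suminf_le)
        fix j
        have "Mx (f j) x powre r \<le> (Mx (f1 j) x + Mx (f2 j) x) powre r"
          using r by (intro powre_mono Mx_le) auto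
        also have "\<dots> \<le> ennreal (2 powr r) * (Mx (f1 j) x powre r + Mx (f2 j) x powre r)"
          using r by (intro powre_add_le) auto
        finally show "Mx (f j) x powre r \<le> ennreal (2 powr r) * (Mx (f1 j) x powre r + Mx (f2 j) x powre r)" .
      qed auto
      also have "\<dots> = ennreal (2 powr r) * (\<Gamma> f1 x + \<Gamma> f2 x)"
        unfolding \<Gamma>_def by (simp add: suminf_add[symmetric])
      finally show ?thesis .
    qed
    have sub: "{x. ennreal (c * m) < \<Gamma> f x} \<subseteq> {x. ennreal m < \<Gamma> f1 x} \<union> {x. ennreal m < \<Gamma> f2 x}"
    proof (rule subsetI, rule ccontr)
      fix x assume x: "x \<in> {x. ennreal (c * m) < \<Gamma> f x}" "x \<notin> {x. ennreal m < \<Gamma> f1 x} \<union> {x. ennreal m < \<Gamma> f2 x}"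
      have "\<Gamma> f x \<le> ennreal (2 powr r) * (ennreal m + ennreal m)"
        using x(2) by (intro order_trans[OF \<Gamma>_le] mult_left_mono add_mono) auto
      also have "\<dots> = ennreal (c * m)"
        using m by (simp add: c_def ennreal_mult[symmetric] mult_ac flip: ennreal_plus)
      finally show False
        using x(1) by auto
    qed
    have level_sets: "{x. ennreal m < \<Gamma> g x} \<in> sets lebesgue" for g
    proof -
      have "{x \<in> space lebesgue. ennreal m < \<Gamma> g x} \<in> sets lebesgue"
        by measurable
      then show ?thesis
        by simp
    qed
    have \<Phi>1: "(\<Sum>j. f1 j x powre r) = \<Phi> x * indicator {x. ennreal m < \<Phi> x} x" for x
      using r by (simp add: f1_def \<Phi>_def powre_mult indicator_def)
    have \<Phi>2: "(\<Sum>j. f2 j x powre r) = \<Phi> x * indicator {x. \<Phi> x \<le> ennreal m} x" for x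
      using r by (simp add: f2_def \<Phi>_def powre_mult indicator_def)
    let ?I = "\<integral>\<^sup>+x. (\<Phi> x * indicator {x. ennreal m < \<Phi> x} x) powre v \<partial>lebesgue"
    let ?I' = "\<integral>\<^sup>+x. (\<Phi> x * indicator {x. \<Phi> x \<le> ennreal m} x) powre u \<partial>lebesgue"
    have cancel: "y \<le> ennreal (m powr - w) * z" if "ennreal (m powr w) * y \<le> z" for w y z
    proof -
      have "y = ennreal (m powr - w) * ennreal (m powr w) * y"
        using m by (simp add: ennreal_powr_mult)
      also have "\<dots> \<le> ennreal (m powr - w) * z"
        using that by (simp add: mult.assoc mult_left_mono)
      finally show ?thesis .
    qed
    have "distribution_fun (\<Gamma> f) (ennreal (c * m)) \<le> emeasure lebesgue ({x. ennreal m < \<Gamma> f1 x} \<union> {x. ennreal m < \<Gamma> f2 x})"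
      unfolding distribution_fun_def using level_sets by (intro emeasure_mono sub sets.Un)
    also have "\<dots> \<le> emeasure lebesgue {x. ennreal m < \<Gamma> f1 x} + emeasure lebesgue {x. ennreal m < \<Gamma> f2 x}"
      by (intro emeasure_subadditive level_sets)
    also have "\<dots> \<le> ennreal (m powr - v) * (C1 * ?I) + ennreal (m powr - u) * (C2 * ?I')"
      using C1(2)[unfolded vector_weak_type_def, rule_format, of f1 m]
        C2(2)[unfolded vector_weak_type_def, rule_format, of f2 m] m f1_meas f2_meas
      by (intro add_mono cancel) (simp_all add: \<Gamma>_def \<Phi>1 \<Phi>2)
    also have "\<dots> \<le> ennreal (m powr - v) * ((C1 + C2) * ?I) + ennreal (m powr - u) * ((C1 + C2) * ?I')"
      by (intro add_mono mult_left_mono mult_right_mono) auto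
    also have "\<dots> = (C1 + C2) * (ennreal (m powr - v) * ?I + ennreal (m powr - u) * ?I')"
      by (simp only: distrib_left mult.left_commute)
    finally show ?case
      by (simp add: \<Gamma>_def[abs_def] \<Phi>_def)
  qed
  have C12: "C1 + C2 < top"
    using C1(1) C2(1) by simp
  have "\<exists>C'<top. \<forall>\<Phi> \<Gamma> :: 'a \<Rightarrow> ennreal. \<Phi> \<in> borel_measurable lebesgue \<longrightarrow>
    \<Gamma> \<in> borel_measurable lebesgue \<longrightarrow> truncation_bound v u c (C1 + C2) \<Phi> \<Gamma> \<longrightarrow>
    lorentz_norm P Q \<Gamma> \<le> C' * lorentz_norm P Q \<Phi>"
  proof (cases Q)
    case (real q)
    then show ?thesis
      using strong_lorentz_interpolation[OF v0 v(3) u(2) c C12, of q] Q by simp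
  next
    case top
    then show ?thesis
      using weak_lorentz_interpolation[OF v0 v(3) u(2) c C12] by simp
  qed
  then obtain C' where C': "C' < top" "\<And>\<Phi> \<Gamma> :: 'a \<Rightarrow> ennreal. \<Phi> \<in> borel_measurable lebesgue \<Longrightarrow>
    \<Gamma> \<in> borel_measurable lebesgue \<Longrightarrow> truncation_bound v u c (C1 + C2) \<Phi> \<Gamma> \<Longrightarrow>
    lorentz_norm P Q \<Gamma> \<le> C' * lorentz_norm P Q \<Phi>"
    by blast
  have "lorentz_norm P Q (\<lambda>x. \<Sum>j. Mx (f j) x powre r) \<le> C' * lorentz_norm P Q (\<lambda>x. \<Sum>j. f j x powre r)"
    if f: "\<forall>j. f j \<in> borel_measurable lebesgue" for f :: "nat \<Rightarrow> 'a \<Rightarrow> ennreal"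
  proof (rule C'(2))
    have [measurable]: "f j \<in> borel_measurable lebesgue" for j
      using f by blast
    show "(\<lambda>x. \<Sum>j. f j x powre r) \<in> borel_measurable lebesgue"
      by measurable
    show "(\<lambda>x. \<Sum>j. Mx (f j) x powre r) \<in> borel_measurable lebesgue"
      by measurable
  qed (rule tb[OF f])
  then show ?thesis
    using C'(1) by blast
qed

section \<open>Balls of an expansive dilation\<close>

lemma expansive_imp_invertible:
  fixes A :: "real^'n^'n"
  assumes "expansive A"
  shows "invertible A"
proof -
  have "v = 0" if v: "A *v v = 0" for v :: "real^'n"
  proof (rule ccontr)
    assume "v \<noteq> 0"
    define w :: "complex^'n" where "w = (\<chi> i. complex_of_real (v $ i))"
    have "w \<noteq> 0"
      using \<open>v \<noteq> 0\<close> by (auto simp: w_def vec_eq_iff)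
    moreover have "(\<chi> i j. complex_of_real (A $ i $ j)) *v w = 0 *s w"
    proof -
      have "(\<Sum>j\<in>UNIV. A $ i $ j * v $ j) = 0" for i
        using v by (simp add: vec_eq_iff matrix_vector_mult_def)
      then have "(\<Sum>j\<in>UNIV. complex_of_real (A $ i $ j) * complex_of_real (v $ j)) = 0" for i
        by (metis (no_types, lifting) of_real_0 of_real_mult of_real_sum sum.cong)
      then show ?thesis
        by (simp add: vec_eq_iff matrix_vector_mult_def w_def)
    qed
    ultimately have "complex_eigenvalue A 0"
      unfolding complex_eigenvalue_def by blast
    then show False
      using assms unfolding expansive_def by fastforce
  qed
  then show ?thesis
    unfolding invertible_left_inverse matrix_left_invertible_ker by blast
qed

context
  fixes A :: "real^'n^'n"
  assumes A: "invertible A"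
begin

lemma matrix_inv_cancel: "A ** matrix_inv A = mat 1" "matrix_inv A ** A = mat 1"
  using A someI_ex[of "\<lambda>A'. A ** A' = mat 1 \<and> A' ** A = mat 1"]
  by (auto simp: invertible_def matrix_inv_def)

lemma matrix_powi_plus_one: "matrix_powi A (k + 1) = A ** matrix_powi A k"
proof (cases "0 \<le> k")
  case True
  then have "nat (k + 1) = Suc (nat k)"
    by simp
  then show ?thesis
    using True by (simp add: matrix_powi_def)
next
  case False
  then obtain n where n: "nat (- k) = Suc n" "nat (- (k + 1)) = n"
    by (intro that[of "nat (- (k + 1))"]) auto
  have "matrix_powi A (k + 1) = (((**) (matrix_inv A)) ^^ n) (mat 1)"
    using False n by (cases "k = -1") (auto simp: matrix_powi_def)
  moreover have "matrix_powi A k = matrix_inv A ** (((**) (matrix_inv A)) ^^ n) (mat 1)"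
    using False n by (simp add: matrix_powi_def)
  ultimately show ?thesis
    by (simp add: matrix_mul_assoc matrix_inv_cancel)
qed

lemma matrix_powi_0: "matrix_powi A 0 = mat 1"
  by (simp add: matrix_powi_def)

lemma matrix_mult_left_cancel: "A ** X = A ** Y \<Longrightarrow> X = Y"
  by (metis matrix_inv_cancel(2) matrix_mul_assoc matrix_mul_lid)

lemma matrix_powi_commute: "matrix_powi A k ** A = A ** matrix_powi A k"
proof (induction k rule: int_induct[where k = 0])
  case base
  then show ?case
    by (simp add: matrix_powi_0)
next
  case (step1 i)
  then show ?case
    by (simp add: matrix_powi_plus_one matrix_mul_assoc[symmetric])
next
  case (step2 i)
  have "A ** matrix_powi A (i - 1) = matrix_powi A i"
    using matrix_powi_plus_one[of "i - 1"] by simp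
  then have "A ** (matrix_powi A (i - 1) ** A) = A ** (A ** matrix_powi A (i - 1))"
    using step2 by (simp add: matrix_mul_assoc)
  then show ?case
    by (rule matrix_mult_left_cancel)
qed

text \<open>
  Negative powers are defined through the inverse matrix, so the induction runs in both directions from
  \<open>0\<close>.
\<close>

lemma matrix_powi_minus: "matrix_powi A k ** matrix_powi A (- k) = mat 1"
proof (induction k rule: int_induct[where k = 0])
  case base
  then show ?case
    by (simp add: matrix_powi_0)
next
  case (step1 i)
  have "matrix_powi A (- i) = A ** matrix_powi A (- (i + 1))"
    using matrix_powi_plus_one[of "- (i + 1)"] by simp
  moreover have "matrix_powi A (i + 1) = matrix_powi A i ** A"
    by (simp add: matrix_powi_plus_one matrix_powi_commute)
  ultimately show ?case
    using step1 by (metis matrix_mul_assoc)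
next
  case (step2 i)
  have "matrix_powi A (i - 1) ** (A ** matrix_powi A (- i)) = mat 1"
    using step2 matrix_powi_plus_one[of "i - 1"] by (simp add: matrix_mul_assoc matrix_powi_commute)
  then show ?case
    using matrix_powi_plus_one[of "- i"] by (simp add: algebra_simps)
qed

lemma matrix_powi_plus_nat: "matrix_powi A (k + int n) = matrix_powi A k ** matrix_powi A (int n)"
proof (induction n)
  case 0
  then show ?case
    by (simp add: matrix_powi_0)
next
  case (Suc n)
  have "matrix_powi A (k + int (Suc n)) = A ** matrix_powi A (k + int n)"
    using matrix_powi_plus_one[of "k + int n"] by (simp add: algebra_simps)
  also have "\<dots> = (matrix_powi A k ** A) ** matrix_powi A (int n)"
    using Suc by (simp add: matrix_mul_assoc matrix_powi_commute)
  also have "\<dots> = matrix_powi A k ** matrix_powi A (int n + 1)"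
    by (simp add: matrix_powi_plus_one matrix_mul_assoc)
  finally show ?case
    by (simp add: algebra_simps)
qed

end

text \<open>
  The inclusion \<open>c \<Delta> \<subseteq> A \<Delta>\<close> in terms of the norm \<open>\<parallel>P x\<parallel>\<close> with unit ball \<open>\<Delta>\<close>: the inverse of
  \<open>A\<close> contracts it by the factor \<open>1/c\<close>. The \<open>\<epsilon>\<close> accounts for the vector \<open>0\<close> and for the ellipsoid being open.
\<close>

lemma ellipsoid_gauge_contraction:
  fixes A P :: "real^'n^'n"
  assumes A: "invertible A" and c: "1 < c"
    and sub: "(\<lambda>x. c *\<^sub>R x) ` {x. norm (P *v x) < 1} \<subseteq> (*v) A ` {x. norm (P *v x) < 1}"
  shows "c * norm (P *v w) \<le> norm (P *v (A *v w))"
proof (rule field_le_epsilon)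
  fix e :: real assume e: "0 < e"
  define t where "t = norm (P *v (A *v w)) + e"
  have t: "0 < t"
    using e by (simp add: t_def add_nonneg_pos)
  have scale: "X *v (s *\<^sub>R y) = s *\<^sub>R (X *v y)" for X :: "real^'n^'n" and s y
    by (simp add: linear_cmul matrix_vector_mul_linear)
  have "norm (P *v ((1 / t) *\<^sub>R (A *v w))) < 1"
    using t e by (simp add: scale) (simp add: t_def)
  then have "c *\<^sub>R ((1 / t) *\<^sub>R (A *v w)) \<in> (*v) A ` {x. norm (P *v x) < 1}"
    using sub by blast
  then obtain y where y: "norm (P *v y) < 1" "c *\<^sub>R ((1 / t) *\<^sub>R (A *v w)) = A *v y"
    by auto
  then have "A *v ((c / t) *\<^sub>R w) = A *v y"
    by (simp add: scale)
  then have "(c / t) *\<^sub>R w = y"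
    using A by (metis matrix_inv_cancel(2) matrix_vector_mul_assoc matrix_vector_mul_lid)
  then have "norm (P *v ((c / t) *\<^sub>R w)) < 1"
    using y(1) by simp
  then have "c * norm (P *v w) < t"
    using c t by (simp add: scale field_simps)
  then show "c * norm (P *v w) \<le> norm (P *v (A *v w)) + e"
    by (simp add: t_def)
qed

text \<open>
  The set \<open>x + B\<^sub>k\<close> is the unit ball about \<open>x\<close> of a norm \<open>\<rho> k\<close>, and \<open>c \<rho> (k + 1) \<le> \<rho> k\<close>. If two
  balls meet, the triangle inequality places the smaller one in the \<open>\<rho> k\<close>-ball of radius \<open>3\<close>, which
  \<open>\<omega>\<close> further dilations with \<open>c\<^sup>\<omega> > 3\<close> cover; the enlargement of \<open>(x, k)\<close> is therefore \<open>(x, k + \<omega>)\<close>.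
\<close>

theorem dilated_balls_ball_space:
  fixes A :: "real^'n^'n" and \<Delta> :: "(real^'n) set"
  assumes "expansive A" and ell: "centered_open_ellipsoid \<Delta>"
    and c: "1 < c" and sub: "(\<lambda>x. c *\<^sub>R x) ` \<Delta> \<subseteq> (\<lambda>x. A *v x) ` \<Delta>"
  shows "\<exists>star D. ball_space lebesgue (\<lambda>(x, k). (+) x ` dilated_ball A \<Delta> k) star snd D"
proof -
  have A: "invertible A"
    using assms(1) by (rule expansive_imp_invertible)
  obtain P :: "real^'n^'n" where P_inv: "invertible P" and P: "\<Delta> = {x. norm (P *v x) < 1}"
    using ell unfolding centered_open_ellipsoid_def by blast
  define \<rho> where "\<rho> k z = norm (P *v (matrix_powi A (- k) *v z))" for k z
  have contr: "c * \<rho> (k + 1) z \<le> \<rho> k z" for k z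
  proof -
    have "matrix_powi A (- k) = A ** matrix_powi A (- (k + 1))"
      using matrix_powi_plus_one[OF A, of "- (k + 1)"] by simp
    then have "matrix_powi A (- k) *v z = A *v (matrix_powi A (- (k + 1)) *v z)"
      by (simp add: matrix_vector_mul_assoc)
    then show ?thesis
      unfolding \<rho>_def using ellipsoid_gauge_contraction[OF A c] sub P by metis
  qed
  have contr_n: "c ^ n * \<rho> (k + int n) z \<le> \<rho> k z" for n k z
  proof (induction n)
    case (Suc n)
    have "c ^ Suc n * \<rho> (k + int (Suc n)) z = c ^ n * (c * \<rho> (k + int n + 1) z)"
      by (simp add: algebra_simps)
    also have "\<dots> \<le> c ^ n * \<rho> (k + int n) z"
      using c by (intro mult_left_mono contr) auto
    finally show ?case
      using Suc by simp
  qed simp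
  have \<rho>_nonneg: "0 \<le> \<rho> k z" for k z
    by (simp add: \<rho>_def)
  have \<rho>_add: "\<rho> k (y + z) \<le> \<rho> k y + \<rho> k z" for k y z
    by (simp add: \<rho>_def matrix_vector_right_distrib norm_triangle_ineq)
  have \<rho>_minus: "\<rho> k (y - z) = \<rho> k (z - y)" for k y z
    by (simp add: \<rho>_def matrix_vector_mult_diff_distrib norm_minus_commute)
  define B where "B = (\<lambda>(x, k). (+) x ` dilated_ball A \<Delta> k)"
  have mem: "y \<in> B (x, k) \<longleftrightarrow> \<rho> k (y - x) < 1" for x y k
  proof
    assume "y \<in> B (x, k)"
    then obtain z where z: "norm (P *v z) < 1" "y = x + matrix_powi A k *v z"
      by (auto simp: B_def dilated_ball_def P)
    have "matrix_powi A (- k) *v (y - x) = z"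
      using matrix_powi_minus[OF A, of "- k"] z(2) by (simp add: matrix_vector_mul_assoc)
    then show "\<rho> k (y - x) < 1"
      using z(1) by (simp add: \<rho>_def)
  next
    assume "\<rho> k (y - x) < 1"
    then have "matrix_powi A (- k) *v (y - x) \<in> \<Delta>"
      by (simp add: P \<rho>_def)
    moreover have "y = x + matrix_powi A k *v (matrix_powi A (- k) *v (y - x))"
      using matrix_powi_minus[OF A, of k] by (simp add: matrix_vector_mul_assoc)
    ultimately show "y \<in> B (x, k)"
      unfolding B_def dilated_ball_def by (auto intro!: imageI)
  qed
  have open_B: "open (B (x, k))" for x k
  proof -
    have "B (x, k) = {y. \<rho> k (y - x) < 1}"
      using mem by auto
    moreover have "continuous_on UNIV (\<lambda>y. \<rho> k (y - x))"
      unfolding \<rho>_def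
      by (intro continuous_intros linear_continuous_on_compose[OF _ matrix_vector_mul_linear])
    ultimately show ?thesis
      by (simp add: open_Collect_less continuous_on_const)
  qed
  have \<Delta>_bounded: "bounded \<Delta>"
  proof -
    have "\<Delta> \<subseteq> (*v) (matrix_inv P) ` ball 0 1"
    proof
      fix x assume "x \<in> \<Delta>"
      then have "P *v x \<in> ball 0 1"
        by (simp add: P)
      moreover have "x = matrix_inv P *v (P *v x)"
        using matrix_inv_cancel[OF P_inv] by (simp add: matrix_vector_mul_assoc)
      ultimately show "x \<in> (*v) (matrix_inv P) ` ball 0 1"
        by blast
    qed
    then show ?thesis
      by (rule bounded_subset[rotated]) (intro bounded_linear_image bounded_ball matrix_vector_mul_bounded_linear)
  qed
  have ball_bounded: "bounded (dilated_ball A \<Delta> k)" for k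
    unfolding dilated_ball_def by (intro bounded_linear_image \<Delta>_bounded matrix_vector_mul_bounded_linear)
  have B_0: "B (0, k) = dilated_ball A \<Delta> k" for k
    by (auto simp: B_def)
  have ball_lmeasurable: "dilated_ball A \<Delta> k \<in> lmeasurable" for k
    using open_B[of 0 k] ball_bounded[of k] by (simp add: B_0 lmeasurable_open)
  define \<mu> where "\<mu> k = emeasure lebesgue (dilated_ball A \<Delta> k)" for k
  have emeasure_translate: "emeasure lebesgue ((+) x ` dilated_ball A \<Delta> k) = \<mu> k" for x k
    using ball_lmeasurable[of k] measurable_translation[OF ball_lmeasurable, of x k]
    by (simp add: \<mu>_def emeasure_eq_measure2 measure_translation)
  have \<mu>_B: "emeasure lebesgue (B (x, k)) = \<mu> k" for x k
    unfolding B_def by (simp add: emeasure_translate)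
  have \<mu>: "0 < \<mu> k \<and> \<mu> k < top" for k
  proof
    have "0 \<in> B (0, k)"
      by (simp add: mem \<rho>_def)
    then have "\<not> negligible (B (0, k))"
      using open_not_negligible open_B by blast
    then show "0 < \<mu> k"
      using open_B[of 0 k] ball_lmeasurable[of k]
      by (simp add: \<mu>_def B_0 negligible_iff_emeasure0 zero_less_iff_neq_zero fmeasurableD)
    show "\<mu> k < top"
      unfolding \<mu>_def less_top[symmetric] by (rule fmeasurableD2[OF ball_lmeasurable])
  qed
  obtain \<omega> where \<omega>: "3 < c ^ \<omega>"
    using c real_arch_pow by blast
  \<comment> \<open>By compactness finitely many translates of the ellipsoid cover its dilate, and dilating this
    cover bounds the doubling ratio at every scale.\<close>
  obtain F where F: "finite F" "dilated_ball A \<Delta> (int \<omega>) \<subseteq> (\<Union>y\<in>F. (+) y ` \<Delta>)"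
  proof -
    have "compact (closure (dilated_ball A \<Delta> (int \<omega>)))"
      using ball_bounded by (simp add: compact_closure)
    moreover have "(+) y ` \<Delta> = B (y, 0)" for y
      by (simp add: B_def dilated_ball_def matrix_powi_0[OF A])
    then have "open ((+) y ` \<Delta>)" for y
      using open_B by metis
    moreover have "y \<in> (+) y ` \<Delta>" for y
      by (rule image_eqI[of _ _ 0]) (auto simp: P)
    then have "closure (dilated_ball A \<Delta> (int \<omega>)) \<subseteq> (\<Union>y\<in>UNIV. (+) y ` \<Delta>)"
      by blast
    ultimately obtain F where "finite F" "closure (dilated_ball A \<Delta> (int \<omega>)) \<subseteq> (\<Union>y\<in>F. (+) y ` \<Delta>)"
      using compactE_image by (metis (no_types, lifting))
    then show ?thesis
      using that closure_subset by blast
  qed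
  have \<mu>_doubling: "\<mu> (k + int \<omega>) \<le> of_nat (card F) * \<mu> k" for k
  proof -
    have "dilated_ball A \<Delta> (k + int \<omega>) = (*v) (matrix_powi A k) ` dilated_ball A \<Delta> (int \<omega>)"
      by (simp add: dilated_ball_def matrix_powi_plus_nat[OF A] image_image matrix_vector_mul_assoc)
    also have "\<dots> \<subseteq> (*v) (matrix_powi A k) ` (\<Union>y\<in>F. (+) y ` \<Delta>)"
      using F(2) by (rule image_mono)
    also have "\<dots> = (\<Union>y\<in>F. (+) (matrix_powi A k *v y) ` dilated_ball A \<Delta> k)"
      by (simp add: dilated_ball_def image_UN image_image matrix_vector_right_distrib)
    finally have "\<mu> (k + int \<omega>) \<le> emeasure lebesgue (\<Union>y\<in>F. (+) (matrix_powi A k *v y) ` dilated_ball A \<Delta> k)"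
      unfolding \<mu>_def using F(1) ball_lmeasurable
      by (intro emeasure_mono sets.finite_UN fmeasurableD measurable_translation) auto
    also have "\<dots> \<le> (\<Sum>y\<in>F. emeasure lebesgue ((+) (matrix_powi A k *v y) ` dilated_ball A \<Delta> k))"
      using F(1) ball_lmeasurable
      by (intro emeasure_subadditive_finite) (auto intro!: fmeasurableD measurable_translation)
    also have "\<dots> = of_nat (card F) * \<mu> k"
      by (simp add: emeasure_translate)
    finally show ?thesis .
  qed
  have engulf: "B (y, j) \<subseteq> B (x, k + int \<omega>)" if jk: "j \<le> k" and ne: "B (x, k) \<inter> B (y, j) \<noteq> {}" for x y j k
  proof
    fix y' assume y': "y' \<in> B (y, j)"
    obtain z where z: "z \<in> B (x, k)" "z \<in> B (y, j)"
      using ne by auto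
    have le: "\<rho> k u \<le> \<rho> j u" for u
    proof -
      have "1 * \<rho> k u \<le> c ^ nat (k - j) * \<rho> k u"
        using c by (intro mult_right_mono one_le_power \<rho>_nonneg) auto
      also have "\<dots> \<le> \<rho> j u"
        using contr_n[of "nat (k - j)" j u] jk by simp
      finally show ?thesis
        by simp
    qed
    have "\<rho> k (y' - x) = \<rho> k ((y' - y) + ((y - z) + (z - x)))"
      by simp
    also have "\<dots> \<le> \<rho> k (y' - y) + (\<rho> k (y - z) + \<rho> k (z - x))"
      by (intro order_trans[OF \<rho>_add] add_left_mono \<rho>_add)
    also have "\<dots> < 1 + (1 + 1)"
      using y' z le[of "y' - y"] le[of "y - z"] by (simp add: mem \<rho>_minus[of _ y z])
    finally have "c ^ \<omega> * \<rho> (k + int \<omega>) (y' - x) < 3"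
      using contr_n[of \<omega> k "y' - x"] by simp
    also have "3 < c ^ \<omega> * 1"
      using \<omega> by simp
    finally have "\<rho> (k + int \<omega>) (y' - x) < 1"
      using c by simp
    then show "y' \<in> B (x, k + int \<omega>)"
      by (simp add: mem)
  qed
  have cover: "\<exists>I. countable I \<and> (\<forall>i\<in>I. x \<in> B i) \<and> (\<Union>i\<in>I. B i) = UNIV" for x
  proof (intro exI conjI)
    let ?I = "range (\<lambda>n. (x, int n))"
    show "countable ?I"
      by simp
    show "\<forall>i\<in>?I. x \<in> B i"
      by (auto simp: mem \<rho>_def)
    have "y \<in> (\<Union>i\<in>?I. B i)" for y
    proof -
      obtain n where n: "\<rho> 0 (y - x) < c ^ n"
        using c real_arch_pow by blast
      have "c ^ n * \<rho> (int n) (y - x) \<le> \<rho> 0 (y - x)"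
        using contr_n[of n 0 "y - x"] by simp
      then have "c ^ n * \<rho> (int n) (y - x) < c ^ n * 1"
        using n by simp
      then have "\<rho> (int n) (y - x) < 1"
        using c by (simp add: mult_less_cancel_left_pos)
      then have "y \<in> B (x, int n)"
        by (simp add: mem)
      then show ?thesis
        by blast
    qed
    then show "(\<Union>i\<in>?I. B i) = UNIV"
      by auto
  qed
  have "ball_space lebesgue B (\<lambda>(x, k). (x, k + int \<omega>)) snd (of_nat (card F))"
  proof (intro ball_space.intro ball_space_axioms.intro sigma_finite_lebesgue)
    show "sets borel \<subseteq> sets (lebesgue :: (real^'n) measure)"
      using sets_completionI_sets by (metis sets_lborel subsetI)
    show "open (B i)" for i
      using open_B by (cases i) auto
    show "0 < emeasure lebesgue (B i)" "emeasure lebesgue (B i) < top" for i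
      using \<mu> \<mu>_B by (cases i; simp)+
    show "B j \<subseteq> B (case i of (x, k) \<Rightarrow> (x, k + int \<omega>))" if "snd j \<le> snd i" "B i \<inter> B j \<noteq> {}" for i j
      using that by (cases i; cases j) (auto dest: engulf)
    show "emeasure lebesgue (B (case i of (x, k) \<Rightarrow> (x, k + int \<omega>))) \<le> of_nat (card F) * emeasure lebesgue (B i)" for i
      by (cases i) (simp add: \<mu>_B \<mu>_doubling)
    show "of_nat (card F) < (top :: ennreal)"
      by (simp add: of_nat_less_top)
    show "\<exists>I. countable I \<and> (\<forall>i\<in>I. x \<in> B i) \<and> (\<Union>i\<in>I. B i) = UNIV" for x
      by (rule cover)
  qed
  then show ?thesis
    unfolding B_def by blast
qed

lemma HL_maximal_eq_maximal:
  assumes "ball_space lebesgue (\<lambda>(x, k). (+) x ` dilated_ball A \<Delta> k) star rk D"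
  shows "HL_maximal A \<Delta> f x =
    ball_space.maximal lebesgue (\<lambda>(x, k). (+) x ` dilated_ball A \<Delta> k) (\<lambda>_. 1) (\<lambda>z. ennreal (cmod (f z))) x"
proof -
  interpret ball_space lebesgue "\<lambda>(x, k). (+) x ` dilated_ball A \<Delta> k" star rk D
    by (rule assms)
  let ?B = "\<lambda>(x, k). (+) x ` dilated_ball A \<Delta> k"
  have "{B \<in> dilated_balls A \<Delta>. x \<in> B} = ?B ` {i. x \<in> ?B i}"
    by (auto simp: dilated_balls_def)
  then show ?thesis
    unfolding HL_maximal_def Mx_alt by (simp only: image_image)
qed

section \<open>The Fefferman-Stein inequality in Lorentz spaces\<close>

theorem vector_HL_maximal_lorentz:
  fixes A :: "real^'n^'n" and s :: real and r :: ennreal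
  assumes "expansive A" "centered_open_ellipsoid \<Delta>" "c > 1" "(\<lambda>x. c *\<^sub>R x) ` \<Delta> \<subseteq> (\<lambda>x. A *v x) ` \<Delta>"
    and p: "0 < p" and q: "0 < q" and s: "0 < s" "ennreal s < min r (ennreal p)"
  shows "\<exists>C::real. C > 0 \<and> (\<forall>f :: nat \<Rightarrow> real^'n \<Rightarrow> complex. (\<forall>j. f j \<in> borel_measurable lebesgue) \<longrightarrow>
    lorentz_norm p q (\<lambda>x. lrs_norm r s (\<lambda>j. HL_maximal A \<Delta> (f j) x))
      \<le> ennreal C * lorentz_norm p q (\<lambda>x. lrs_norm r s (\<lambda>j. ennreal (cmod (f j x)))))"
proof -
  let ?B = "\<lambda>(x, k). (+) x ` dilated_ball A \<Delta> k"
  obtain star D where bs: "ball_space lebesgue ?B star snd D"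
    using dilated_balls_ball_space[OF assms(1-4)] by blast
  interpret ball_space lebesgue ?B star snd D
    by (rule bs)
  note HL = HL_maximal_eq_maximal[OF bs]
  have sp: "s < p"
    using s p by (simp add: ennreal_less_iff)
  define bounded_by where "bounded_by t e C \<longleftrightarrow>
    (\<forall>g :: nat \<Rightarrow> real^'n \<Rightarrow> ennreal. (\<forall>j. g j \<in> borel_measurable lebesgue) \<longrightarrow>
      lorentz_norm p q (\<lambda>x. (\<Sum>j. Mx (g j) x powre t) powre e)
        \<le> C * lorentz_norm p q (\<lambda>x. (\<Sum>j. g j x powre t) powre e))" for t e C
  have power_form: "\<exists>C<top. bounded_by t e C"
    if t: "1 < t" and e: "0 < e" "1 / t < p * e" for t e
  proof -
    have "0 < q * ennreal e"
      using q e by (simp add: ennreal_zero_less_mult_iff)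
    then obtain C where C: "C < top" "\<And>g :: nat \<Rightarrow> real^'n \<Rightarrow> ennreal. (\<forall>j. g j \<in> borel_measurable lebesgue) \<Longrightarrow>
        lorentz_norm (p * e) (q * ennreal e) (\<lambda>x. \<Sum>j. Mx (g j) x powre t)
          \<le> C * lorentz_norm (p * e) (q * ennreal e) (\<lambda>x. \<Sum>j. g j x powre t)"
      using vector_maximal_lorentz[OF bs t e(2)] by blast
    have "lorentz_norm p q (\<lambda>x. (\<Sum>j. Mx (g j) x powre t) powre e)
        \<le> C powre e * lorentz_norm p q (\<lambda>x. (\<Sum>j. g j x powre t) powre e)"
      if g: "\<forall>j. g j \<in> borel_measurable lebesgue" for g :: "nat \<Rightarrow> real^'n \<Rightarrow> ennreal"
    proof -
      have [measurable]: "g j \<in> borel_measurable lebesgue" for j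
        using g by blast
      have "lorentz_norm p q (\<lambda>x. (\<Sum>j. Mx (g j) x powre t) powre e)
          = lorentz_norm (p * e) (q * ennreal e) (\<lambda>x. \<Sum>j. Mx (g j) x powre t) powre e"
        by (intro lorentz_norm_powre e p q) measurable
      also have "\<dots> \<le> (C * lorentz_norm (p * e) (q * ennreal e) (\<lambda>x. \<Sum>j. g j x powre t)) powre e"
        by (intro powre_mono e C(2) g)
      also have "\<dots> = C powre e * lorentz_norm (p * e) (q * ennreal e) (\<lambda>x. \<Sum>j. g j x powre t) powre e"
        using e(1) by (rule powre_mult)
      also have "lorentz_norm (p * e) (q * ennreal e) (\<lambda>x. \<Sum>j. g j x powre t) powre e
          = lorentz_norm p q (\<lambda>x. (\<Sum>j. g j x powre t) powre e)"
        by (intro lorentz_norm_powre[symmetric] e p q) measurable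
      finally show ?thesis .
    qed
    then show ?thesis
      using C(1) by (intro exI[of _ "C powre e"]) (auto simp: bounded_by_def less_top[symmetric])
  qed
  have "\<exists>C<top. \<forall>f :: nat \<Rightarrow> real^'n \<Rightarrow> complex. (\<forall>j. f j \<in> borel_measurable lebesgue) \<longrightarrow>
    lorentz_norm p q (\<lambda>x. lrs_norm r s (\<lambda>j. HL_maximal A \<Delta> (f j) x))
      \<le> C * lorentz_norm p q (\<lambda>x. lrs_norm r s (\<lambda>j. ennreal (cmod (f j x))))"
  proof (cases r)
    case (real R)
    have R: "s < R" "0 < R"
      using s real by (auto simp: ennreal_less_iff)
    have "1 < R / s" "0 < 1 / R" "1 / (R / s) < p * (1 / R)"
      using R s(1) sp by (auto simp: field_simps)
    from power_form[OF this] obtain C where C: "C < top" "bounded_by (R / s) (1 / R) C"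
      by blast
    have "lorentz_norm p q (\<lambda>x. lrs_norm r s (\<lambda>j. HL_maximal A \<Delta> (f j) x))
        \<le> C * lorentz_norm p q (\<lambda>x. lrs_norm r s (\<lambda>j. ennreal (cmod (f j x))))"
      if "\<forall>j. f j \<in> borel_measurable lebesgue" for f :: "nat \<Rightarrow> real^'n \<Rightarrow> complex"
    proof -
      have [measurable]: "f j \<in> borel_measurable lebesgue" for j
        using that by blast
      show ?thesis
        using C(2)[unfolded bounded_by_def, rule_format, of "\<lambda>j x. ennreal (cmod (f j x))"] R real by (simp add: lrs_norm_def HL)
    qed
    then show ?thesis
      using C(1) by blast
  next
    case top
    have "(1::real) < 2" "0 < 1 / (2 * s)" "1 / 2 < p * (1 / (2 * s))"
      using s(1) sp by (auto simp: field_simps)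
    from power_form[OF this] obtain C where C: "C < top" "bounded_by 2 (1 / (2 * s)) C"
      by blast
    have "lorentz_norm p q (\<lambda>x. lrs_norm r s (\<lambda>j. HL_maximal A \<Delta> (f j) x))
        \<le> C * lorentz_norm p q (\<lambda>x. lrs_norm r s (\<lambda>j. ennreal (cmod (f j x))))"
      if "\<forall>j. f j \<in> borel_measurable lebesgue" for f :: "nat \<Rightarrow> real^'n \<Rightarrow> complex"
    proof -
      have f [measurable]: "f j \<in> borel_measurable lebesgue" for j
        using that by blast
      define \<Psi> where "\<Psi> x = (SUP j. ennreal (cmod (f j x)))" for x
      have [measurable]: "\<Psi> \<in> borel_measurable lebesgue"
        unfolding \<Psi>_def[abs_def] by measurable
      \<comment> \<open>For a sequence with one nonzero entry any finite exponent above \<open>1\<close> gives the same inequality; here it is \<open>2\<close>.\<close>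
      define g where "g j = (if j = 0 then \<Psi> else (\<lambda>_. 0))" for j :: nat
      have g_meas: "\<forall>j. g j \<in> borel_measurable lebesgue"
        by (simp add: g_def)
      have Mx_0: "Mx (\<lambda>_. 0) x = 0" for x
        by (intro Mx_eq_0) simp
      have sum: "(\<Sum>j. h j x powre 2) powre (1 / (2 * s)) = h 0 x powre (1 / s)"
        if "\<And>j. j \<noteq> 0 \<Longrightarrow> h j x = 0" for h :: "nat \<Rightarrow> real^'n \<Rightarrow> ennreal" and x
      proof -
        have "(\<Sum>j. h j x powre 2) = (\<Sum>j\<in>{0}. h j x powre 2)"
          using that by (intro suminf_finite) auto
        then show ?thesis
          by (simp add: powre_powre)
      qed
      have Mx_mono: "Mx (\<lambda>z. ennreal (cmod (f j z))) x \<le> Mx \<Psi> x" for j x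
        unfolding Mx_alt \<Psi>_def
        by (intro SUP_mono' divide_right_mono_ennreal nn_integral_mono mult_right_mono SUP_upper) auto
      have "lorentz_norm p q (\<lambda>x. lrs_norm r s (\<lambda>j. HL_maximal A \<Delta> (f j) x))
          \<le> lorentz_norm p q (\<lambda>x. (\<Sum>j. Mx (g j) x powre 2) powre (1 / (2 * s)))"
      proof (rule lorentz_norm_mono[OF _ _ q])
        show "(\<lambda>x. (\<Sum>j. Mx (g j) x powre 2) powre (1 / (2 * s))) \<in> borel_measurable lebesgue"
          by measurable
        fix x
        have "lrs_norm r s (\<lambda>j. HL_maximal A \<Delta> (f j) x) \<le> Mx \<Psi> x powre (1 / s)"
          using top s(1) by (auto simp: lrs_norm_def HL intro!: SUP_least powre_mono Mx_mono)
        then show "lrs_norm r s (\<lambda>j. HL_maximal A \<Delta> (f j) x) \<le> (\<Sum>j. Mx (g j) x powre 2) powre (1 / (2 * s))"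
          using sum[of "\<lambda>j. Mx (g j)" x] by (simp add: g_def Mx_0)
      qed
      also have "\<dots> \<le> C * lorentz_norm p q (\<lambda>x. (\<Sum>j. g j x powre 2) powre (1 / (2 * s)))"
        using C(2) g_meas unfolding bounded_by_def by blast
      also have "(\<lambda>x. (\<Sum>j. g j x powre 2) powre (1 / (2 * s))) = (\<lambda>x. lrs_norm r s (\<lambda>j. ennreal (cmod (f j x))))"
        using sum[of g] top s(1) by (auto simp: g_def lrs_norm_def \<Psi>_def powre_SUP)
      finally show ?thesis .
    qed
    then show ?thesis
      using C(1) by blast
  qed
  then obtain C where C: "C < top" "\<And>f :: nat \<Rightarrow> real^'n \<Rightarrow> complex. \<forall>j. f j \<in> borel_measurable lebesgue \<Longrightarrow>
    lorentz_norm p q (\<lambda>x. lrs_norm r s (\<lambda>j. HL_maximal A \<Delta> (f j) x))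
      \<le> C * lorentz_norm p q (\<lambda>x. lrs_norm r s (\<lambda>j. ennreal (cmod (f j x))))"
    by blast
  have "C = ennreal (enn2real C)"
    using C(1) by simp
  also have "\<dots> \<le> ennreal (enn2real C + 1)"
    by (intro ennreal_leI) simp
  finally have "C * y \<le> ennreal (enn2real C + 1) * y" for y
    by (rule mult_right_mono) simp
  then show ?thesis
    using C(2) by (intro exI[of _ "enn2real C + 1"]) (auto simp: add_nonneg_pos intro: order_trans)
qed

theorem lemma4p5:
  fixes A :: "real^'n^'n" and \<Delta> :: "(real^'n) set" and c :: real and r :: ennreal
  assumes "expansive A"
    and "centered_open_ellipsoid \<Delta>"
    and "emeasure lebesgue \<Delta> = 1"
    and "c > 1"
    and "\<Delta> \<subseteq> (\<lambda>x. c *\<^sub>R x) ` \<Delta>"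
    and "(\<lambda>x. c *\<^sub>R x) ` \<Delta> \<subseteq> (\<lambda>x. A *v x) ` \<Delta>"
    and "1 < r"
  shows "(\<forall>(p::real) (q::ennreal). 1 < p \<and> 0 < q \<longrightarrow>
           (\<exists>C9::real. C9 > 0 \<and>
             (\<forall>f :: nat \<Rightarrow> real^'n \<Rightarrow> complex. (\<forall>j. f j \<in> borel_measurable lebesgue) \<longrightarrow>
               lorentz_norm p q (\<lambda>x. lr_norm r (\<lambda>j. HL_maximal A \<Delta> (f j) x))
               \<le> ennreal C9 * lorentz_norm p q (\<lambda>x. lr_norm r (\<lambda>j. ennreal (cmod (f j x)))))))
       \<and> (\<forall>(p::real) (q::ennreal) (s::real).
           0 < p \<and> 0 < q \<and> 0 < s \<and> ennreal s < min r (ennreal p) \<longrightarrow>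
           (\<exists>C10::real. C10 > 0 \<and>
             (\<forall>f :: nat \<Rightarrow> real^'n \<Rightarrow> complex. (\<forall>j. f j \<in> borel_measurable lebesgue) \<longrightarrow>
               lorentz_norm p q (\<lambda>x. lrs_norm r s (\<lambda>j. HL_maximal A \<Delta> (f j) x))
               \<le> ennreal C10 * lorentz_norm p q (\<lambda>x. lrs_norm r s (\<lambda>j. ennreal (cmod (f j x)))))))"
proof (intro conjI allI impI, goal_cases)
  case (1 p q)
  have "lr_norm r = lrs_norm r 1"
    by (intro ext) (simp add: lr_norm_def lrs_norm_def)
  moreover have "ennreal 1 < min r (ennreal p)"
    using 1 \<open>1 < r\<close> by (simp add: ennreal_less_iff flip: ennreal_1)
  ultimately show ?case
    using vector_HL_maximal_lorentz[OF assms(1,2,4,6), of p q 1 r] 1 by simp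
next
  case (2 p q s)
  then show ?case
    using vector_HL_maximal_lorentz[OF assms(1,2,4,6)] by blast
qed

end
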